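(* Let $n\ge2$, let $\widetilde C_n$ have generators $r_0,\dots,r_n$, and for a homomorphism $\phi:\widetilde C_n\to W$ put $U^W_{\widetilde C_n}(q):=\sum_{w\in\widetilde C_n}q^{\ell_W(\phi(w))}$ with $\ell_W$ the length function of $W$. In each case below, $i$ ranges over $1\le i\le n-1$. \begin{enumerate} \item $\phi:\widetilde C_n\to\widetilde A_{2n+1}$, $\phi(r_0)=s_0s_{2n+1}s_0$, $\phi(r_n)=s_ns_{n+1}s_n$, $\phi(r_i)=s_is_{2n+1-i}$: $U=[n+1]_{-q}[n+1]_{(-1)^{n+1}q}\displaystyle\prod_{\substack{k=1\\k\ne n+1}}^{2n+1}\frac{[k]_{(-1)^kq}}{1+(-q)^k}$. \item $\phi:\widetilde C_n\to\widetilde A_{2n}$, $\phi(r_0)=s_0s_{2n}s_0$, $\phi(r_n)=s_n$, $\phi(r_i)=s_is_{2n-i}$: $U=\displaystyle\prod_{k=1}^{2n}\frac{[k+1]_{(-1)^{k+1}q}}{1+(-q)^k}$. \item $\phi:\widetilde C_n\to\widetilde A_{2n-1}$, $\phi(r_0)=s_0$, $\phi(r_n)=s_n$, $\phi(r_i)=s_is_{2n-i}$: $U=\displaystyle\prod_{k=2}^{2n}\frac{[k]_{(-1)^kq}}{1+(-q)^{k-1}}$. \item $\phi:\widetilde C_n\to\widetilde B_{n+1}$, $\phi(r_j)=s_j$ for $0\le j\le n-1$, $\phi(r_n)=s_ns_{n+1}$: $U=\displaystyle\frac{[2]_q[3]_{-q}[4]_q[2]_{-q^{n+1}}}{(1-q)(1-q^3)(1-q^5)}\prod_{k=3}^{n}\frac{[2k+1]_q-q^k}{1-q^{2k+1}}$.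 \item $\phi:\widetilde C_n\to\widetilde D_{n+2}$, $\phi(r_0)=s_0s_1$, $\phi(r_n)=s_{n+1}s_{n+2}$, $\phi(r_i)=s_{i+1}$: $U=[2]_q[3]_{-q}[4]_q\displaystyle\left(\prod_{k=3}^{n}\left([2k+1]_q-q^k\right)\right)\prod_{k=1}^{n}\frac{1+q^{k+1}}{1-q^{n+k+2}}$. \item $\phi:\widetilde C_n\to\widetilde C_{2n+1}$, $\phi(r_j)=s_js_{2n+1-j}$ for $0\le j\le n-1$, $\phi(r_n)=s_ns_{n+1}s_n$: $U=\displaystyle\left(\prod_{k=1}^{2n+1}[k]_{(-1)^kq}\right)\prod_{k=1}^{n}\frac{1+q^{2k}}{1-q^{2(n+k)+1}}$. \item $\phi:\widetilde C_n\to\widetilde C_{2n}$, $\phi(r_j)=s_js_{2n-j}$ for $0\le j\le n-1$, $\phi(r_n)=s_n$: $U=\displaystyle\left(\prod_{k=1}^{2n}[k]_{(-1)^kq}\right)\prod_{k=1}^{n}\frac{1+q^{2k}}{1-q^{2(n+k)-1}}$. \end{enumerate}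
   Context: $[k]_q:=1+q+\cdots+q^{k-1}$, and $[k]_{x}$ denotes the same polynomial evaluated at $x$. All groups are Coxeter groups: generators are involutions and pairs of distinct generators not listed commute. $\widetilde C_N$ ($N\ge2$): generators $s_0,\dots,s_N$ with $(s_0s_1)^4=(s_{N-1}s_N)^4=e$ and $(s_is_{i+1})^3=e$ for $1\le i\le N-2$ (for $\widetilde C_n$ itself the generators are called $r_0,\dots,r_n$). $\widetilde A_N$ ($N\ge2$): generators $s_0,\dots,s_N$, indices mod $N+1$, with $(s_is_{i+1})^3=e$. $\widetilde B_N$ ($N\ge3$): generators $s_0,\dots,s_N$ with $(s_0s_1)^4=e$, $(s_is_{i+1})^3=e$ for $1\le i\le N-3$, $(s_{N-2}s_{N-1})^3=(s_{N-2}s_N)^3=e$. $\widetilde D_N$ ($N\ge4$): generators $s_0,\dots,s_N$ with $(s_0s_2)^3=(s_1s_2)^3=e$, $(s_is_{i+1})^3=e$ for $2\le i\le N-3$, $(s_{N-2}s_{N-1})^3=(s_{N-2}s_N)^3=e$. In each part the assignment on generators extends to an injective group homomorphism (a folding subgroup). *)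

theory Defs
  imports
    "HOL-Analysis.Infinite_Sum"
    "HOL-Computational_Algebra.Formal_Power_Series"
    "HOL-Algebra.Group"
begin

section \<open>Coxeter groups by generators and relations\<close>

text \<open>A Coxeter system is given by its set \<open>S\<close> of generators and its Coxeter matrix
  \<open>m\<close>.  As \<open>m i i = 1\<close> in all matrices below, the relation \<open>(s\<^sub>i s\<^sub>j)^(m i j) = e\<close> for \<open>i = j\<close>
  says that the generators are involutions.  An entry \<open>0\<close> would impose no relation.\<close>

type_synonym 'a coxeter_datum = "'a set \<times> ('a \<Rightarrow> 'a \<Rightarrow> nat)"

inductive coxeter_equiv :: "'a coxeter_datum \<Rightarrow> 'a list \<Rightarrow> 'a list \<Rightarrow> bool"
  for X :: "'a coxeter_datum" where
  refl: "xs \<in> lists (fst X) \<Longrightarrow> coxeter_equiv X xs xs"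
| sym: "coxeter_equiv X xs ys \<Longrightarrow> coxeter_equiv X ys xs"
| trans: "coxeter_equiv X xs ys \<Longrightarrow> coxeter_equiv X ys zs \<Longrightarrow> coxeter_equiv X xs zs"
| relator: "us \<in> lists (fst X) \<Longrightarrow> vs \<in> lists (fst X) \<Longrightarrow> i \<in> fst X \<Longrightarrow> j \<in> fst X \<Longrightarrow>
    coxeter_equiv X (us @ concat (replicate (snd X i j) [i, j]) @ vs) (us @ vs)"

definition coxeter_class :: "'a coxeter_datum \<Rightarrow> 'a list \<Rightarrow> 'a list set" where
  "coxeter_class X xs = {ys. coxeter_equiv X xs ys}"

definition coxeter_group :: "'a coxeter_datum \<Rightarrow> 'a list set monoid" where
  "coxeter_group X =
     \<lparr>carrier = coxeter_class X ` lists (fst X),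
      mult = (\<lambda>A B. \<Union>a\<in>A. \<Union>b\<in>B. coxeter_class X (a @ b)),
      one = coxeter_class X []\<rparr>"

definition coxeter_gen :: "'a coxeter_datum \<Rightarrow> 'a \<Rightarrow> 'a list set" where
  "coxeter_gen X i = coxeter_class X [i]"

definition coxeter_length :: "'a coxeter_datum \<Rightarrow> 'a list set \<Rightarrow> nat" where
  "coxeter_length X w = (LEAST k. \<exists>xs \<in> lists (fst X). length xs = k \<and>
     w = foldr (\<lambda>i v. coxeter_gen X i \<otimes>\<^bsub>coxeter_group X\<^esub> v) xs \<one>\<^bsub>coxeter_group X\<^esub>)"

lemma coxeter_equiv_lists:
  assumes "coxeter_equiv X xs ys"
  shows "xs \<in> lists (fst X) \<and> ys \<in> lists (fst X)"
  using assms
  by (induction rule: coxeter_equiv.induct) (auto simp: in_lists_conv_set)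

lemma coxeter_equiv_append_right:
  "coxeter_equiv X xs ys \<Longrightarrow> zs \<in> lists (fst X) \<Longrightarrow> coxeter_equiv X (xs @ zs) (ys @ zs)"
proof (induction rule: coxeter_equiv.induct)
  case (relator us vs i j)
  then show ?case
    using coxeter_equiv.relator[of us X "vs @ zs" i j] by simp
next
  case (trans xs ys zs')
  then show ?case
    by (meson coxeter_equiv.trans)
qed (simp_all add: coxeter_equiv.refl coxeter_equiv.sym)

lemma coxeter_equiv_append_left:
  "coxeter_equiv X xs ys \<Longrightarrow> zs \<in> lists (fst X) \<Longrightarrow> coxeter_equiv X (zs @ xs) (zs @ ys)"
proof (induction rule: coxeter_equiv.induct)
  case (relator us vs i j)
  then show ?case
    using coxeter_equiv.relator[of "zs @ us" X vs i j] by simp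
next
  case (trans xs ys zs')
  then show ?case
    by (meson coxeter_equiv.trans)
qed (simp_all add: coxeter_equiv.refl coxeter_equiv.sym)

lemma coxeter_class_eq_iff:
  assumes "xs \<in> lists (fst X)" "ys \<in> lists (fst X)"
  shows "coxeter_class X xs = coxeter_class X ys \<longleftrightarrow> coxeter_equiv X xs ys"
proof
  assume "coxeter_class X xs = coxeter_class X ys"
  moreover have "ys \<in> coxeter_class X ys"
    using assms by (simp add: coxeter_class_def coxeter_equiv.refl)
  ultimately show "coxeter_equiv X xs ys"
    unfolding coxeter_class_def by blast
next
  assume "coxeter_equiv X xs ys"
  then have "coxeter_equiv X xs zs \<longleftrightarrow> coxeter_equiv X ys zs" for zs
    by (meson coxeter_equiv.sym coxeter_equiv.trans)
  then show "coxeter_class X xs = coxeter_class X ys"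
    by (simp add: coxeter_class_def)
qed

lemma coxeter_class_mult:
  assumes "xs \<in> lists (fst X)" "ys \<in> lists (fst X)"
  shows "coxeter_class X xs \<otimes>\<^bsub>coxeter_group X\<^esub> coxeter_class X ys = coxeter_class X (xs @ ys)"
proof -
  have "coxeter_class X (a @ b) = coxeter_class X (xs @ ys)"
    if "a \<in> coxeter_class X xs" "b \<in> coxeter_class X ys" for a b
  proof -
    have ab: "coxeter_equiv X xs a" "coxeter_equiv X ys b"
      using that by (auto simp: coxeter_class_def)
    have lists: "a \<in> lists (fst X)" "b \<in> lists (fst X)"
      using coxeter_equiv_lists[OF ab(1)] coxeter_equiv_lists[OF ab(2)] by simp_all
    have "coxeter_equiv X (xs @ ys) (a @ b)"
      by (rule coxeter_equiv.trans[OF coxeter_equiv_append_right[OF ab(1) assms(2)]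
            coxeter_equiv_append_left[OF ab(2) lists(1)]])
    then have "coxeter_equiv X (a @ b) (xs @ ys)"
      by (rule coxeter_equiv.sym)
    then show ?thesis
      using assms lists by (subst coxeter_class_eq_iff) simp_all
  qed
  moreover have "xs \<in> coxeter_class X xs" "ys \<in> coxeter_class X ys"
    using assms by (simp_all add: coxeter_class_def coxeter_equiv.refl)
  ultimately have "(\<Union>a\<in>coxeter_class X xs. \<Union>b\<in>coxeter_class X ys. coxeter_class X (a @ b))
      = coxeter_class X (xs @ ys)"
    by blast
  then show ?thesis
    by (simp add: coxeter_group_def)
qed

lemma group_coxeter_group:
  assumes "\<And>i. i \<in> fst X \<Longrightarrow> snd X i i = 1"
  shows "group (coxeter_group X)"
proof -
  have carr: "carrier (coxeter_group X) = coxeter_class X ` lists (fst X)"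
    and one: "\<one>\<^bsub>coxeter_group X\<^esub> = coxeter_class X []"
    by (simp_all add: coxeter_group_def)
  have inverse: "coxeter_class X (rev xs @ xs) = coxeter_class X []" if "xs \<in> lists (fst X)" for xs
    using that
  proof (induction xs)
    case (Cons x xs)
    have "coxeter_equiv X (rev xs @ [x, x] @ xs) (rev xs @ xs)"
      using coxeter_equiv.relator[of "rev xs" X xs x x] Cons.hyps assms[of x]
      by (simp add: in_lists_conv_set)
    then have "coxeter_class X (rev (x # xs) @ x # xs) = coxeter_class X (rev xs @ xs)"
      using Cons.hyps by (subst coxeter_class_eq_iff) (auto simp: in_lists_conv_set)
    then show ?case
      using Cons.IH by simp
  qed simp
  have rev: "rev xs \<in> lists (fst X)" if "xs \<in> lists (fst X)" for xs
    using that by (simp add: in_lists_conv_set)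
  show ?thesis
  proof (rule groupI)
    fix a b assume "a \<in> carrier (coxeter_group X)" "b \<in> carrier (coxeter_group X)"
    then obtain xs ys where *: "xs \<in> lists (fst X)" "ys \<in> lists (fst X)"
      "a = coxeter_class X xs" "b = coxeter_class X ys"
      unfolding carr by blast
    then have "xs @ ys \<in> lists (fst X)"
      by simp
    with * show "a \<otimes>\<^bsub>coxeter_group X\<^esub> b \<in> carrier (coxeter_group X)"
      unfolding carr by (metis coxeter_class_mult imageI)
  next
    show "\<one>\<^bsub>coxeter_group X\<^esub> \<in> carrier (coxeter_group X)"
      unfolding carr one by (metis lists.Nil imageI)
  next
    fix a b c
    assume "a \<in> carrier (coxeter_group X)" "b \<in> carrier (coxeter_group X)"
      "c \<in> carrier (coxeter_group X)"
    then obtain xs ys zs where *: "xs \<in> lists (fst X)" "ys \<in> lists (fst X)" "zs \<in> lists (fst X)"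
      "a = coxeter_class X xs" "b = coxeter_class X ys" "c = coxeter_class X zs"
      unfolding carr by blast
    then have "xs @ ys \<in> lists (fst X)" "ys @ zs \<in> lists (fst X)"
      by simp_all
    with * show "a \<otimes>\<^bsub>coxeter_group X\<^esub> b \<otimes>\<^bsub>coxeter_group X\<^esub> c
        = a \<otimes>\<^bsub>coxeter_group X\<^esub> (b \<otimes>\<^bsub>coxeter_group X\<^esub> c)"
      by (metis coxeter_class_mult append_assoc)
  next
    fix a assume "a \<in> carrier (coxeter_group X)"
    then obtain xs where *: "xs \<in> lists (fst X)" "a = coxeter_class X xs"
      unfolding carr by blast
    then show "\<one>\<^bsub>coxeter_group X\<^esub> \<otimes>\<^bsub>coxeter_group X\<^esub> a = a"
      unfolding one by (metis coxeter_class_mult append_Nil lists.Nil)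
    show "\<exists>b\<in>carrier (coxeter_group X). b \<otimes>\<^bsub>coxeter_group X\<^esub> a = \<one>\<^bsub>coxeter_group X\<^esub>"
    proof
      show "coxeter_class X (rev xs) \<otimes>\<^bsub>coxeter_group X\<^esub> a = \<one>\<^bsub>coxeter_group X\<^esub>"
        using coxeter_class_mult[OF rev[OF *(1)] *(1)] inverse[OF *(1)] *(2) one by metis
      show "coxeter_class X (rev xs) \<in> carrier (coxeter_group X)"
        unfolding carr by (rule imageI[OF rev[OF *(1)]])
    qed
  qed
qed

section \<open>The affine Coxeter systems\<close>

text \<open>The conventions are for \<open>N \<ge> 2\<close> in types A and C, \<open>N \<ge> 3\<close> in type B and \<open>N \<ge> 4\<close> in type D.\<close>

definition affine_A :: "nat \<Rightarrow> nat coxeter_datum" where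
  "affine_A N = ({0..N}, \<lambda>i j.
     if i = j then 1
     else if \<exists>k\<in>{0..N}. {i, j} = {k, (k + 1) mod (N + 1)} then 3
     else 2)"

definition affine_B :: "nat \<Rightarrow> nat coxeter_datum" where
  "affine_B N = ({0..N}, \<lambda>i j.
     if i = j then 1
     else if {i, j} = {0, 1} then 4
     else if (\<exists>k. 1 \<le> k \<and> k + 3 \<le> N \<and> {i, j} = {k, k + 1})
           \<or> {i, j} = {N - 2, N - 1} \<or> {i, j} = {N - 2, N} then 3
     else 2)"

definition affine_C :: "nat \<Rightarrow> nat coxeter_datum" where
  "affine_C N = ({0..N}, \<lambda>i j.
     if i = j then 1
     else if {i, j} = {0, 1} \<or> {i, j} = {N - 1, N} then 4
     else if \<exists>k. 1 \<le> k \<and> k + 2 \<le> N \<and> {i, j} = {k, k + 1} then 3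
     else 2)"

definition affine_D :: "nat \<Rightarrow> nat coxeter_datum" where
  "affine_D N = ({0..N}, \<lambda>i j.
     if i = j then 1
     else if {i, j} = {0, 2} \<or> {i, j} = {1, 2}
           \<or> (\<exists>k. 2 \<le> k \<and> k + 3 \<le> N \<and> {i, j} = {k, k + 1})
           \<or> {i, j} = {N - 2, N - 1} \<or> {i, j} = {N - 2, N} then 3
     else 2)"

lemma group_affine:
  "group (coxeter_group (affine_A N))" "group (coxeter_group (affine_B N))"
  "group (coxeter_group (affine_C N))" "group (coxeter_group (affine_D N))"
  by (simp_all add: group_coxeter_group affine_A_def affine_B_def affine_C_def affine_D_def)

section \<open>The polynomials \<open>[k]\<^sub>x = 1 + x + \<dots> + x^(k-1)\<close>\<close>

definition q_bracket :: "nat \<Rightarrow> 'a::comm_semiring_1 \<Rightarrow> 'a" where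
  "q_bracket k x = (\<Sum>i<k. x ^ i)"

end

theory Submission
  imports Defs
begin

text \<open>Let \<open>c\<^sub>i\<close> be the length of \<open>\<phi> (r\<^sub>i)\<close>.  Inspecting the pairs of generators shows that \<open>\<phi>\<close>
  folds the simple roots: whenever \<open>r\<^sub>i\<close> is an ascent of \<open>w\<close>, all generators occurring in \<open>\<phi> (r\<^sub>i)\<close>
  are ascents of \<open>\<phi> w\<close>, by Tits's reduction to dihedral subgroups in an integral reflection
  representation.  So the length of \<open>\<phi> w\<close> is the length of \<open>w\<close> weighted by the \<open>c\<^sub>i\<close>, and \<open>U\<close> is the
  Poincare series of \<open>C\<close> with the three parameters \<open>s = q^c\<^sub>0\<close>, \<open>x = q^c\<^sub>1\<close>, \<open>t = q^c\<^sub>n\<close>.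

  No element of the infinite group \<open>C\<close> has only descents, so the alternating sum of the
  reciprocals of the Poincare series of all standard parabolic subgroups vanishes.  The proper ones
  are products of groups of signed and ordinary permutations, and a \<open>q\<close>-binomial identity
  turns the sum into Macdonald's formula, the product over \<open>i < n\<close> of
  \<open>(1 + s x^i) (1 + t x^i) [i + 1]\<^sub>x / (1 - s t x^(n + i - 1))\<close>.  The seven closed forms are
  specialisations of it.\<close>

section \<open>Words and lengths\<close>

text \<open>All bonds have label at most 4, so Cartan matrices with integer entries exist;
  positivity of a root becomes the sign of an integer-valued functional, and each rank-two check is
  finite linear arithmetic. Two such representations are in play: that of the target shows that
  lengths grow under the folding, that of \<open>C\<close> itself decides ascents during the
  counting.

  The counting sees only a weight that jumps by \<open>c i\<close> at each generator, so all seven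
  targets share it. The alternating sum can be solved for the whole Poincare series because the full
  generator set contributes the reciprocal of that series. Its other terms belong to subsets of a
  path: cutting a subset at its smallest missing node turns the sum into a convolution. This is done
  once for the subsets near the right end and once for the whole path; both convolutions are the
  same \<open>q\<close>-binomial identity, with \<open>s = 0\<close> and with general
  \<open>s\<close>.

  Formal power series over the rationals are the right home for these quotients: every denominator
  has constant term 1, and sums converge coefficient by coefficient.\<close>

declare coxeter_equiv.trans [trans]

text \<open>Every relator has even length, so the parity is an invariant of the group element. This
  is the sign character; it keeps a word and its extension by one generator from having the same
  length.\<close>

lemma coxeter_equiv_even:
  "coxeter_equiv X xs ys \<Longrightarrow> even (length xs) \<longleftrightarrow> even (length ys)"
proof (induction rule: coxeter_equiv.induct)
  case (relator us vs i j)
  have "length (concat (replicate k [i, j])) = 2 * k" for k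
    by (induction k) auto
  then show ?case by simp
qed auto

text \<open>Length is measured on words, so that inductions can take place there;
  \<open>coxeter_length_class\<close> identifies it with the length of the group element.\<close>

definition word_length :: "'a coxeter_datum \<Rightarrow> 'a list \<Rightarrow> nat" where
  "word_length X xs = (LEAST k. \<exists>ys. coxeter_equiv X xs ys \<and> length ys = k)"

lemma word_length_le: "coxeter_equiv X xs ys \<Longrightarrow> word_length X xs \<le> length ys"
  unfolding word_length_def by (rule Least_le) blast

lemma reduced_word_exists:
  assumes "xs \<in> lists (fst X)"
  obtains ys where "coxeter_equiv X xs ys" "length ys = word_length X xs"
proof -
  have "\<exists>ys. coxeter_equiv X xs ys \<and> length ys = word_length X xs"
    unfolding word_length_def
    by (rule LeastI[of _ "length xs"], rule exI[of _ xs]) (simp add: coxeter_equiv.refl[OF assms])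
  then show ?thesis using that by blast
qed

lemma word_length_cong:
  assumes "coxeter_equiv X xs ys"
  shows "word_length X xs = word_length X ys"
proof -
  have "coxeter_equiv X xs zs \<longleftrightarrow> coxeter_equiv X ys zs" for zs
    using assms by (meson coxeter_equiv.sym coxeter_equiv.trans)
  then show ?thesis by (simp add: word_length_def)
qed

lemma word_length_Nil [simp]: "word_length X [] = 0"
  using word_length_le[OF coxeter_equiv.refl, of "[]" X] by simp

lemma word_length_snoc_le:
  assumes "xs \<in> lists (fst X)" "i \<in> fst X"
  shows "word_length X (xs @ [i]) \<le> word_length X xs + 1"
proof -
  obtain ys where ys: "coxeter_equiv X xs ys" "length ys = word_length X xs"
    using reduced_word_exists[OF assms(1)] .
  have "coxeter_equiv X (xs @ [i]) (ys @ [i])"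
    using ys(1) assms(2) by (simp add: coxeter_equiv_append_right)
  from word_length_le[OF this] ys(2) show ?thesis by simp
qed

lemma word_length_snoc_neq:
  assumes "xs \<in> lists (fst X)" "i \<in> fst X"
  shows "word_length X (xs @ [i]) \<noteq> word_length X xs"
proof -
  obtain ys where ys: "coxeter_equiv X xs ys" "length ys = word_length X xs"
    using reduced_word_exists[OF assms(1)] .
  have "xs @ [i] \<in> lists (fst X)" using assms by simp
  from reduced_word_exists[OF this]
  obtain zs where zs: "coxeter_equiv X (xs @ [i]) zs" "length zs = word_length X (xs @ [i])" .
  show ?thesis
    using coxeter_equiv_even[OF ys(1)] coxeter_equiv_even[OF zs(1)] ys(2) zs(2) by auto
qed

text \<open>A shorter word for the prefix could be substituted and would shorten the whole
  word.\<close>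

lemma word_length_eq_length_prefix:
  assumes "coxeter_equiv X xs (us @ vs)" "word_length X xs = length us + length vs"
  shows "word_length X us = length us"
proof (rule antisym)
  have l: "us \<in> lists (fst X)" "vs \<in> lists (fst X)"
    using coxeter_equiv_lists[OF assms(1)] by auto
  show "word_length X us \<le> length us"
    by (rule word_length_le) (simp add: l coxeter_equiv.refl)
  obtain ys where ys: "coxeter_equiv X us ys" "length ys = word_length X us"
    using reduced_word_exists[OF l(1)] .
  have "coxeter_equiv X xs (ys @ vs)"
    by (rule coxeter_equiv.trans[OF assms(1) coxeter_equiv_append_right[OF ys(1) l(2)]])
  from word_length_le[OF this] ys(2) assms(2) show "length us \<le> word_length X us" by simp
qed

lemma coxeter_length_class:
  assumes "xs \<in> lists (fst X)"
  shows "coxeter_length X (coxeter_class X xs) = word_length X xs"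
proof -
  have fold: "foldr (\<lambda>i v. coxeter_gen X i \<otimes>\<^bsub>coxeter_group X\<^esub> v) ys \<one>\<^bsub>coxeter_group X\<^esub> = coxeter_class X ys"
    if "ys \<in> lists (fst X)" for ys
    using that
  proof (induction ys)
    case Nil
    then show ?case by (simp add: coxeter_group_def)
  next
    case (Cons y ys)
    then show ?case
      using coxeter_class_mult[of "[y]" X ys] by (simp add: coxeter_gen_def)
  qed
  have "ys \<in> lists (fst X) \<and> coxeter_class X xs =
      foldr (\<lambda>i v. coxeter_gen X i \<otimes>\<^bsub>coxeter_group X\<^esub> v) ys \<one>\<^bsub>coxeter_group X\<^esub> \<longleftrightarrow>
    coxeter_equiv X xs ys" for ys
  proof (cases "ys \<in> lists (fst X)")
    case True
    then show ?thesis using coxeter_class_eq_iff[OF assms True] fold[OF True] by simp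
  next
    case False
    then show ?thesis using coxeter_equiv_lists[of X xs ys] by blast
  qed
  then have "(\<exists>ys \<in> lists (fst X). length ys = k \<and> coxeter_class X xs =
      foldr (\<lambda>i v. coxeter_gen X i \<otimes>\<^bsub>coxeter_group X\<^esub> v) ys \<one>\<^bsub>coxeter_group X\<^esub>) \<longleftrightarrow>
    (\<exists>ys. coxeter_equiv X xs ys \<and> length ys = k)" for k
    by blast
  then show ?thesis
    unfolding coxeter_length_def word_length_def by simp
qed

lemma coxeter_carrier: "carrier (coxeter_group X) = coxeter_class X ` lists (fst X)"
  and coxeter_one: "\<one>\<^bsub>coxeter_group X\<^esub> = coxeter_class X []"
  by (simp_all add: coxeter_group_def)

section \<open>Integral reflection representations\<close>

text \<open>\<open>A\<close> orients the bonds of label 4: each has exactly one end in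
  \<open>A\<close>, the end whose Cartan entry towards the other one is -2. This keeps the Cartan
  matrix integral, where the symmetric bilinear form would need the square root of 2.\<close>

locale crystallographic =
  fixes X :: "'a coxeter_datum" and A :: "'a set"
  assumes m_diag: "i \<in> fst X \<Longrightarrow> snd X i i = 1"
    and m_sym: "snd X i j = snd X j i"
    and m_cases: "i \<in> fst X \<Longrightarrow> j \<in> fst X \<Longrightarrow> i \<noteq> j \<Longrightarrow> snd X i j \<in> {2, 3, 4}"
    and orient: "i \<in> fst X \<Longrightarrow> j \<in> fst X \<Longrightarrow> snd X i j = 4 \<Longrightarrow> i \<in> A \<longleftrightarrow> j \<notin> A"
begin

abbreviation equiv (infix "\<simeq>" 50) where "xs \<simeq> ys \<equiv> coxeter_equiv X xs ys"

abbreviation len where "len \<equiv> word_length X"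

lemma cancel:
  assumes "us \<in> lists (fst X)" "vs \<in> lists (fst X)" "i \<in> fst X"
  shows "us @ [i, i] @ vs \<simeq> us @ vs"
  using coxeter_equiv.relator[OF assms(1,2,3,3)] m_diag[OF assms(3)] by simp

lemma len_le_len_snoc:
  assumes "xs \<in> lists (fst X)" "i \<in> fst X"
  shows "len xs \<le> len (xs @ [i]) + 1"
proof -
  have "xs @ [i, i] \<simeq> xs"
    using cancel[of xs "[]" i] assms by simp
  from word_length_cong[OF this] have "len xs = len ((xs @ [i]) @ [i])" by simp
  then show ?thesis
    using word_length_snoc_le[of "xs @ [i]" X i] assms by simp
qed

text \<open>The relator is put in front of the word on one side; its second half then cancels letter
  by letter against that word.\<close>

lemma braid:
  assumes "i \<in> fst X" "j \<in> fst X"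
  shows "snd X i j = 2 \<Longrightarrow> [i, j] \<simeq> [j, i]"
    and "snd X i j = 3 \<Longrightarrow> [j, i, j] \<simeq> [i, j, i]"
    and "snd X i j = 4 \<Longrightarrow> [i, j, i, j] \<simeq> [j, i, j, i]"
proof -
  note rel = coxeter_equiv.relator[OF _ _ assms, of "[]"]
  note T = coxeter_equiv.trans and S = coxeter_equiv.sym
  {
    assume "snd X i j = 2"
    then have "[i,j,i,j,j,i] \<simeq> [j,i]"
      using rel[of "[j,i]"] assms by (simp add: eval_nat_numeral)
    moreover have "[i,j,i,j,j,i] \<simeq> [i,j,i,i]" using cancel[of "[i,j,i]" "[i]" j] assms by simp
    moreover have "[i,j,i,i] \<simeq> [i,j]" using cancel[of "[i,j]" "[]" i] assms by simp
    ultimately show "[i, j] \<simeq> [j, i]" by (metis T S)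
  }
  {
    assume "snd X i j = 3"
    then have "[i,j,i,j,i,j,j,i,j] \<simeq> [j,i,j]"
      using rel[of "[j,i,j]"] assms by (simp add: eval_nat_numeral)
    moreover have "[i,j,i,j,i,j,j,i,j] \<simeq> [i,j,i,j,i,i,j]"
      using cancel[of "[i,j,i,j,i]" "[i,j]" j] assms by simp
    moreover have "[i,j,i,j,i,i,j] \<simeq> [i,j,i,j,j]" using cancel[of "[i,j,i,j]" "[j]" i] assms by simp
    moreover have "[i,j,i,j,j] \<simeq> [i,j,i]" using cancel[of "[i,j,i]" "[]" j] assms by simp
    ultimately show "[j, i, j] \<simeq> [i, j, i]" by (meson T S)
  }
  {
    assume "snd X i j = 4"
    then have "[i,j,i,j,i,j,i,j,j,i,j,i] \<simeq> [j,i,j,i]"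
      using rel[of "[j,i,j,i]"] assms by (simp add: eval_nat_numeral)
    moreover have "[i,j,i,j,i,j,i,j,j,i,j,i] \<simeq> [i,j,i,j,i,j,i,i,j,i]"
      using cancel[of "[i,j,i,j,i,j,i]" "[i,j,i]" j] assms by simp
    moreover have "[i,j,i,j,i,j,i,i,j,i] \<simeq> [i,j,i,j,i,j,j,i]"
      using cancel[of "[i,j,i,j,i,j]" "[j,i]" i] assms by simp
    moreover have "[i,j,i,j,i,j,j,i] \<simeq> [i,j,i,j,i,i]"
      using cancel[of "[i,j,i,j,i]" "[i]" j] assms by simp
    moreover have "[i,j,i,j,i,i] \<simeq> [i,j,i,j]" using cancel[of "[i,j,i,j]" "[]" i] assms by simp
    ultimately show "[i, j, i, j] \<simeq> [j, i, j, i]" by (meson T S)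
  }
qed

text \<open>The alternating words in \<open>i\<close> and \<open>j\<close> that are shorter than \<open>m i j\<close> and do not end in \<open>i\<close>.\<close>

definition dihedral_tails :: "'a \<Rightarrow> 'a \<Rightarrow> 'a list set" where
  "dihedral_tails i j = {[], [j]} \<union> (if snd X i j \<ge> 3 then {[i, j]} else {})
     \<union> (if snd X i j \<ge> 4 then {[j, i, j]} else {})"

text \<open>The letters of \<open>y\<close> are read from the right. The last one is not
  \<open>i\<close>, because \<open>i\<close> is an ascent; equal neighbours would cancel, against
  the minimal length of \<open>v @ y\<close>; and an alternating suffix of \<open>m i j\<close>
  letters ending in \<open>j\<close> could be rewritten by a braid relation so as to end in
  \<open>i\<close>.\<close>

lemma reduced_dihedral_tail:
  assumes xs: "xs \<simeq> v @ y" "len xs = length v + length y" and ij: "i \<in> fst X" "j \<in> fst X" "i \<noteq> j"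
    and y: "y \<in> lists {i, j}" and up: "len xs < len (xs @ [i])"
  shows "y \<in> dihedral_tails i j"
proof -
  have v: "v \<in> lists (fst X)" using coxeter_equiv_lists[OF xs(1)] by auto
  have no_end: False if "xs \<simeq> z @ [i]" "len xs = length z + 1" for z
  proof -
    have z: "z \<in> lists (fst X)" using coxeter_equiv_lists[OF that(1)] by auto
    have "xs @ [i] \<simeq> z @ [i, i] @ []"
      using coxeter_equiv_append_right[OF that(1), of "[i]"] ij by simp
    also have "z @ [i, i] @ [] \<simeq> z @ []"
      using z ij by (intro cancel) simp_all
    finally have "xs @ [i] \<simeq> z" by simp
    from word_length_le[OF this] that(2) up show False by simp
  qed
  have no_double: False if "y = z @ [k, k] @ u" for z k u
  proof -
    have l: "k \<in> fst X" "z \<in> lists (fst X)" "u \<in> lists (fst X)"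
      using y that ij by auto
    have "xs \<simeq> (v @ z) @ [k, k] @ u" using xs(1) that by simp
    also have "(v @ z) @ [k, k] @ u \<simeq> (v @ z) @ u"
      using l v by (intro cancel) simp_all
    finally have "xs \<simeq> (v @ z) @ u" .
    from word_length_le[OF this] that xs(2) show False by simp
  qed
  have no_braid: False if "y = z @ b" "b \<simeq> b' @ [i]" "length b = length b' + 1" for z b b'
  proof -
    have z: "v @ z \<in> lists (fst X)" using that(1) y ij v by auto
    have "xs \<simeq> (v @ z) @ b" using xs(1) that by simp
    also note coxeter_equiv_append_left[OF that(2) z]
    finally have "xs \<simeq> (v @ z @ b') @ [i]" by simp
    then show False using no_end[of "v @ z @ b'"] xs(2) that(1,3) by simp
  qed
  have m: "snd X i j = 2 \<or> snd X i j = 3 \<or> snd X i j = 4" using m_cases[OF ij] by auto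
  show ?thesis
  proof (cases y rule: rev_cases)
    case Nil then show ?thesis by (simp add: dihedral_tails_def)
  next
    case (snoc y1 k1)
    have "xs \<simeq> (v @ y1) @ [k1]" "len xs = length (v @ y1) + 1" using xs snoc by simp_all
    then have "k1 \<noteq> i" using no_end[of "v @ y1"] by blast
    then have k1: "k1 = j" using y snoc by auto
    show ?thesis
    proof (cases y1 rule: rev_cases)
      case Nil then show ?thesis using snoc k1 by (simp add: dihedral_tails_def)
    next
      case y1: (snoc y2 k2)
      have y': "y = y2 @ [k2, j]" using snoc y1 k1 by simp
      have k2: "k2 = i" using no_double[of y2 j "[]"] y y' by auto
      have m2: "snd X i j \<noteq> 2"
        using no_braid[of y2 "[i, j]" "[j]"] y' k2 braid(1)[OF ij(1,2)] by auto
      show ?thesis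
      proof (cases y2 rule: rev_cases)
        case Nil then show ?thesis using y' k2 m m2 by (auto simp: dihedral_tails_def)
      next
        case y2: (snoc y3 k3)
        have y'': "y = y3 @ [k3, i, j]" using y' y2 k2 by simp
        have k3: "k3 = j" using no_double[of y3 i "[j]"] y y'' by auto
        have m3: "snd X i j \<noteq> 3"
          using no_braid[of y3 "[j, i, j]" "[i, j]"] y'' k3 braid(2)[OF ij(1,2)] by auto
        show ?thesis
        proof (cases y3 rule: rev_cases)
          case Nil then show ?thesis using y'' k3 m m2 m3 by (auto simp: dihedral_tails_def)
        next
          case y3: (snoc y4 k4)
          have y3': "y = y4 @ [k4, j, i, j]" using y'' y3 k3 by simp
          have k4: "k4 = i" using no_double[of y4 j "[i, j]"] y y3' by auto
          have "snd X i j \<noteq> 4"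
            using no_braid[of y4 "[i, j, i, j]" "[j, i, j]"] y3' k4 braid(3)[OF ij(1,2)] by auto
          then show ?thesis using m m2 m3 by auto
        qed
      qed
    qed
  qed
qed

text \<open>Tits's reduction to rank two: if \<open>xs\<close> has a descent \<open>j\<close>, split off the longest possible
  right factor in the dihedral subgroup of \<open>i\<close> and \<open>j\<close>.\<close>

lemma ascent_induct:
  assumes cong: "\<And>xs ys i. xs \<simeq> ys \<Longrightarrow> Q xs i \<Longrightarrow> Q ys i"
    and Nil: "\<And>i. i \<in> fst X \<Longrightarrow> Q [] i"
    and step: "\<And>v i j y. v \<in> lists (fst X) \<Longrightarrow> i \<in> fst X \<Longrightarrow> j \<in> fst X \<Longrightarrow> i \<noteq> j \<Longrightarrow>
      Q v i \<Longrightarrow> Q v j \<Longrightarrow> y \<in> dihedral_tails i j \<Longrightarrow> Q (v @ y) i"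
    and "xs \<in> lists (fst X)" "i \<in> fst X" "len xs < len (xs @ [i])"
  shows "Q xs i"
  using assms(4-6)
proof (induction "len xs" arbitrary: xs i rule: less_induct)
  case less
  obtain ys where ys: "xs \<simeq> ys" "length ys = len xs"
    using reduced_word_exists[OF less.prems(1)] .
  show ?case
  proof (cases ys rule: rev_cases)
    case Nil
    then show ?thesis
      using assms(2)[of i] cong[of "[]" xs i] ys(1) less.prems by (simp add: coxeter_equiv.sym)
  next
    case (snoc ys' j)
    have j: "j \<in> fst X" using coxeter_equiv_lists[OF ys(1)] snoc by auto
    define P where "P k \<longleftrightarrow> (\<exists>v y. length v = k \<and> y \<in> lists {i, j} \<and> xs \<simeq> v @ y \<and>
      len xs = length v + length y)" for k
    have "P (length ys')"
      unfolding P_def by (rule exI[of _ ys'], rule exI[of _ "[j]"]) (use ys snoc in auto)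
    then have PL: "P (Least P)" and L: "Least P \<le> length ys'"
      by (rule LeastI, rule Least_le)
    from PL obtain v y where v: "length v = Least P" "y \<in> lists {i, j}" "xs \<simeq> v @ y"
      "len xs = length v + length y" unfolding P_def by blast
    have vl: "v \<in> lists (fst X)" using coxeter_equiv_lists[OF v(3)] by auto
    have lv: "len v = length v" using word_length_eq_length_prefix[OF v(3,4)] .
    have less_xs: "len v < len xs" using lv v L ys snoc by auto
    \<comment> \<open>If \<open>k\<close> were a descent of \<open>v\<close>, then \<open>v\<close>
      would be equivalent to \<open>u @ [k]\<close> with \<open>u\<close> shorter by one letter, and
      moving \<open>k\<close> into the dihedral factor would contradict the choice of
      \<open>v\<close>.\<close>
    have up: "len v < len (v @ [k])" if k: "k \<in> {i, j}" "k \<in> fst X" for k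
    proof (rule ccontr)
      assume "\<not> ?thesis"
      then have lt: "len (v @ [k]) < len v"
        using word_length_snoc_neq[OF vl k(2)] by simp
      have vk: "v @ [k] \<in> lists (fst X)" using vl k by simp
      obtain u where u: "v @ [k] \<simeq> u" "length u = len (v @ [k])"
        using reduced_word_exists[OF vk] .
      have lu: "length u + 1 = length v"
        using lt len_le_len_snoc[OF vl k(2)] u lv by simp
      have "v \<simeq> v @ [k, k]"
        using coxeter_equiv.sym[OF cancel[OF vl _ k(2), of "[]"]] by simp
      also have "v @ [k, k] \<simeq> u @ [k]"
        using coxeter_equiv_append_right[OF u(1), of "[k]"] k by simp
      finally have vu: "v \<simeq> u @ [k]" .
      have yl: "y \<in> lists (fst X)" using coxeter_equiv_lists[OF v(3)] by auto
      note v(3)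
      also have "v @ y \<simeq> u @ [k] @ y"
        using coxeter_equiv_append_right[OF vu yl] by simp
      finally have "xs \<simeq> u @ ([k] @ y)" .
      then have "P (length u)"
        unfolding P_def by (intro exI[of _ u] exI[of _ "[k] @ y"]) (use v lu k in auto)
      then have "Least P \<le> length u" by (rule Least_le)
      then show False using lu v(1) by simp
    qed
    have Q: "Q v k" if "k \<in> {i, j}" "k \<in> fst X" for k
      using less.hyps[OF less_xs vl that(2) up[OF that]] .
    have ij: "i \<noteq> j"
    proof
      assume "i = j"
      have "ys' \<in> lists (fst X)" using coxeter_equiv_lists[OF ys(1)] snoc by auto
      then have "ys' @ [i, i] \<simeq> ys'"
        using cancel[of ys' "[]" i] less.prems by simp
      moreover have "xs @ [i] \<simeq> ys' @ [i, i]"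
        using coxeter_equiv_append_right[OF ys(1), of "[i]"] less.prems snoc \<open>i = j\<close> by simp
      ultimately have "xs @ [i] \<simeq> ys'" by (metis coxeter_equiv.trans)
      from word_length_le[OF this] less.prems(3) ys(2) snoc show False by simp
    qed
    have "Q (v @ y) i"
      using step[OF vl less.prems(2) j ij Q Q]
        reduced_dihedral_tail[OF v(3,4) less.prems(2) j ij v(2) less.prems(3)] less.prems(2) j by simp
    then show ?thesis by (rule cong[OF coxeter_equiv.sym[OF v(3)]])
  qed
qed

section \<open>The reflection action on functionals\<close>

definition cartan :: "'a \<Rightarrow> 'a \<Rightarrow> int" where
  "cartan i j = (if j \<notin> fst X then 0 else if i = j then 2 else if snd X i j = 2 then 0
     else if snd X i j = 4 \<and> i \<in> A then -2 else -1)"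

text \<open>The action on functionals: \<open>act xs f i\<close> is the value of \<open>f\<close> at the image of the simple
  root \<open>\<alpha>\<^sub>i\<close> under \<open>xs\<close>, so words act from the right.\<close>

definition reflect :: "'a \<Rightarrow> ('a \<Rightarrow> int) \<Rightarrow> 'a \<Rightarrow> int" where
  "reflect i f = (\<lambda>j. f j - cartan i j * f i)"

abbreviation act :: "'a list \<Rightarrow> ('a \<Rightarrow> int) \<Rightarrow> 'a \<Rightarrow> int" where
  "act xs f \<equiv> fold reflect xs f"

lemma cartan_diag: "i \<in> fst X \<Longrightarrow> cartan i i = 2"
  by (simp add: cartan_def)

lemma cartan_pair:
  assumes "i \<in> fst X" "j \<in> fst X" "i \<noteq> j"
  shows "snd X i j = 2 \<and> cartan i j = 0 \<and> cartan j i = 0 \<or>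
    snd X i j = 3 \<and> cartan i j = -1 \<and> cartan j i = -1 \<or>
    snd X i j = 4 \<and> cartan i j = -1 \<and> cartan j i = -2 \<or>
    snd X i j = 4 \<and> cartan i j = -2 \<and> cartan j i = -1"
  using m_cases[OF assms] orient[OF assms(1,2)] assms m_sym[of j i] by (auto simp: cartan_def)

text \<open>Under one round \<open>T\<close> the values at \<open>i\<close> and \<open>j\<close>
  evolve by themselves, as a rotation of order \<open>m i j\<close>, while the value at any
  \<open>k\<close> only collects multiples of them. Iterating \<open>T\<close> is thus a computation
  with three values.\<close>

lemma act_relator:
  assumes "i \<in> fst X" "j \<in> fst X"
  shows "act (concat (replicate (snd X i j) [i, j])) f = f"
proof (cases "i = j")
  case True
  then show ?thesis
    using assms by (auto simp: m_diag reflect_def cartan_diag fun_eq_iff algebra_simps)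
next
  case False
  note d = cartan_diag[OF assms(1)] cartan_diag[OF assms(2)]
  define T where "T f = reflect j (reflect i f)" for f
  have T: "T f k = f k - cartan i k * f i - cartan j k * (f j - cartan i j * f i)" for f k
    by (simp add: T_def reflect_def)
  have rep: "act (concat (replicate m [i, j])) f = (T ^^ m) f" for m
    by (induction m arbitrary: f) (simp_all add: T_def funpow_swap1)
  have Ti: "T f i = f i - 2 * f i - cartan j i * (f j - cartan i j * f i)" for f
    by (simp add: T d)
  have Tj: "T f j = - (f j - cartan i j * f i)" for f
    by (simp add: T d)
  from cartan_pair[OF assms False] have "(T ^^ snd X i j) f k = f k" for k
  proof (elim disjE conjE)
    assume "snd X i j = 2" and c: "cartan i j = 0" "cartan j i = 0"
    then show ?thesis
      by (simp add: eval_nat_numeral T[of _ k] Ti[unfolded c] Tj[unfolded c])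
  next
    assume "snd X i j = 3" and c: "cartan i j = -1" "cartan j i = -1"
    then show ?thesis
      by (simp add: eval_nat_numeral T[of _ k] Ti[unfolded c] Tj[unfolded c] algebra_simps)
  next
    assume "snd X i j = 4" and c: "cartan i j = -1" "cartan j i = -2"
    then show ?thesis
      by (simp add: eval_nat_numeral T[of _ k] Ti[unfolded c] Tj[unfolded c] algebra_simps)
  next
    assume "snd X i j = 4" and c: "cartan i j = -2" "cartan j i = -1"
    then show ?thesis
      by (simp add: eval_nat_numeral T[of _ k] Ti[unfolded c] Tj[unfolded c] algebra_simps)
  qed
  then show ?thesis
    by (simp add: rep fun_eq_iff)
qed

lemma act_cong: "xs \<simeq> ys \<Longrightarrow> act xs f = act ys f"
  by (induction arbitrary: f rule: coxeter_equiv.induct) (auto simp: act_relator)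

text \<open>At an ascent the image of the simple root is a positive root, tested here by an
  arbitrary positive functional. On a dihedral tail the new value is a nonnegative combination, not
  identically zero, of the two positive values at \<open>i\<close> and \<open>j\<close> that the
  induction supplies.\<close>

lemma act_pos_if_ascent:
  assumes "xs \<in> lists (fst X)" "i \<in> fst X" "len xs < len (xs @ [i])"
    and f: "\<And>i. i \<in> fst X \<Longrightarrow> f i > 0"
  shows "act xs f i > 0"
proof (rule ascent_induct[of "\<lambda>xs i. act xs f i > 0", OF _ _ _ assms(1-3)])
  fix v i j y assume ij: "i \<in> fst X" "j \<in> fst X" "i \<noteq> j"
    and pos: "act v f i > 0" "act v f j > 0" and y: "y \<in> dihedral_tails i j"
  note d = cartan_diag[OF ij(1)] cartan_diag[OF ij(2)]
  from cartan_pair[OF ij] y pos show "act (v @ y) f i > 0"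
    by (elim disjE conjE) (auto simp: dihedral_tails_def reflect_def d split: if_splits)
next
  fix xs ys i assume "xs \<simeq> ys" "act xs f i > 0"
  then show "act ys f i > 0" by (simp add: act_cong)
qed (simp add: f)

lemma act_neg_if_descent:
  assumes "xs \<in> lists (fst X)" "i \<in> fst X" "len (xs @ [i]) < len xs"
    and f: "\<And>i. i \<in> fst X \<Longrightarrow> f i > 0"
  shows "act xs f i < 0"
proof -
  have "len ((xs @ [i]) @ [i]) = len xs"
    using word_length_cong[OF cancel[of xs "[]" i]] assms(1,2) by simp
  then have "act (xs @ [i]) f i > 0"
    using assms(1-3) by (intro act_pos_if_ascent[OF _ _ _ f]) simp_all
  then show ?thesis using assms(2) by (simp add: reflect_def cartan_diag)
qed

lemma len_snoc_cases:
  assumes "xs \<in> lists (fst X)" "i \<in> fst X" and f: "\<And>i. i \<in> fst X \<Longrightarrow> f i > 0"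
  shows "act xs f i > 0 \<and> len (xs @ [i]) = len xs + 1 \<or> act xs f i < 0 \<and> len xs = len (xs @ [i]) + 1"
proof (cases "len xs < len (xs @ [i])")
  case True
  have "act xs f i > 0"
    by (rule act_pos_if_ascent[OF assms(1,2) True f])
  then show ?thesis
    using True word_length_snoc_le[OF assms(1,2)] by simp
next
  case False
  then have "len (xs @ [i]) < len xs"
    using word_length_snoc_neq[OF assms(1,2)] by simp
  moreover from this have "act xs f i < 0"
    by (rule act_neg_if_descent[OF assms(1,2) _ f])
  ultimately show ?thesis
    using len_le_len_snoc[OF assms(1,2)] by simp
qed

end

section \<open>A \<open>q\<close>-binomial identity\<close>

text \<open>Gaussian binomials, by a recursion without division. Of the two Pascal rules this is the
  one whose terms, in the sum below, become shorter sums with \<open>s\<close> or \<open>t\<close>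
  multiplied by \<open>q\<close>.\<close>

fun qbinom :: "'a::comm_ring_1 \<Rightarrow> nat \<Rightarrow> nat \<Rightarrow> 'a" where
  "qbinom q n 0 = 1"
| "qbinom q 0 (Suc m) = 0"
| "qbinom q (Suc n) (Suc m) = qbinom q n (Suc m) + q ^ (n - m) * qbinom q n m"

definition qfact :: "'a::comm_ring_1 \<Rightarrow> nat \<Rightarrow> 'a" where
  "qfact q n = (\<Prod>i<n. q_bracket (Suc i) q)"

text \<open>In the usual notation this is the Pochhammer symbol (-t; q)_n.\<close>

definition qpoch :: "'a::comm_ring_1 \<Rightarrow> 'a \<Rightarrow> nat \<Rightarrow> 'a" where
  "qpoch q t n = (\<Prod>i<n. 1 + t * q ^ i)"

lemma qbinom_eq_0: "n < m \<Longrightarrow> qbinom q n m = 0"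
  by (induction q n m rule: qbinom.induct) auto

lemma q_bracket_add: "q_bracket (a + b) q = q_bracket a q + q ^ a * q_bracket b (q :: 'a::comm_ring_1)"
  by (induction b) (simp_all add: q_bracket_def power_add algebra_simps)

lemma qfact_Suc: "qfact q (Suc n) = q_bracket (Suc n) q * qfact q n"
  by (simp add: qfact_def)

text \<open>The two Pascal terms combine because the bracket of \<open>Suc n\<close> splits after
  \<open>n - m\<close> summands. The formula is the usual quotient of factorials, cleared of
  denominators.\<close>

lemma qbinom_qfact:
  "m \<le> n \<Longrightarrow> qbinom q n m * (qfact q m * qfact q (n - m)) = qfact q n"
proof (induction q n m rule: qbinom.induct)
  case (1 q n)
  then show ?case by (simp add: qfact_def)
next
  case (2 q m)
  then show ?case by simp
next
  case (3 q n m)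
  have snd: "qbinom q n m * (qfact q m * qfact q (n - m)) = qfact q n"
    using 3 by simp
  have fst: "qbinom q n (Suc m) * (qfact q (Suc m) * qfact q (n - m)) = q_bracket (n - m) q * qfact q n"
  proof (cases "m = n")
    case True
    then show ?thesis by (simp add: qbinom_eq_0 q_bracket_def)
  next
    case False
    then have le: "Suc m \<le> n" using 3 by auto
    then have e: "qfact q (n - m) = q_bracket (n - m) q * qfact q (n - Suc m)"
      using qfact_Suc[of q "n - Suc m"] by (simp add: Suc_diff_Suc)
    have "qbinom q n (Suc m) * (qfact q (Suc m) * qfact q (n - m))
      = q_bracket (n - m) q * (qbinom q n (Suc m) * (qfact q (Suc m) * qfact q (n - Suc m)))"
      unfolding e by (simp only: ac_simps)
    then show ?thesis unfolding "3.IH"(1)[OF le] .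
  qed
  have "qbinom q (Suc n) (Suc m) * (qfact q (Suc m) * qfact q (Suc n - Suc m)) =
    qbinom q n (Suc m) * (qfact q (Suc m) * qfact q (n - m))
      + q ^ (n - m) * q_bracket (Suc m) q * (qbinom q n m * (qfact q m * qfact q (n - m)))"
    by (simp add: qfact_Suc[of q m] algebra_simps)
  also have "\<dots> = (q_bracket (n - m) q + q ^ (n - m) * q_bracket (Suc m) q) * qfact q n"
    unfolding fst snd by (simp add: algebra_simps)
  also have "q_bracket (n - m) q + q ^ (n - m) * q_bracket (Suc m) q = q_bracket (Suc n) q"
    using q_bracket_add[of "n - m" "Suc m" q] 3 by simp
  finally show ?case by (simp add: qfact_Suc)
qed

text \<open>Write \<open>H\<^sub>n(s,t)\<close> for the left-hand side.  Pascal's rule gives \<open>H\<^sub>n\<^sub>+\<^sub>1(s,t) = (1 + t q\<^sup>n) H\<^sub>n(s q, t) - t q\<^sup>n (1 + s q\<^sup>n) H\<^sub>n(s, t q)\<close>, and both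
  terms on the right share the same product by induction.\<close>

lemma qbinom_sum:
  fixes q s t :: "'a::comm_ring_1"
  shows "(\<Sum>m\<le>n. qbinom q n m * (- t) ^ m * q ^ (m * (m - 1)) *
      (\<Prod>i\<in>{n-m..<n}. 1 + s * q ^ i) * (\<Prod>i\<in>{m..<n}. 1 + t * q ^ i))
    = (\<Prod>i<n. 1 - s * t * q ^ (n - 1 + i))"
proof (induction n arbitrary: s t)
  case 0
  then show ?case by simp
next
  case (Suc n)
  define F where "F n s t m = qbinom q n m * (- t) ^ m * q ^ (m * (m - 1)) *
      (\<Prod>i\<in>{n-m..<n}. 1 + s * q ^ i) * (\<Prod>i\<in>{m..<n}. 1 + t * q ^ i)" for n s t m
  define A where "A m = qbinom q n m * (- t) ^ m * q ^ (m * (m - 1)) *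
      (\<Prod>i\<in>{Suc n-m..<Suc n}. 1 + s * q ^ i) * (\<Prod>i\<in>{m..<Suc n}. 1 + t * q ^ i)" for m
  define B where "B m = q ^ (n - m) * qbinom q n m * (- t) ^ Suc m * q ^ (Suc m * m) *
      (\<Prod>i\<in>{n-m..<Suc n}. 1 + s * q ^ i) * (\<Prod>i\<in>{Suc m..<Suc n}. 1 + t * q ^ i)" for m
  have A: "A m = (1 + t * q ^ n) * F n (s * q) t m" if "m \<le> n" for m
  proof -
    have "(\<Prod>i\<in>{Suc n-m..<Suc n}. 1 + s * q ^ i) = (\<Prod>i\<in>{n-m..<n}. 1 + (s * q) * q ^ i)"
      using that prod.shift_bounds_Suc_ivl[of "\<lambda>i. 1 + s * q ^ i" "n - m" n]
      by (simp add: Suc_diff_le ac_simps)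
    moreover have "(\<Prod>i\<in>{m..<Suc n}. 1 + t * q ^ i) = (\<Prod>i\<in>{m..<n}. 1 + t * q ^ i) * (1 + t * q ^ n)"
      using that by simp
    ultimately show ?thesis by (simp add: A_def F_def ac_simps)
  qed
  have B: "B m = - (t * q ^ n) * (1 + s * q ^ n) * F n s (t * q) m" if "m \<le> n" for m
  proof -
    have "(\<Prod>i\<in>{Suc m..<Suc n}. 1 + t * q ^ i) = (\<Prod>i\<in>{m..<n}. 1 + (t * q) * q ^ i)"
      using prod.shift_bounds_Suc_ivl[of "\<lambda>i. 1 + t * q ^ i" m n] by (simp add: ac_simps)
    moreover have "(\<Prod>i\<in>{n-m..<Suc n}. 1 + s * q ^ i) = (\<Prod>i\<in>{n-m..<n}. 1 + s * q ^ i) * (1 + s * q ^ n)"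
      by simp
    moreover have "q ^ (n - m) * (- t) ^ Suc m * q ^ (Suc m * m)
        = - (t * q ^ n) * ((- (t * q)) ^ m * q ^ (m * (m - 1)))"
    proof -
      \<comment> \<open>The parts on the right belong to the factor \<open>t * q ^ n\<close>, to the
        power \<open>(t * q) ^ m\<close> and to the old exponent. For \<open>m = 0\<close> the
        truncated \<open>m - 1\<close> is harmless, as it is multiplied by \<open>m\<close>.\<close>
      have e: "(n - m) + Suc m * m = n + m + m * (m - 1)"
        using that by (cases m) auto
      have "q ^ (n - m) * (- t) ^ Suc m * q ^ (Suc m * m) = - t * (- t) ^ m * q ^ ((n - m) + Suc m * m)"
        by (simp add: power_add ac_simps)
      also have "\<dots> = - (t * q ^ n) * ((- t * q) ^ m * q ^ (m * (m - 1)))"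
        unfolding e power_add power_mult_distrib by (simp add: ac_simps)
      finally show ?thesis by simp
    qed
    moreover have "B m = (q ^ (n - m) * (- t) ^ Suc m * q ^ (Suc m * m)) * (qbinom q n m *
        (\<Prod>i\<in>{n-m..<Suc n}. 1 + s * q ^ i) * (\<Prod>i\<in>{Suc m..<Suc n}. 1 + t * q ^ i))"
      unfolding B_def by (simp only: ac_simps)
    ultimately show ?thesis
      unfolding F_def by (simp only: ac_simps)
  qed
  have shift: "s * q * t * q ^ (n + i - Suc 0) = s * t * q ^ (n + i)"
    "s * (t * q) * q ^ (n + i - Suc 0) = s * t * q ^ (n + i)" if "i < n" for i
    using that by (cases n; simp add: ac_simps)+
  have F0: "F (Suc n) s t 0 = A 0" by (simp add: F_def A_def)
  have FS: "F (Suc n) s t (Suc m) = A (Suc m) + B m" if "m \<le> n" for m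
    by (simp add: F_def A_def B_def algebra_simps)
  have top: "A (Suc n) = 0" by (simp add: A_def qbinom_eq_0)
  have "(\<Sum>m\<le>Suc n. F (Suc n) s t m) = A 0 + (\<Sum>m\<le>n. A (Suc m) + B m)"
    unfolding sum.atMost_Suc_shift F0 using FS by simp
  also have "\<dots> = (A 0 + (\<Sum>m\<le>n. A (Suc m))) + (\<Sum>m\<le>n. B m)"
    by (simp add: sum.distrib add.assoc)
  also have "A 0 + (\<Sum>m\<le>n. A (Suc m)) = (\<Sum>m\<le>n. A m)"
    using sum.atMost_Suc_shift[of A n] top by simp
  also have "(\<Sum>m\<le>n. A m) + (\<Sum>m\<le>n. B m) = (1 + t * q ^ n) * (\<Sum>m\<le>n. F n (s * q) t m)
      + - (t * q ^ n) * (1 + s * q ^ n) * (\<Sum>m\<le>n. F n s (t * q) m)"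
    using A B by (simp add: sum_distrib_left)
  also have "(\<Sum>m\<le>n. F n (s * q) t m) = (\<Prod>i<n. 1 - s * t * q ^ (n + i))"
    unfolding F_def Suc.IH by (intro prod.cong) (simp_all add: shift)
  also have "(\<Sum>m\<le>n. F n s (t * q) m) = (\<Prod>i<n. 1 - s * t * q ^ (n + i))"
    unfolding F_def Suc.IH by (intro prod.cong) (simp_all add: shift)
  also have "(1 + t * q ^ n) * (\<Prod>i<n. 1 - s * t * q ^ (n + i))
      + - (t * q ^ n) * (1 + s * q ^ n) * (\<Prod>i<n. 1 - s * t * q ^ (n + i))
      = (\<Prod>i<n. 1 - s * t * q ^ (n + i)) * (1 - s * t * q ^ (n + n))"
    by (simp add: algebra_simps power_add)
  also have "\<dots> = (\<Prod>i<Suc n. 1 - s * t * q ^ (Suc n - 1 + i))"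
    by simp
  finally show ?case by (simp only: F_def)
qed

lemma qpoch_split: "m \<le> n \<Longrightarrow> qpoch q t n = qpoch q t m * (\<Prod>i\<in>{m..<n}. 1 + t * q ^ i)"
  unfolding qpoch_def by (metis atLeast0LessThan le0 prod.atLeastLessThan_concat)

text \<open>Dividing the previous identity by the full factorial and Pochhammer products leaves a
  convolution of reciprocals, the form in which the Poincare series of parabolic subgroups enter.
  The reciprocals are given as functions because the ring need not be a field.\<close>

lemma qbinom_sum_inverse:
  fixes q s t :: "'a::comm_ring_1"
  assumes f: "\<And>k. f k * qfact q k = 1" and S: "\<And>k. S k * qpoch q s k = 1"
    and T: "\<And>k. T k * qpoch q t k = 1"
  shows "(\<Sum>m\<le>n. (- t) ^ m * q ^ (m * (m - 1)) * f m * f (n - m) * S (n - m) * T m)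
    = f n * S n * T n * (\<Prod>i<n. 1 - s * t * q ^ (n - 1 + i))"
proof -
  have inv: "g m = g n * p" if "g m * h m = 1" "g n * h n = 1" "h n = h m * p" for g h :: "nat \<Rightarrow> 'a" and m n p
  proof -
    have "g m = g m * (g n * h n)" using that by simp
    also have "\<dots> = (g m * h m) * (g n * p)" unfolding that(3) by (simp only: ac_simps)
    finally show ?thesis using that(1) by simp
  qed
  have "(- t) ^ m * q ^ (m * (m - 1)) * f m * f (n - m) * S (n - m) * T m =
    f n * S n * T n * (qbinom q n m * (- t) ^ m * q ^ (m * (m - 1)) *
      (\<Prod>i\<in>{n-m..<n}. 1 + s * q ^ i) * (\<Prod>i\<in>{m..<n}. 1 + t * q ^ i))" if "m \<le> n" for m
  proof -
    have "f m * f (n - m) = f m * f (n - m) * (f n * qfact q n)" by (simp add: f)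
    also have "\<dots> = f n * qbinom q n m * (f m * qfact q m) * (f (n - m) * qfact q (n - m))"
      unfolding qbinom_qfact[OF that, symmetric] by (simp only: ac_simps)
    finally have 1: "f m * f (n - m) = f n * qbinom q n m" by (simp add: f)
    have 2: "S (n - m) = S n * (\<Prod>i\<in>{n-m..<n}. 1 + s * q ^ i)"
      using inv[OF S S qpoch_split[of "n - m" n q s]] by simp
    have 3: "T m = T n * (\<Prod>i\<in>{m..<n}. 1 + t * q ^ i)"
      using inv[OF T T qpoch_split[OF that]] .
    have "(- t) ^ m * q ^ (m * (m - 1)) * f m * f (n - m) * S (n - m) * T m =
      (f m * f (n - m)) * ((- t) ^ m * q ^ (m * (m - 1)) * S (n - m) * T m)"
      by (simp only: ac_simps)
    then show ?thesis unfolding 1 2 3 by (simp only: ac_simps)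
  qed
  then show ?thesis
    unfolding qbinom_sum[symmetric] sum_distrib_left by (intro sum.cong) simp_all
qed

section \<open>Weighted length functions on the affine group of type \<open>C\<close>\<close>

text \<open>Both end roots are short. With this choice every row sums to zero, so the null root is
  simply the sum of all simple roots.\<close>

definition affC_cartan :: "nat \<Rightarrow> nat \<Rightarrow> nat \<Rightarrow> int" where
  "affC_cartan n i j = (if i = j then 2 else if i = 0 \<and> j = 1 \<or> i = n \<and> j + 1 = n then -2
     else if j = i + 1 \<or> i = j + 1 then -1 else 0)"

lemma affC_cartan_flip:
  assumes "i \<le> n" "j \<le> n"
  shows "affC_cartan n (n - i) (n - j) = affC_cartan n i j"
proof -
  have "n - i = n - j \<longleftrightarrow> i = j" "n - i = 0 \<longleftrightarrow> i = n" "n - j = 1 \<longleftrightarrow> j + 1 = n"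
    "n - i = n \<longleftrightarrow> i = 0" "n - j + 1 = n \<longleftrightarrow> j = 1"
    "n - j = n - i + 1 \<longleftrightarrow> i = j + 1" "n - i = n - j + 1 \<longleftrightarrow> j = i + 1"
    using assms by linarith+
  then show ?thesis unfolding affC_cartan_def by presburger
qed

text \<open>The case \<open>k = n\<close> gives the invariance of the null root; smaller
  \<open>k\<close> give the effect of a generator on the partial sums that serve as coordinates
  later.\<close>

lemma sum_affC_cartan:
  assumes "n \<ge> 2" "i \<le> n" "k \<le> n"
  shows "(\<Sum>j\<le>k. affC_cartan n i j) = (if i = 0 then (if k = 0 then 2 else 0)
    else if k + 1 = i then (if i = n then -2 else -1) else if k = i \<and> i < n then 1 else 0)"
  using assms(3)
proof (induction k)
  case 0
  then show ?case using assms by (auto simp: affC_cartan_def)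
next
  case (Suc k)
  then show ?case using assms by (auto simp: affC_cartan_def split: if_splits)
qed

lemma sum_Pow_neg_one_power:
  assumes "finite S" "S \<noteq> {}"
  shows "(\<Sum>I\<in>Pow S. (- 1) ^ card I) = (0 :: 'b::comm_ring_1)"
  using assms
proof (induction S rule: finite_ne_induct)
  case (singleton x)
  then show ?case by (simp add: Pow_insert)
next
  case (insert x F)
  have "(\<Sum>I\<in>insert x ` Pow F. (- 1) ^ card I) = (\<Sum>I\<in>Pow F. (- 1) ^ card (insert x I) :: 'b)"
    using insert by (subst sum.reindex) (auto simp: inj_on_def o_def)
  also have "\<dots> = (\<Sum>I\<in>Pow F. - ((- 1) ^ card I))"
    using insert by (intro sum.cong) (auto simp: card_insert_if finite_subset)
  finally have "(\<Sum>I\<in>insert x ` Pow F. (- 1) ^ card I) = (0 :: 'b)"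
    using insert by (simp add: sum_negf)
  then show ?case
    using insert by (simp add: Pow_insert, subst sum.union_disjoint) auto
qed

text \<open>Subsets are sorted by the smallest element \<open>k\<close> that they lack. Everything
  below \<open>k\<close> is then a full interval, and nothing above \<open>k\<close> is adjacent to
  it in the path.\<close>

lemma sum_Pow_first_missing:
  fixes F :: "nat set \<Rightarrow> 'b::comm_monoid_add"
  assumes "a \<le> b"
  shows "(\<Sum>I\<in>Pow {a..<b}. F I)
    = F {a..<b} + (\<Sum>k\<in>{a..<b}. \<Sum>J\<in>Pow {Suc k..<b}. F ({a..<k} \<union> J))"
  using assms
proof (induction a arbitrary: F rule: inc_induct)
  case base
  then show ?case by simp
next
  case (step a)
  have a: "{a..<b} = insert a {Suc a..<b}" using step by auto
  have "(\<Sum>I\<in>Pow {a..<b}. F I)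
    = (\<Sum>I\<in>Pow {Suc a..<b}. F I) + (\<Sum>I\<in>insert a ` Pow {Suc a..<b}. F I)"
    unfolding a Pow_insert by (rule sum.union_disjoint) auto
  also have "(\<Sum>I\<in>insert a ` Pow {Suc a..<b}. F I) = (\<Sum>I\<in>Pow {Suc a..<b}. F (insert a I))"
  proof (subst sum.reindex)
    show "inj_on (insert a) (Pow {Suc a..<b})"
    proof (rule inj_onI)
      fix x y assume xy: "x \<in> Pow {Suc a..<b}" "y \<in> Pow {Suc a..<b}" "insert a x = insert a y"
      then have "a \<notin> x" "a \<notin> y" by auto
      then show "x = y" using xy(3) insert_ident by metis
    qed
  qed (simp add: o_def)
  also have "\<dots> = F (insert a {Suc a..<b}) +
      (\<Sum>k\<in>{Suc a..<b}. \<Sum>J\<in>Pow {Suc k..<b}. F (insert a ({Suc a..<k} \<union> J)))"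
    by (rule step.IH)
  also have "(\<Sum>k\<in>{Suc a..<b}. \<Sum>J\<in>Pow {Suc k..<b}. F (insert a ({Suc a..<k} \<union> J)))
    = (\<Sum>k\<in>{Suc a..<b}. \<Sum>J\<in>Pow {Suc k..<b}. F ({a..<k} \<union> J))"
  proof (intro sum.cong HOL.refl)
    fix k J assume "k \<in> {Suc a..<b}"
    then have "insert a ({Suc a..<k} \<union> J) = {a..<k} \<union> J" by auto
    then show "F (insert a ({Suc a..<k} \<union> J)) = F ({a..<k} \<union> J)" by simp
  qed
  finally show ?case
    unfolding a[symmetric] using step by (simp add: sum.atLeast_Suc_lessThan ac_simps)
qed

text \<open>\<open>L_snoc\<close> is demanded for every positive functional and not for a fixed one:
  additivity along cosets applies it to the functional that a coset representative produces.\<close>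

locale weighted_affine_C = group G for G (structure) +
  fixes n :: nat and r :: "nat \<Rightarrow> 'a" and L :: "'a \<Rightarrow> nat" and c :: "nat \<Rightarrow> nat"
    and act :: "'a \<Rightarrow> (nat \<Rightarrow> int) \<Rightarrow> nat \<Rightarrow> int"
  assumes n2: "n \<ge> 2"
    and r_closed [simp]: "i \<le> n \<Longrightarrow> r i \<in> carrier G"
    and r_square: "i \<le> n \<Longrightarrow> r i \<otimes> r i = \<one>"
    and generated: "g \<in> carrier G \<Longrightarrow> P \<one> \<Longrightarrow>
      (\<And>g i. g \<in> carrier G \<Longrightarrow> P g \<Longrightarrow> i \<le> n \<Longrightarrow> P (g \<otimes> r i)) \<Longrightarrow> P g"
    and act_one: "j \<le> n \<Longrightarrow> act \<one> f j = f j"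
    and act_snoc: "g \<in> carrier G \<Longrightarrow> i \<le> n \<Longrightarrow> j \<le> n \<Longrightarrow>
      act (g \<otimes> r i) f j = act g f j - affC_cartan n i j * act g f i"
    and L_one: "L \<one> = 0"
    and L_eq_0: "g \<in> carrier G \<Longrightarrow> L g = 0 \<Longrightarrow> g = \<one>"
    and L_snoc: "g \<in> carrier G \<Longrightarrow> i \<le> n \<Longrightarrow> (\<And>j. j \<le> n \<Longrightarrow> f j > 0) \<Longrightarrow>
      act g f i > 0 \<and> L (g \<otimes> r i) = L g + c i \<or> act g f i < 0 \<and> L g = L (g \<otimes> r i) + c i"
    and c_pos: "i \<le> n \<Longrightarrow> c i > 0"
    and c_mid: "1 \<le> i \<Longrightarrow> i < n \<Longrightarrow> c i = c 1"
begin

abbreviation ones :: "nat \<Rightarrow> int" where "ones \<equiv> \<lambda>_. 1"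

section \<open>Standard parabolic subgroups and their cosets\<close>

inductive_set parabolic :: "nat set \<Rightarrow> 'a set" for I where
  one: "\<one> \<in> parabolic I"
| snoc: "g \<in> parabolic I \<Longrightarrow> i \<in> I \<Longrightarrow> g \<otimes> r i \<in> parabolic I"

lemma parabolic_closed: "g \<in> parabolic I \<Longrightarrow> I \<subseteq> {..n} \<Longrightarrow> g \<in> carrier G"
  by (induction rule: parabolic.induct) auto

lemma parabolic_mono: "g \<in> parabolic I \<Longrightarrow> I \<subseteq> K \<Longrightarrow> g \<in> parabolic K"
  by (induction rule: parabolic.induct) (auto intro: parabolic.intros)

lemma parabolic_mult:
  assumes "h \<in> parabolic I" "g \<in> parabolic I" "I \<subseteq> {..n}"
  shows "g \<otimes> h \<in> parabolic I"
  using assms(1)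
proof induction
  case one
  then show ?case using assms(2) parabolic_closed[OF assms(2,3)] by simp
next
  case (snoc h i)
  then have "g \<otimes> (h \<otimes> r i) = g \<otimes> h \<otimes> r i"
    using parabolic_closed[OF assms(2,3)] parabolic_closed[OF snoc(1) assms(3)] assms(3)
    by (subst m_assoc) auto
  then show ?case using snoc parabolic.snoc by simp
qed

lemma inv_r: "i \<le> n \<Longrightarrow> inv (r i) = r i"
  using r_square inv_equality r_closed by blast

lemma snoc_snoc: "g \<in> carrier G \<Longrightarrow> i \<le> n \<Longrightarrow> g \<otimes> r i \<otimes> r i = g"
  by (simp add: m_assoc r_square)

lemma parabolic_inv:
  assumes "g \<in> parabolic I" "I \<subseteq> {..n}"
  shows "inv g \<in> parabolic I"
  using assms(1)
proof induction
  case one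
  then show ?case by (simp add: parabolic.one)
next
  case (snoc g i)
  have i: "i \<le> n" "g \<in> carrier G" using snoc assms(2) parabolic_closed by auto
  have "r i \<in> parabolic I"
    using parabolic.snoc[OF parabolic.one[of I] snoc(2)] i by simp
  then show ?case
    using parabolic_mult[OF snoc.IH _ assms(2)] i by (simp add: inv_mult_group inv_r)
qed

lemma parabolic_all: "parabolic {..n} = carrier G"
proof
  show "parabolic {..n} \<subseteq> carrier G" using parabolic_closed by blast
  show "carrier G \<subseteq> parabolic {..n}"
  proof
    fix g assume "g \<in> carrier G"
    then show "g \<in> parabolic {..n}"
      by (rule generated) (auto intro: parabolic.intros)
  qed
qed

lemma act_mult:
  assumes "g \<in> carrier G" "h \<in> carrier G" "j \<le> n"
  shows "act (g \<otimes> h) f j = act h (act g f) j"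
proof -
  have "\<forall>j\<le>n. act (g \<otimes> h) f j = act h (act g f) j"
    using assms(2)
  proof (rule generated)
    show "\<forall>j\<le>n. act (g \<otimes> \<one>) f j = act \<one> (act g f) j"
      using assms(1) by (simp add: act_one)
    fix h i assume h: "h \<in> carrier G" "\<forall>j\<le>n. act (g \<otimes> h) f j = act h (act g f) j" "i \<le> n"
    then show "\<forall>j\<le>n. act (g \<otimes> (h \<otimes> r i)) f j = act (h \<otimes> r i) (act g f) j"
      using assms(1) by (simp add: act_snoc m_assoc[symmetric])
  qed
  then show ?thesis using assms(3) by simp
qed

lemma act_local:
  assumes "g \<in> parabolic I" "I \<subseteq> {..n}" "\<And>i. i \<in> I \<Longrightarrow> f i = f' i" "i \<in> I"
  shows "act g f i = act g f' i"
  using assms(1,4)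
proof (induction arbitrary: i)
  case one
  then have "i \<le> n" using assms(2) by auto
  then show ?case using assms(3)[OF one(1)] by (simp add: act_one)
next
  case (snoc g k)
  have "g \<in> carrier G" "i \<le> n" "k \<le> n" using snoc assms(2) parabolic_closed by auto
  then show ?case using snoc by (simp add: act_snoc)
qed

text \<open>These are the shortest representatives of the cosets of \<open>parabolic I\<close>,
  described by signs: no generator in \<open>I\<close> is a right descent.\<close>

definition minimal :: "nat set \<Rightarrow> 'a set" where
  "minimal I = {x \<in> carrier G. \<forall>i\<in>I. act x ones i > 0}"

text \<open>Inside \<open>parabolic I\<close> only the values of a functional on \<open>I\<close> matter, so the sign of
  \<open>act (x \<otimes> y) ones i\<close> agrees with that of \<open>act y ones i\<close>.\<close>

lemma L_mult:
  assumes x: "x \<in> minimal I" and I: "I \<subseteq> {..n}" and "y \<in> parabolic I"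
  shows "L (x \<otimes> y) = L x + L y"
  using assms(3)
proof induction
  case one
  then show ?case using x by (simp add: L_one minimal_def)
next
  case (snoc y i)
  have c: "x \<in> carrier G" "y \<in> carrier G" "i \<le> n"
    using x snoc I parabolic_closed by (auto simp: minimal_def)
  \<comment> \<open>\<open>L_snoc\<close> asks for positivity at all nodes, so the functional is
    reset to 1 outside \<open>I\<close>; by \<open>act_local\<close> this does not change the value
    at \<open>i\<close>.\<close>
  define f where "f j = (if j \<in> I then act x ones j else 1)" for j
  have pos: "f j > 0" for j using x by (simp add: f_def minimal_def)
  have "act (x \<otimes> y) ones i = act y (act x ones) i"
    using c by (simp add: act_mult)
  also have "\<dots> = act y f i"
    by (rule act_local[OF snoc(1) I _ snoc(2)]) (simp add: f_def)
  finally have "act (x \<otimes> y) ones i = act y f i" .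
  then show ?case
    using L_snoc[OF c(2,3), of f] L_snoc[of "x \<otimes> y" i ones] c pos snoc.IH
    by (auto simp: m_assoc)
qed

text \<open>By additivity the weights of \<open>y\<close> and of its inverse add up to the weight 0
  of the identity.\<close>

lemma one_if_ascents:
  assumes "I \<subseteq> {..n}" "y \<in> parabolic I" "y \<in> minimal I"
  shows "y = \<one>"
proof -
  have y: "y \<in> carrier G" using assms parabolic_closed by blast
  then have "L y + L (inv y) = L \<one>"
    using L_mult[OF assms(3,1) parabolic_inv[OF assms(2,1)]] by simp
  then show ?thesis using L_eq_0[OF y] by (simp add: L_one)
qed

text \<open>Going from \<open>x\<close> to \<open>x \<otimes> y\<close> adds \<open>L y\<close>, and
  going back adds \<open>L (inv y)\<close> since that element is minimal too. The round trip changes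
  nothing, so both weights vanish.\<close>

lemma minimal_unique:
  assumes I: "I \<subseteq> {..n}" and x: "x \<in> minimal I" and "x \<otimes> y \<in> minimal I" and y: "y \<in> parabolic I"
  shows "y = \<one>"
proof -
  have c: "x \<in> carrier G" "y \<in> carrier G"
    using x y I parabolic_closed by (auto simp: minimal_def)
  have "L (x \<otimes> y \<otimes> inv y) = L (x \<otimes> y) + L (inv y)"
    by (rule L_mult[OF assms(3) I parabolic_inv[OF y I]])
  moreover have "x \<otimes> y \<otimes> inv y = x" using c by (simp add: m_assoc)
  ultimately have "L y = 0" using L_mult[OF x I y] by simp
  then show ?thesis using L_eq_0 c by blast
qed

lemma not_minimal_descent:
  assumes "x \<in> carrier G" "x \<notin> minimal I" "I \<subseteq> {..n}"
  obtains i where "i \<in> I" "act x ones i < 0" "L x = L (x \<otimes> r i) + c i" "L (x \<otimes> r i) < L x"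
proof -
  obtain i where i: "i \<in> I" "\<not> act x ones i > 0" using assms(1,2) by (auto simp: minimal_def)
  then have "i \<le> n" using assms(3) by auto
  then show ?thesis using that[OF i(1)] L_snoc[OF assms(1), of i ones] c_pos[of i] i by auto
qed

text \<open>Descents in \<open>I\<close> are stripped off on the right until none is left, which
  stops because each lowers \<open>L\<close>; injectivity is \<open>minimal_unique\<close>. For
  \<open>K = {..n}\<close> these are the cosets in the whole group, and smaller \<open>K\<close>
  serve to build up the finite parabolic subgroups node by node.\<close>

lemma parabolic_decomp:
  assumes IK: "I \<subseteq> K" "K \<subseteq> {..n}"
  shows "bij_betw (\<lambda>(x, y). x \<otimes> y) ((minimal I \<inter> parabolic K) \<times> parabolic I) (parabolic K)"
proof (rule bij_betw_imageI)
  have I: "I \<subseteq> {..n}" using IK by auto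
  show "inj_on (\<lambda>(x, y). x \<otimes> y) ((minimal I \<inter> parabolic K) \<times> parabolic I)"
  proof (rule inj_onI, clarify)
    fix x y x' y'
    assume x: "x \<in> minimal I" and y: "y \<in> parabolic I" and x': "x' \<in> minimal I"
      and y': "y' \<in> parabolic I" and eq: "x \<otimes> y = x' \<otimes> y'"
    have c: "x \<in> carrier G" "x' \<in> carrier G" "y \<in> carrier G" "y' \<in> carrier G"
      using x x' y y' I parabolic_closed by (auto simp: minimal_def)
    have "x' = x \<otimes> (y \<otimes> inv y')"
      using c eq by (simp add: m_assoc[symmetric]) (simp add: m_assoc)
    moreover have p: "y \<otimes> inv y' \<in> parabolic I"
      by (rule parabolic_mult[OF parabolic_inv[OF y' I] y I])
    ultimately have "y \<otimes> inv y' = \<one>"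
      using minimal_unique[OF I x _ p] x' by simp
    then have "inv (inv y') = y" using c by (intro inv_equality) simp_all
    then have "y = y'" using c by simp
    then show "x = x' \<and> y = y'" using eq c by simp
  qed
  show "(\<lambda>(x, y). x \<otimes> y) ` ((minimal I \<inter> parabolic K) \<times> parabolic I) = parabolic K"
  proof (intro equalityI subsetI)
    fix g assume "g \<in> (\<lambda>(x, y). x \<otimes> y) ` ((minimal I \<inter> parabolic K) \<times> parabolic I)"
    then obtain x y where "x \<in> parabolic K" "y \<in> parabolic I" "g = x \<otimes> y" by auto
    then show "g \<in> parabolic K"
      using parabolic_mult[OF parabolic_mono[OF _ IK(1)] _ IK(2)] by simp
  next
    fix g assume "g \<in> parabolic K"
    then show "g \<in> (\<lambda>(x, y). x \<otimes> y) ` ((minimal I \<inter> parabolic K) \<times> parabolic I)"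
    proof (induction "L g" arbitrary: g rule: less_induct)
      case less
      have g: "g \<in> carrier G" using parabolic_closed[OF less.prems IK(2)] .
      show ?case
      proof (cases "g \<in> minimal I")
        case True
        then have "(g, \<one>) \<in> (minimal I \<inter> parabolic K) \<times> parabolic I"
          using less.prems parabolic.one by simp
        then show ?thesis by (rule rev_image_eqI) (simp add: g)
      next
        case False
        then obtain i where i: "i \<in> I" "L (g \<otimes> r i) < L g"
          using not_minimal_descent[OF g False I] by blast
        have "i \<in> K" using i(1) IK(1) by auto
        then have "g \<otimes> r i \<in> parabolic K" by (rule parabolic.snoc[OF less.prems])
        from less.hyps[OF i(2) this] obtain x y where
          xy: "x \<in> minimal I \<inter> parabolic K" "y \<in> parabolic I" "g \<otimes> r i = x \<otimes> y" by auto
        have c: "x \<in> carrier G" "y \<in> carrier G" "i \<le> n"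
          using xy i I parabolic_closed[of y I] by (auto simp: minimal_def)
        have "g = x \<otimes> (y \<otimes> r i)"
          using snoc_snoc[OF g c(3)] xy(3) c by (simp add: m_assoc)
        moreover have "(x, y \<otimes> r i) \<in> (minimal I \<inter> parabolic K) \<times> parabolic I"
          using xy(1) parabolic.snoc[OF xy(2) i(1)] by simp
        ultimately show ?thesis by (metis (no_types, lifting) case_prod_conv rev_image_eqI)
      qed
    qed
  qed
qed

text \<open>Every element other than the identity has a descent, so it arises from a lower level by
  one of finitely many generators. This makes the cardinalities in the coefficients of
  \<open>gf\<close> genuine counts.\<close>

lemma finite_level: "finite {g \<in> carrier G. L g = k}"
proof (induction k rule: less_induct)
  case (less k)
  define B where "B = (\<Union>l\<in>{..<k}. {g \<in> carrier G. L g = l})"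
  have "finite B" unfolding B_def using less by auto
  moreover have "{g \<in> carrier G. L g = k} \<subseteq> insert \<one> ((\<lambda>(g, i). g \<otimes> r i) ` (B \<times> {..n}))"
  proof
    fix g assume g: "g \<in> {g \<in> carrier G. L g = k}"
    show "g \<in> insert \<one> ((\<lambda>(g, i). g \<otimes> r i) ` (B \<times> {..n}))"
    proof (cases "g \<in> minimal {..n}")
      case True
      then show ?thesis using one_if_ascents[of "{..n}" g] g by (simp add: parabolic_all)
    next
      case False
      obtain i where i: "i \<in> {..n}" "L (g \<otimes> r i) < L g"
        using not_minimal_descent[OF _ False] g by blast
      then have "(g \<otimes> r i, i) \<in> B \<times> {..n}" using g by (auto simp: B_def)
      moreover have "g = (\<lambda>(g, i). g \<otimes> r i) (g \<otimes> r i, i)" using g i by (simp add: snoc_snoc)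
      ultimately show ?thesis by (intro insertI2 rev_image_eqI)
    qed
  qed
  moreover from \<open>finite B\<close> have "finite (insert \<one> ((\<lambda>(g, i). g \<otimes> r i) ` (B \<times> {..n})))" by simp
  ultimately show ?case using finite_subset by blast
qed

section \<open>Generating functions by weight\<close>

definition gf :: "'a set \<Rightarrow> rat fps" where
  "gf D = Abs_fps (\<lambda>k. of_nat (card {g \<in> D. L g = k}))"

lemma finite_level_subset: "D \<subseteq> carrier G \<Longrightarrow> finite {g \<in> D. L g = k}"
  by (rule finite_subset[OF _ finite_level[of k]]) auto

lemma gf_mult:
  assumes "bij_betw (\<lambda>(x, y). x \<otimes> y) (A \<times> B) D" "A \<subseteq> carrier G" "B \<subseteq> carrier G"
    and "\<And>x y. x \<in> A \<Longrightarrow> y \<in> B \<Longrightarrow> L (x \<otimes> y) = L x + L y"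
  shows "gf D = gf A * gf B"
proof (rule fps_ext)
  fix k
  define U where "U = (\<Union>i\<in>{0..k}. {x \<in> A. L x = i} \<times> {y \<in> B. L y = k - i})"
  have "bij_betw (\<lambda>(x, y). x \<otimes> y) U {g \<in> D. L g = k}"
  proof (rule bij_betw_imageI)
    show "inj_on (\<lambda>(x, y). x \<otimes> y) U"
      by (rule inj_on_subset[OF bij_betw_imp_inj_on[OF assms(1)]]) (auto simp: U_def)
    have "D = (\<lambda>(x, y). x \<otimes> y) ` (A \<times> B)" using bij_betw_imp_surj_on[OF assms(1)] by simp
    then show "(\<lambda>(x, y). x \<otimes> y) ` U = {g \<in> D. L g = k}"
      using assms(4) by (force simp: U_def image_iff)
  qed
  then have "card {g \<in> D. L g = k} = card U" by (simp add: bij_betw_same_card)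
  also have "card U = (\<Sum>i\<in>{0..k}. card ({x \<in> A. L x = i} \<times> {y \<in> B. L y = k - i}))"
    unfolding U_def using assms(2,3) finite_level_subset by (intro card_UN_disjoint) auto
  finally show "fps_nth (gf D) k = fps_nth (gf A * gf B) k"
    by (simp add: gf_def fps_mult_nth card_cartesian_product)
qed

lemma gf_parabolic_decomp:
  assumes "I \<subseteq> K" "K \<subseteq> {..n}"
  shows "gf (parabolic K) = gf (minimal I \<inter> parabolic K) * gf (parabolic I)"
proof (rule gf_mult[OF parabolic_decomp[OF assms]])
  have I: "I \<subseteq> {..n}" using assms by auto
  show "minimal I \<inter> parabolic K \<subseteq> carrier G" "parabolic I \<subseteq> carrier G"
    using parabolic_closed[OF _ I] by (auto simp: minimal_def)
  show "L (x \<otimes> y) = L x + L y" if "x \<in> minimal I \<inter> parabolic K" "y \<in> parabolic I" for x y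
    using L_mult[OF _ I that(2)] that(1) by blast
qed

lemma gf_finite: "finite D \<Longrightarrow> gf D = (\<Sum>g\<in>D. fps_X ^ L g)"
proof (rule fps_ext)
  fix k assume D: "finite D"
  have "fps_nth (\<Sum>g\<in>D. fps_X ^ L g) k = (\<Sum>g\<in>D. if L g = k then 1 else 0 :: rat)"
    by (simp add: fps_sum_nth fps_X_power_nth eq_commute)
  also have "\<dots> = of_nat (card {g \<in> D. L g = k})"
    using D by (simp add: sum.If_cases Int_def)
  finally show "fps_nth (gf D) k = fps_nth (\<Sum>g\<in>D. fps_X ^ L g) k" by (simp add: gf_def)
qed

lemma gf_nth_0:
  assumes "\<one> \<in> D" "D \<subseteq> carrier G"
  shows "fps_nth (gf D) 0 = 1"
proof -
  have "{g \<in> D. L g = 0} = {\<one>}" using assms L_eq_0 L_one by auto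
  then show ?thesis by (simp add: gf_def)
qed

lemma gf_parabolic_inverse:
  assumes "I \<subseteq> {..n}"
  shows "gf (parabolic I) * inverse (gf (parabolic I)) = 1"
proof -
  have "fps_nth (gf (parabolic I)) 0 = 1"
    using gf_nth_0[OF parabolic.one] parabolic_closed[OF _ assms] by blast
  then show ?thesis by (simp add: inverse_mult_eq_1')
qed

text \<open>The null root takes the constant value \<open>n + 1\<close> at \<open>ones\<close>, so no element has only descents.\<close>

lemma ascent_exists:
  assumes "g \<in> carrier G"
  obtains i where "i \<le> n" "act g ones i > 0"
proof -
  have "(\<Sum>j\<le>n. act g ones j) = int n + 1"
    using assms
  proof (rule generated)
    show "(\<Sum>j\<le>n. act \<one> ones j) = int n + 1" by (simp add: act_one)
    fix g i assume g: "g \<in> carrier G" "(\<Sum>j\<le>n. act g ones j) = int n + 1" "i \<le> n"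
    have "(\<Sum>j\<le>n. act (g \<otimes> r i) ones j)
      = (\<Sum>j\<le>n. act g ones j) - (\<Sum>j\<le>n. affC_cartan n i j) * act g ones i"
      using g by (simp add: act_snoc sum_subtractf sum_distrib_right)
    then show "(\<Sum>j\<le>n. act (g \<otimes> r i) ones j) = int n + 1"
      using g sum_affC_cartan[OF n2 g(3), of n] n2 by auto
  qed
  then have "\<not> (\<forall>j\<le>n. act g ones j \<le> 0)"
    using sum_nonpos[of "{..n}" "act g ones"] by force
  then show ?thesis using that by force
qed

text \<open>Each \<open>g\<close> is counted with a sign once for every subset of its ascent set,
  and the signs cancel because that set is never empty.\<close>

lemma alternating_sum: "(\<Sum>I\<in>Pow {..n}. (- 1) ^ card I * gf (minimal I)) = 0"
proof (rule fps_ext)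
  fix k
  define F where "F = {g \<in> carrier G. L g = k}"
  define asc where "asc g = {i \<in> {..n}. act g ones i > 0}" for g
  have F: "finite F" unfolding F_def by (rule finite_level)
  have sgn: "fps_nth ((- 1) ^ m * f) k = (- 1) ^ m * fps_nth f k" for m and f :: "rat fps"
    by (cases "even m") auto
  have "card {g \<in> minimal I. L g = k} = card {g \<in> F. I \<subseteq> asc g}" if "I \<subseteq> {..n}" for I
    by (rule arg_cong[of _ _ card]) (use that in \<open>auto simp: F_def minimal_def asc_def\<close>)
  then have "fps_nth (\<Sum>I\<in>Pow {..n}. (- 1) ^ card I * gf (minimal I)) k
    = (\<Sum>I\<in>Pow {..n}. (- 1) ^ card I * of_nat (card {g \<in> F. I \<subseteq> asc g}))"
    by (simp add: fps_sum_nth sgn gf_def)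
  also have "\<dots> = (\<Sum>I\<in>Pow {..n}. \<Sum>g\<in>F. if I \<subseteq> asc g then (- 1) ^ card I else 0)"
    using F by (simp add: sum.If_cases Int_def mult.commute)
  also have "\<dots> = (\<Sum>g\<in>F. \<Sum>I\<in>Pow {..n}. if I \<subseteq> asc g then (- 1) ^ card I else 0)"
    by (rule sum.swap)
  also have "\<dots> = (\<Sum>g\<in>F. 0)"
  proof (rule sum.cong[OF HOL.refl])
    fix g assume "g \<in> F"
    then have g: "g \<in> carrier G" by (simp add: F_def)
    have ne: "asc g \<noteq> {}" using ascent_exists[OF g] by (auto simp: asc_def)
    have "{I \<in> Pow {..n}. I \<subseteq> asc g} = Pow (asc g)" by (auto simp: asc_def)
    then have "(\<Sum>I\<in>Pow {..n}. if I \<subseteq> asc g then (- 1) ^ card I else 0) = (\<Sum>I\<in>Pow (asc g). (- 1) ^ card I :: rat)"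
      by (simp add: sum.If_cases Int_def)
    also have "\<dots> = 0" by (rule sum_Pow_neg_one_power) (use ne in \<open>auto simp: asc_def\<close>)
    finally show "(\<Sum>I\<in>Pow {..n}. if I \<subseteq> asc g then (- 1) ^ card I else 0) = (0 :: rat)" .
  qed
  finally show "fps_nth (\<Sum>I\<in>Pow {..n}. (- 1) ^ card I * gf (minimal I)) k = fps_nth 0 k" by simp
qed

text \<open>By the coset decomposition the series of \<open>minimal I\<close> is the quotient of the
  whole series by that of \<open>parabolic I\<close>; the common factor is nonzero and
  cancels.\<close>

lemma alternating_sum_inverse: "(\<Sum>I\<in>Pow {..n}. (- 1) ^ card I * inverse (gf (parabolic I))) = 0"
proof -
  have "(- 1) ^ card I * gf (minimal I) = gf (carrier G) * ((- 1) ^ card I * inverse (gf (parabolic I)))"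
    if "I \<subseteq> {..n}" for I
  proof -
    have "minimal I \<inter> carrier G = minimal I" by (auto simp: minimal_def)
    then have "gf (carrier G) = gf (minimal I) * gf (parabolic I)"
      using gf_parabolic_decomp[OF that, unfolded parabolic_all] by simp
    then show ?thesis using gf_parabolic_inverse[OF that] by (simp add: ac_simps)
  qed
  then have "gf (carrier G) * (\<Sum>I\<in>Pow {..n}. (- 1) ^ card I * inverse (gf (parabolic I)))
    = (\<Sum>I\<in>Pow {..n}. (- 1) ^ card I * gf (minimal I))"
    unfolding sum_distrib_left by (intro sum.cong) auto
  then have "gf (carrier G) * (\<Sum>I\<in>Pow {..n}. (- 1) ^ card I * inverse (gf (parabolic I))) = 0"
    using alternating_sum by simp
  moreover have "gf (carrier G) \<noteq> 0"
    using gf_nth_0[of "carrier G"] by force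
  ultimately show ?thesis by simp
qed

text \<open>Generators in \<open>I\<close> leave the values on \<open>K\<close> unchanged. Hence
  elements of \<open>parabolic I\<close> have no descent in \<open>K\<close>, and conversely an
  element without descents in \<open>K\<close> can be reduced to the identity by descents in
  \<open>I\<close> alone.\<close>

lemma gf_parabolic_union:
  assumes IK: "I \<union> K \<subseteq> {..n}" "I \<inter> K = {}"
    and orth: "\<And>i j. i \<in> I \<Longrightarrow> j \<in> K \<Longrightarrow> affC_cartan n i j = 0"
  shows "gf (parabolic (I \<union> K)) = gf (parabolic I) * gf (parabolic K)"
proof -
  have "minimal K \<inter> parabolic (I \<union> K) = parabolic I"
  proof (intro equalityI subsetI)
    fix x assume x: "x \<in> parabolic I"
    then have "x \<in> carrier G" using IK parabolic_closed by blast
    moreover have "act x ones j = 1" if j: "j \<in> K" for j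
      using x
    proof induction
      case one
      then show ?case using j IK by (intro act_one) auto
    next
      case (snoc g i)
      have "g \<in> carrier G" "i \<le> n" "j \<le> n" using snoc IK j parabolic_closed by auto
      then show ?case using snoc orth j by (simp add: act_snoc)
    qed
    ultimately show "x \<in> minimal K \<inter> parabolic (I \<union> K)"
      using parabolic_mono[OF x, of "I \<union> K"] by (simp add: minimal_def)
  next
    fix x assume "x \<in> minimal K \<inter> parabolic (I \<union> K)"
    then show "x \<in> parabolic I"
    proof (induction "L x" arbitrary: x rule: less_induct)
      case less
      have x: "x \<in> carrier G" using less.prems IK parabolic_closed by blast
      show ?case
      proof (cases "x \<in> minimal (I \<union> K)")
        case True
        then have "x = \<one>" using one_if_ascents[OF IK(1)] less.prems by blast
        then show ?thesis by (simp add: parabolic.one)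
      next
        case False
        then obtain i where i: "i \<in> I \<union> K" "act x ones i < 0" "L (x \<otimes> r i) < L x"
          using not_minimal_descent[OF x False IK(1)] by blast
        then have iI: "i \<in> I" using less.prems by (force simp: minimal_def)
        have il: "i \<le> n" using iI IK by auto
        have "x \<otimes> r i \<in> minimal K"
          using less.prems x il IK orth[OF iI] by (auto simp: minimal_def act_snoc subset_iff)
        then have "x \<otimes> r i \<in> parabolic I"
          using less.hyps[OF i(3)] less.prems parabolic.snoc i by blast
        then show ?thesis
          using parabolic.snoc[OF _ iI, of "x \<otimes> r i"] snoc_snoc[OF x il] by simp
      qed
    qed
  qed
  then show ?thesis using gf_parabolic_decomp[of K "I \<union> K"] IK by simp
qed

end

section \<open>Finite parabolic subgroups\<close>

context weighted_affine_C
begin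

text \<open>In the coordinates \<open>V g\<close> the generators \<open>r 0, \<dots>, r (n - 1)\<close> act as signed permutations:
  \<open>r 0\<close> changes the sign of the coordinate 0 and \<open>r p\<close> swaps the coordinates \<open>p - 1\<close> and \<open>p\<close>.\<close>

definition V :: "'a \<Rightarrow> nat \<Rightarrow> int" where
  "V g i = (\<Sum>m\<le>i. act g ones m)"

lemma V_one: "i \<le> n \<Longrightarrow> V \<one> i = int i + 1"
  by (simp add: V_def act_one)

lemma V_snoc:
  assumes "g \<in> carrier G" "i < n" "p < n"
  shows "V (g \<otimes> r p) i = (if p = 0 then if i = 0 then - V g 0 else V g i
    else if i + 1 = p then V g p else if i = p then V g (p - 1) else V g i)"
proof -
  have e: "V (g \<otimes> r p) i = V g i - (\<Sum>m\<le>i. affC_cartan n p m) * act g ones p"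
    using assms by (simp add: V_def act_snoc sum_subtractf sum_distrib_right)
  have p: "act g ones p = V g p - V g (p - 1)" if "p \<noteq> 0"
    using that by (cases p) (simp_all add: V_def)
  have 0: "act g ones 0 = V g 0" by (simp add: V_def)
  show ?thesis
    unfolding e using sum_affC_cartan[OF n2, of p i] assms p 0
    by (auto simp: algebra_simps)
qed

lemma act_eq_V: "act g ones i = (if i = 0 then V g 0 else V g i - V g (i - 1))"
  by (cases i) (simp_all add: V_def)

lemma L_snoc_V:
  assumes "g \<in> carrier G" "p \<le> n" "if p = 0 then V g 0 > 0 else V g (p - 1) < V g p"
  shows "L (g \<otimes> r p) = L g + c p"
  using L_snoc[OF assms(1,2), of ones] assms(3) by (auto simp: act_eq_V split: if_splits)

section \<open>Moving one coordinate past the others\<close>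

definition app :: "'a \<Rightarrow> nat list \<Rightarrow> 'a" where
  "app x ws = foldl (\<lambda>g i. g \<otimes> r i) x ws"

lemma app_simps [simp]: "app x [] = x" "app x (ws @ [i]) = app x ws \<otimes> r i"
  "app x (i # ws) = app (x \<otimes> r i) ws"
  by (simp_all add: app_def)

lemma app_closed: "x \<in> carrier G \<Longrightarrow> set ws \<subseteq> {..n} \<Longrightarrow> app x ws \<in> carrier G"
  by (induction ws arbitrary: x) auto

lemma app_parabolic: "x \<in> parabolic I \<Longrightarrow> set ws \<subseteq> I \<Longrightarrow> app x ws \<in> parabolic I"
  by (induction ws arbitrary: x) (auto intro: parabolic.snoc)

text \<open>The generators \<open>r p\<close> to \<open>r (q - 1)\<close> carry the entry at
  position \<open>p - 1\<close> to position \<open>q - 1\<close>. Every step goes up because the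
  travelling entry is smaller than the one it passes.\<close>

lemma run_up:
  assumes x: "x \<in> carrier G" and pq: "1 \<le> p" "p \<le> q" "q \<le> n"
    and less: "\<And>j. p \<le> j \<Longrightarrow> j < q \<Longrightarrow> V x (p - 1) < V x j"
  shows "L (app x [p..<q]) = L x + (q - p) * c 1 \<and>
    (\<forall>i<n. V (app x [p..<q]) i = (if p - 1 \<le> i \<and> i + 1 < q then V x (i + 1)
      else if i + 1 = q then V x (p - 1) else V x i))"
  using pq(2,3) less
proof (induction q rule: dec_induct)
  case base
  then show ?case using pq(1) by auto
next
  case (step q)
  define y where "y = app x [p..<q]"
  have IH: "L y = L x + (q - p) * c 1"
    "\<And>i. i < n \<Longrightarrow> V y i = (if p - 1 \<le> i \<and> i + 1 < q then V x (i + 1)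
      else if i + 1 = q then V x (p - 1) else V x i)"
    using step unfolding y_def by auto
  have y: "y \<in> carrier G" unfolding y_def using x step by (intro app_closed) auto
  have q: "1 \<le> q" "q < n" "q \<noteq> 0" using step pq by auto
  have app: "app x [p..<Suc q] = y \<otimes> r q" using step by (simp add: y_def)
  have "V y (q - 1) = V x (p - 1)" "V y q = V x q" using IH(2)[of "q - 1"] IH(2)[of q] q pq by auto
  then have "L (y \<otimes> r q) = L y + c 1"
    using L_snoc_V[OF y, of q] q step c_mid[of q] by simp
  moreover have "V (y \<otimes> r q) i = (if p - 1 \<le> i \<and> i + 1 < Suc q then V x (i + 1)
      else if i + 1 = Suc q then V x (p - 1) else V x i)" if i: "i < n" for i
  proof -
    consider "i + 1 = q" | "i = q" | "i + 1 < q" | "i > q" by linarith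
    then show ?thesis
      by cases (use V_snoc[OF y i q(2)] IH(2)[OF i] IH(2)[OF q(2)] IH(2)[of "q - 1"] q step(1) pq(1) in auto)
  qed
  ultimately show ?case
    unfolding app using IH(1) step by (simp add: Suc_diff_le)
qed

text \<open>The generators \<open>r p\<close> down to \<open>r 1\<close> bring the entry at position
  \<open>p\<close> to the front; here the travelling entry is the larger one, so every step again
  goes up.\<close>

lemma run_down:
  assumes "x \<in> carrier G" "p < n" "\<And>j. j < p \<Longrightarrow> V x j < V x p"
  shows "L (app x (rev [1..<Suc p])) = L x + p * c 1 \<and>
    (\<forall>i<n. V (app x (rev [1..<Suc p])) i = (if i = 0 then V x p else if i \<le> p then V x (i - 1) else V x i))"
  using assms
proof (induction p arbitrary: x)
  case 0
  then show ?case by simp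
next
  case (Suc p)
  define y where "y = x \<otimes> r (Suc p)"
  have y: "y \<in> carrier G" unfolding y_def using Suc.prems by simp
  have Vy: "V y i = (if i = p then V x (Suc p) else if i = Suc p then V x p else V x i)" if "i < n" for i
    unfolding y_def using V_snoc[OF Suc.prems(1) that Suc.prems(2)] by simp
  have app: "app x (rev [1..<Suc (Suc p)]) = app y (rev [1..<Suc p])"
    by (simp add: y_def)
  have "V x (Suc p - 1) < V x (Suc p)" using Suc.prems(3)[of p] by simp
  then have Ly: "L y = L x + c 1"
    unfolding y_def using L_snoc_V[of x "Suc p"] Suc.prems(1,2) c_mid[of "Suc p"] by simp
  have IH: "L (app y (rev [1..<Suc p])) = L y + p * c 1 \<and>
    (\<forall>i<n. V (app y (rev [1..<Suc p])) i = (if i = 0 then V y p else if i \<le> p then V y (i - 1) else V y i))"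
  proof (rule Suc.IH[OF y])
    show "p < n" using Suc.prems by simp
    show "V y j < V y p" if "j < p" for j
      using Vy[of j] Vy[of p] Suc.prems(2) Suc.prems(3)[of j] that by simp
  qed
  have "V (app y (rev [1..<Suc p])) i = (if i = 0 then V x (Suc p) else if i \<le> Suc p then V x (i - 1) else V x i)"
    if i: "i < n" for i
  proof -
    consider "i = 0" | "i \<noteq> 0" "i \<le> p" | "i = Suc p" | "i > Suc p" by linarith
    then show ?thesis
      by cases (use IH i Vy[of p] Vy[of "i - 1"] Vy[of i] Suc.prems(2) in auto)
  qed
  then show ?case unfolding app using IH Ly by simp
qed

end

text \<open>A finite set of integers has only one increasing enumeration. The comparison function
  \<open>h'\<close> enumerates the interval with the value \<open>h m\<close> left out.\<close>

lemma increasing_image_determined: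
  fixes h :: "nat \<Rightarrow> int"
  assumes inc: "\<And>i. i + 1 < m \<Longrightarrow> h i < h (i + 1)" and im: "h ` {..m} = {b+1..b + int m + 1}"
  shows "\<forall>i<m. h i = (if b + 1 + int i < h m then b + 1 + int i else b + 2 + int i)"
proof -
  define h' where "h' i = (if b + 1 + int i < h m then b + 1 + int i else b + 2 + int i)" for i
  have card: "card (h ` {..m}) = card {..m}" unfolding im by simp
  then have inj: "inj_on h {..m}" by (simp add: eq_card_imp_inj_on)
  have strict: "h i < h j" if "i < j" "j < m" for i j
    using that
  proof (induction j)
    case (Suc j)
    then show ?case using inc[of j] by (cases "i = j") auto
  qed simp
  have hm: "h m \<in> {b+1..b + int m + 1}" using im by blast
  have s: "h ` {..<m} = {b+1..b + int m + 1} - {h m}"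
  proof -
    have "{..m} = insert m {..<m}" by auto
    then have "h ` {..m} = insert (h m) (h ` {..<m})" by simp
    moreover have "h m \<notin> h ` {..<m}" by (auto dest: inj_onD[OF inj])
    ultimately show ?thesis using im by auto
  qed
  have s': "h' ` {..<m} = {b+1..b + int m + 1} - {h m}"
  proof (intro equalityI subsetI)
    fix y assume "y \<in> h' ` {..<m}"
    then show "y \<in> {b+1..b + int m + 1} - {h m}" using hm by (auto simp: h'_def split: if_splits)
  next
    fix y assume y: "y \<in> {b+1..b + int m + 1} - {h m}"
    show "y \<in> h' ` {..<m}"
    proof (cases "y < h m")
      case True
      then show ?thesis using y hm by (intro image_eqI[of _ _ "nat (y - b - 1)"]) (auto simp: h'_def)
    next
      case False
      then show ?thesis using y hm by (intro image_eqI[of _ _ "nat (y - b - 2)"]) (auto simp: h'_def)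
    qed
  qed
  have sorted: "sorted (map g [0..<m]) \<and> distinct (map g [0..<m])"
    if "\<And>i j. i < j \<Longrightarrow> j < m \<Longrightarrow> g i < (g j :: int)" for g
    using that by (auto simp: sorted_iff_nth_mono_less distinct_conv_nth nat_neq_iff intro!: less_imp_le)
       (metis less_irrefl)+
  have "map h [0..<m] = map h' [0..<m]"
  proof (rule sorted_distinct_set_unique)
    show "sorted (map h [0..<m])" "distinct (map h [0..<m])"
      using sorted[of h] strict by auto
    show "sorted (map h' [0..<m])" "distinct (map h' [0..<m])"
      using sorted[of h'] by (auto simp: h'_def)
    show "set (map h [0..<m]) = set (map h' [0..<m])"
      using s s' by (simp add: atLeast0LessThan)
  qed
  then show ?thesis unfolding h'_def by simp
qed

context weighted_affine_C
begin

text \<open>The group permutes the positions \<open>b\<close> to \<open>b + m\<close> up to sign.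
  Node 0 is allowed for every \<open>b\<close>: it changes one sign in the window if
  \<open>b = 0\<close> and acts outside of it otherwise. So the lemma covers both ordinary and
  signed permutations.\<close>

lemma V_abs_image:
  assumes "x \<in> parabolic I" and bm: "b + m < n"
    and I: "\<And>p. p \<in> I \<Longrightarrow> p \<le> b + m \<and> (p = 0 \<or> b < p)"
  shows "(\<lambda>i. \<bar>V x (b + i)\<bar>) ` {..m} = {int b + 1..int b + int m + 1}"
  using assms(1)
proof induction
  case one
  have "(\<lambda>i. \<bar>V \<one> (b + i)\<bar>) ` {..m} = (\<lambda>i. int i + (int b + 1)) ` {..m}"
    by (rule image_cong) (use bm in \<open>auto simp: V_one\<close>)
  also have "\<dots> = {int b + 1..int b + int m + 1}"
  proof (intro equalityI subsetI)
    fix y assume "y \<in> {int b + 1..int b + int m + 1}"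
    then show "y \<in> (\<lambda>i. int i + (int b + 1)) ` {..m}"
      by (intro image_eqI[of _ _ "nat (y - int b - 1)"]) auto
  qed auto
  finally show ?case .
next
  case (snoc x p)
  have "I \<subseteq> {..n}" using I bm by force
  then have x: "x \<in> carrier G" using snoc parabolic_closed by blast
  have p: "p \<le> b + m" "p = 0 \<or> b < p" "p < n" using I[OF snoc(2)] bm by auto
  define \<sigma> where "\<sigma> i = (if p = 0 then i else if b + i + 1 = p then i + 1 else if b + i = p then i - 1 else i)" for i
  have "\<bar>V (x \<otimes> r p) (b + i)\<bar> = \<bar>V x (b + \<sigma> i)\<bar>" if "i \<le> m" for i
    using V_snoc[OF x _ p(3), of "b + i"] that p bm
    by (auto simp: \<sigma>_def)
  then have "(\<lambda>i. \<bar>V (x \<otimes> r p) (b + i)\<bar>) ` {..m} = (\<lambda>i. \<bar>V x (b + i)\<bar>) ` \<sigma> ` {..m}"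
    unfolding image_image by (intro image_cong) auto
  also have "\<sigma> ` {..m} = {..m}"
  proof -
    have "\<sigma> i \<le> m \<and> \<sigma> (\<sigma> i) = i" if "i \<le> m" for i
      using p that by (auto simp: \<sigma>_def)
    then show ?thesis by (metis (no_types, lifting) atMost_iff bij_betw_byWitness bij_betw_imp_surj_on image_subsetI)
  qed
  finally show ?case using snoc by simp
qed

lemma V_pos:
  assumes "x \<in> parabolic I" "0 \<notin> I" "I \<subseteq> {..<n}" "i < n"
  shows "V x i > 0"
  using assms(1,4)
proof (induction arbitrary: i)
  case one
  then show ?case by (simp add: V_one)
next
  case (snoc x p)
  have "I \<subseteq> {..n}" using assms(3) by auto
  then have x: "x \<in> carrier G" using snoc parabolic_closed by blast
  have p: "p < n" "p \<noteq> 0" using snoc(2) assms(2,3) by (auto intro: gr0I)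
  show ?case
    unfolding V_snoc[OF x snoc.prems p(1)] using snoc.IH p snoc.prems by auto
qed

text \<open>If the entries before the last are positive and increasing, then the last entry alone
  fixes the whole window. This is what makes the coset representatives enumerable.\<close>

lemma V_determined:
  assumes "x \<in> parabolic I" "b + m < n" "\<And>p. p \<in> I \<Longrightarrow> p \<le> b + m \<and> (p = 0 \<or> b < p)"
    and inc: "\<And>i. i + 1 < m \<Longrightarrow> V x (b + i) < V x (b + i + 1)"
    and pos: "\<And>i. i < m \<Longrightarrow> V x (b + i) > 0"
  shows "\<bar>V x (b + m)\<bar> \<in> {int b + 1..int b + int m + 1}"
    and "i < m \<Longrightarrow> V x (b + i) = (if int b + 1 + int i < \<bar>V x (b + m)\<bar> then int b + 1 + int i else int b + 2 + int i)"
proof -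
  note im = V_abs_image[OF assms(1-3)]
  show "\<bar>V x (b + m)\<bar> \<in> {int b + 1..int b + int m + 1}"
    using im by blast
  have "\<bar>V x (b + i)\<bar> < \<bar>V x (b + (i + 1))\<bar>" if "i + 1 < m" for i
    using inc[OF that] pos[of i] pos[of "i + 1"] that by (simp add: add.assoc)
  from increasing_image_determined[of m "\<lambda>i. \<bar>V x (b + i)\<bar>", OF this im]
  show "i < m \<Longrightarrow> V x (b + i) = (if int b + 1 + int i < \<bar>V x (b + m)\<bar> then int b + 1 + int i else int b + 2 + int i)"
    using pos[of i] by (auto split: if_splits)
qed

text \<open>The action is faithful: the quotient of \<open>x\<close> by \<open>x'\<close> takes the
  value 1 at each node of \<open>I\<close>, so it has no descent there and is trivial.\<close>

lemma eq_if_act_eq: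
  assumes x: "x \<in> parabolic I" "x' \<in> parabolic I" and I: "I \<subseteq> {..n}"
    and eq: "\<And>i. i \<in> I \<Longrightarrow> act x ones i = act x' ones i"
  shows "x = x'"
proof -
  have c: "x \<in> carrier G" "x' \<in> carrier G" using x I parabolic_closed by auto
  have p: "x \<otimes> inv x' \<in> parabolic I" by (rule parabolic_mult[OF parabolic_inv[OF x(2) I] x(1) I])
  have "act (x \<otimes> inv x') ones i = 1" if i: "i \<in> I" for i
  proof -
    have il: "i \<le> n" using i I by auto
    have "act (x \<otimes> inv x') ones i = act (inv x') (act x ones) i" using c il by (simp add: act_mult)
    also have "\<dots> = act (inv x') (act x' ones) i"
      by (rule act_local[OF parabolic_inv[OF x(2) I] I eq i])
    also have "\<dots> = act (x' \<otimes> inv x') ones i" using c il by (subst act_mult) auto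
    finally show ?thesis using c il by (simp add: act_one)
  qed
  then have "x \<otimes> inv x' \<in> minimal I" using c by (simp add: minimal_def)
  then have "x \<otimes> inv x' = \<one>" by (rule one_if_ascents[OF I p])
  then have "inv (inv x') = x" using c by (intro inv_equality) simp_all
  then show ?thesis using c by simp
qed

lemma parabolic_empty: "parabolic {} = {\<one>}"
proof -
  have "x \<in> parabolic {} \<Longrightarrow> x = \<one>" for x by (induction rule: parabolic.induct) auto
  then show ?thesis using parabolic.one by auto
qed

text \<open>This is the symmetric group on the coordinates \<open>b\<close> to \<open>b + m\<close>.
  A further node multiplies the series by the bracket of \<open>m + 2\<close>, with one minimal
  representative for each possible last entry.\<close>

lemma gf_parabolic_A:
  assumes "b + m < n"
  shows "gf (parabolic {b + 1..<b + 1 + m}) = qfact (fps_X ^ c 1) (m + 1)"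
  using assms
proof (induction m)
  case 0
  show ?case by (simp add: parabolic_empty gf_finite L_one qfact_def q_bracket_def)
next
  case (Suc m)
  define I where "I = {b + 1..<b + 1 + m}"
  define K where "K = {b + 1..<b + 1 + Suc m}"
  \<comment> \<open>\<open>X p\<close> moves the entry \<open>p\<close>, which starts at position
    \<open>p - 1\<close>, to the last position \<open>b + Suc m\<close>.\<close>
  define X where "X p = app \<one> [p..<b + Suc m + 1]" for p
  have IK: "I \<subseteq> K" "K \<subseteq> {..n}" "I \<subseteq> {..n}" using Suc.prems by (auto simp: I_def K_def)
  define P where "P = {b + 1..b + Suc m + 1}"
  have X: "L (X p) = (b + Suc m + 1 - p) * c 1"
    "\<And>i. i < n \<Longrightarrow> V (X p) i = (if p - 1 \<le> i \<and> i < b + Suc m then int i + 2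
      else if i = b + Suc m then int p else int i + 1)" if p: "p \<in> P" for p
    using run_up[of \<one> p "b + Suc m + 1"] p Suc.prems by (auto simp: X_def P_def V_one L_one of_nat_diff)
  have XK: "X p \<in> parabolic K" if "p \<in> P" for p
    unfolding X_def by (rule app_parabolic[OF parabolic.one]) (use that in \<open>auto simp: K_def P_def\<close>)
  have top: "V (X p) (b + Suc m) = int p" if "p \<in> P" for p
    using X(2)[OF that, of "b + Suc m"] Suc.prems by simp
  have "minimal I \<inter> parabolic K = X ` P"
  proof (intro equalityI subsetI)
    fix x assume "x \<in> X ` P"
    then obtain p where p: "p \<in> P" "x = X p" by auto
    have "act x ones i > 0" if i: "i \<in> I" for i
      using X(2)[OF p(1), of i] X(2)[OF p(1), of "i - 1"] i Suc.prems p
      by (auto simp: act_eq_V I_def P_def)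
    then show "x \<in> minimal I \<inter> parabolic K"
      using XK[OF p(1)] p(2) parabolic_closed[OF _ IK(2)] by (simp add: minimal_def)
  next
    fix x assume x: "x \<in> minimal I \<inter> parabolic K"
    have xK: "x \<in> parabolic K" using x by simp
    have inc: "V x (b + i) < V x (b + i + 1)" if "i + 1 < Suc m" for i
    proof -
      have "b + i + 1 \<in> I" using that by (simp add: I_def)
      then have "act x ones (b + i + 1) > 0" using x by (simp add: minimal_def)
      then show ?thesis by (simp add: act_eq_V)
    qed
    have pos: "V x i > 0" if "i < n" for i
      by (rule V_pos[OF xK _ _ that]) (use Suc.prems in \<open>auto simp: K_def\<close>)
    have K: "p \<le> b + Suc m \<and> (p = 0 \<or> b < p)" if "p \<in> K" for p using that by (auto simp: K_def)
    note det = V_determined[OF xK Suc.prems K inc pos]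
    define p where "p = nat (V x (b + Suc m))"
    have Vp: "V x (b + Suc m) = int p" using pos[OF Suc.prems] by (simp add: p_def)
    have p: "p \<in> P" using det(1) Suc.prems unfolding Vp by (auto simp: P_def)
    have VX: "V x j = V (X p) j" if j: "b \<le> j" "j \<le> b + Suc m" for j
    proof (cases "j = b + Suc m")
      case True
      then show ?thesis using Vp top[OF p] by simp
    next
      case False
      then obtain i where i: "j = b + i" "i < Suc m" using j by (metis le_add_diff_inverse less_le nat_add_left_cancel_less)
      show ?thesis
        unfolding i(1) using det(2)[of i] i Suc.prems X(2)[OF p, of "b + i"] p Vp by (auto simp: P_def)
    qed
    have "x = X p"
      by (rule eq_if_act_eq[OF xK XK[OF p] IK(2)])
        (use VX in \<open>auto simp: act_eq_V K_def\<close>)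
    then show "x \<in> X ` P" using p by simp
  qed
  moreover have inj: "inj_on X P"
    by (rule inj_onI) (metis top of_nat_eq_iff)
  ultimately have "gf (minimal I \<inter> parabolic K) = (\<Sum>p\<in>P. fps_X ^ L (X p))"
    by (simp add: gf_finite P_def sum.reindex o_def)
  also have "\<dots> = (\<Sum>p\<in>P. (fps_X ^ c 1) ^ (b + Suc m + 1 - p))"
    by (intro sum.cong) (simp_all add: X(1) mult.commute[of _ "c (Suc 0)"] flip: power_mult)
  also have "\<dots> = q_bracket (m + 2) (fps_X ^ c 1)"
    unfolding q_bracket_def P_def
    by (rule sum.reindex_bij_witness[of _ "\<lambda>j. b + Suc m + 1 - j" "\<lambda>p. b + Suc m + 1 - p"]) auto
  finally show ?case
    using gf_parabolic_decomp[OF IK(1,2)] Suc.IH Suc.prems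
    by (simp add: I_def K_def qfact_Suc[of _ "Suc m"])
qed

text \<open>These are the signed permutations of \<open>k\<close> coordinates. A further coordinate
  brings two minimal representatives for each \<open>p\<close> from 1 to \<open>k + 1\<close>, with
  last entry \<open>p\<close> or \<open>- p\<close>. The negative ones account for the summand
  \<open>fps_X ^ c 0 * (fps_X ^ c 1) ^ k\<close> in the new factor of \<open>qpoch\<close>.\<close>

lemma gf_parabolic_C:
  assumes "k \<le> n"
  shows "gf (parabolic {..<k}) = qpoch (fps_X ^ c 1) (fps_X ^ c 0) k * qfact (fps_X ^ c 1) k"
  using assms
proof (induction k)
  case 0
  show ?case by (simp add: parabolic_empty gf_finite L_one qfact_def qpoch_def)
next
  case (Suc k)
  then have k: "k < n" by simp
  define I where "I = {..<k}"
  define K where "K = {..<Suc k}"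
  have IK: "I \<subseteq> K" "K \<subseteq> {..n}" "I \<subseteq> {..n}" using k by (auto simp: I_def K_def)
  define P where "P = {1..k + 1}"
  define X where "X p = app \<one> [p..<k + 1]" for p
  have X: "L (X p) = (k + 1 - p) * c 1"
    "\<And>i. i < n \<Longrightarrow> V (X p) i = (if p - 1 \<le> i \<and> i < k then int i + 2
      else if i = k then int p else int i + 1)" if p: "p \<in> P" for p
    using run_up[of \<one> p "k + 1"] p k by (auto simp: X_def P_def V_one L_one of_nat_diff)
  \<comment> \<open>To end with \<open>- p\<close>, the entry \<open>p\<close> is brought to
    position 0, negated by \<open>r 0\<close> and carried to position \<open>k\<close>. Being
    negative, it is smaller than everything it passes on the way.\<close>
  define Z where "Z p = app \<one> (rev [1..<Suc (p - 1)])" for p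
  define Y where "Y p = app (Z p \<otimes> r 0) [1..<k + 1]" for p
  have Y: "L (Y p) = (p - 1) * c 1 + c 0 + k * c 1"
    "\<And>i. i < n \<Longrightarrow> V (Y p) i = (if i < p - 1 then int i + 1 else if i < k then int i + 2
      else if i = k then - int p else int i + 1)" if p: "p \<in> P" for p
  proof -
    have Zc: "Z p \<in> carrier G" unfolding Z_def using p k by (intro app_closed) (auto simp: P_def)
    have Z: "L (Z p) = (p - 1) * c 1"
      "\<And>i. i < n \<Longrightarrow> V (Z p) i = (if i = 0 then int p else if i \<le> p - 1 then int i else int i + 1)"
      using run_down[of \<one> "p - 1"] p k unfolding Z_def[symmetric]
      by (auto simp: P_def V_one L_one of_nat_diff)
    define U where "U = Z p \<otimes> r 0"
    have Uc: "U \<in> carrier G" using Zc by (simp add: U_def)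
    have LU: "L U = (p - 1) * c 1 + c 0"
      unfolding U_def using L_snoc_V[OF Zc, of 0] Z p k by (simp add: P_def)
    have VU: "V U i = (if i = 0 then - int p else if i \<le> p - 1 then int i else int i + 1)" if "i < n" for i
      unfolding U_def using V_snoc[OF Zc that, of 0] Z(2)[OF that] Z(2)[of 0] k by auto
    have less: "V U (1 - 1) < V U j" if "1 \<le> j" "j < k + 1" for j
      using VU[of j] VU[of 0] that k p by (auto simp: P_def)
    note run = run_up[OF Uc _ _ _ less, of "k + 1", unfolded U_def, folded Y_def, folded U_def]
    show "L (Y p) = (p - 1) * c 1 + c 0 + k * c 1"
      using run LU k by simp
    show "V (Y p) i = (if i < p - 1 then int i + 1 else if i < k then int i + 2
      else if i = k then - int p else int i + 1)" if i: "i < n" for i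
      using run VU[of "i + 1"] VU[of 0] VU[of i] i k p by (auto simp: P_def)
  qed
  have XK: "X p \<in> parabolic K" if "p \<in> P" for p
    unfolding X_def by (rule app_parabolic[OF parabolic.one]) (auto simp: K_def)
  have YK: "Y p \<in> parabolic K" if "p \<in> P" for p
    unfolding Y_def Z_def
    by (intro app_parabolic parabolic.snoc parabolic.one) (use that in \<open>auto simp: K_def P_def\<close>)
  have topX: "V (X p) k = int p" if "p \<in> P" for p using X(2)[OF that k] by simp
  have topY: "V (Y p) k = - int p" if "p \<in> P" for p using Y(2)[OF that k] that by (auto simp: P_def)
  have minX: "X p \<in> minimal I" if p: "p \<in> P" for p
  proof -
    have "act (X p) ones i > 0" if i: "i \<in> I" for i
      using X(2)[OF p, of i] X(2)[OF p, of "i - 1"] i k p by (auto simp: act_eq_V I_def P_def)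
    then show ?thesis using parabolic_closed[OF XK[OF p] IK(2)] by (simp add: minimal_def)
  qed
  have minY: "Y p \<in> minimal I" if p: "p \<in> P" for p
  proof -
    have "act (Y p) ones i > 0" if i: "i \<in> I" for i
      using Y(2)[OF p, of i] Y(2)[OF p, of "i - 1"] i k p by (auto simp: act_eq_V I_def P_def)
    then show ?thesis using parabolic_closed[OF YK[OF p] IK(2)] by (simp add: minimal_def)
  qed
  have eq: "minimal I \<inter> parabolic K = X ` P \<union> Y ` P"
  proof (intro equalityI subsetI)
    fix x assume "x \<in> X ` P \<union> Y ` P"
    then show "x \<in> minimal I \<inter> parabolic K" using XK YK minX minY by auto
  next
    fix x assume x: "x \<in> minimal I \<inter> parabolic K"
    have xK: "x \<in> parabolic K" using x by simp
    have inc: "V x i < V x (i + 1)" if "i + 1 < k" for i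
    proof -
      have "i + 1 \<in> I" using that by (simp add: I_def)
      then have "act x ones (i + 1) > 0" using x by (simp add: minimal_def)
      then show ?thesis by (simp add: act_eq_V)
    qed
    have pos: "V x i > 0" if "i < k" for i
      using that
    proof (induction i)
      case 0
      then have "act x ones 0 > 0" using x by (simp add: minimal_def I_def)
      then show ?case by (simp add: act_eq_V)
    next
      case (Suc i)
      then show ?case using inc[of i] by simp
    qed
    have K: "p \<le> 0 + k \<and> (p = 0 \<or> 0 < p)" if "p \<in> K" for p using that by (auto simp: K_def)
    have k0: "0 + k < n" using k by simp
    have inc0: "V x (0 + i) < V x (0 + i + 1)" if "i + 1 < k" for i using inc[OF that] by simp
    have pos0: "V x (0 + i) > 0" if "i < k" for i using pos[OF that] by simp
    note det = V_determined[OF xK k0 K inc0 pos0, simplified]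
    define p where "p = nat \<bar>V x k\<bar>"
    have p: "p \<in> P" using det(1) by (auto simp: P_def p_def)
    have *: "x = y" if y: "y \<in> parabolic K" "\<And>i. i \<le> k \<Longrightarrow> V x i = V y i" for y
      by (rule eq_if_act_eq[OF xK y(1) IK(2)]) (use y(2) in \<open>auto simp: act_eq_V K_def\<close>)
    show "x \<in> X ` P \<union> Y ` P"
    proof (cases "V x k > 0")
      case True
      have "V x i = V (X p) i" if "i \<le> k" for i
        using that True det(2)[of i] X(2)[OF p, of i] k p
        by (cases "i = k") (auto simp: p_def P_def split: if_splits)
      then show ?thesis using *[OF XK[OF p]] p by blast
    next
      case False
      then have Vk: "V x k = - int p" by (simp add: p_def)
      have "V x i = V (Y p) i" if "i \<le> k" for i
        using that Vk det(2)[of i] Y(2)[OF p, of i] k p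
        by (cases "i = k") (auto simp: P_def split: if_splits)
      then show ?thesis using *[OF YK[OF p]] p by blast
    qed
  qed
  have "x \<noteq> y" if "x \<in> X ` P" "y \<in> Y ` P" for x y
  proof -
    have "V x k > 0" "V y k < 0" using that topX topY by (auto simp: P_def)
    then show ?thesis by auto
  qed
  then have disj: "X ` P \<inter> Y ` P = {}" by blast
  have injX: "inj_on X P" by (rule inj_onI) (metis topX of_nat_eq_iff)
  have injY: "inj_on Y P" by (rule inj_onI) (metis topY of_nat_eq_iff neg_equal_iff_equal)
  let ?q = "fps_X ^ c 1 :: rat fps" and ?t = "fps_X ^ c 0 :: rat fps"
  have "gf (minimal I \<inter> parabolic K) = (\<Sum>p\<in>P. fps_X ^ L (X p)) + (\<Sum>p\<in>P. fps_X ^ L (Y p))"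
    unfolding eq using disj injX injY
    by (simp add: gf_finite P_def sum.union_disjoint sum.reindex o_def)
  also have "(\<Sum>p\<in>P. fps_X ^ L (X p)) = (\<Sum>p\<in>P. ?q ^ (k + 1 - p))"
    by (intro sum.cong) (simp_all add: X(1) mult.commute[of _ "c (Suc 0)"] flip: power_mult)
  also have "\<dots> = q_bracket (Suc k) ?q"
    unfolding q_bracket_def P_def
    by (rule sum.reindex_bij_witness[of _ "\<lambda>j. k + 1 - j" "\<lambda>p. k + 1 - p"]) auto
  also have "(\<Sum>p\<in>P. fps_X ^ L (Y p)) = (\<Sum>p\<in>P. ?t * ?q ^ k * ?q ^ (p - 1))"
    by (intro sum.cong) (simp_all add: Y(1) power_add ac_simps flip: power_mult)
  also have "\<dots> = ?t * ?q ^ k * (\<Sum>p\<in>P. ?q ^ (p - 1))"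
    by (simp add: sum_distrib_left)
  also have "(\<Sum>p\<in>P. ?q ^ (p - 1)) = q_bracket (Suc k) ?q"
    unfolding q_bracket_def P_def
    by (rule sum.reindex_bij_witness[of _ "\<lambda>j. j + 1" "\<lambda>p. p - 1"]) auto
  finally have "gf (minimal I \<inter> parabolic K) = (1 + ?t * ?q ^ k) * q_bracket (Suc k) ?q"
    by (simp add: algebra_simps)
  then show ?case
    using gf_parabolic_decomp[OF IK(1,2)] Suc.IH k
    by (simp add: I_def K_def qfact_Suc qpoch_def ac_simps)
qed

end

section \<open>Macdonald's formula\<close>

lemma fps_nth_qfact_0: "fps_nth q 0 = 0 \<Longrightarrow> fps_nth (qfact q k) 0 = (1 :: rat)"
proof (induction k)
  case (Suc k)
  have "fps_nth (q_bracket (Suc k) q) 0 = 1"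
    using Suc.prems unfolding q_bracket_def sum.lessThan_Suc_shift by (simp add: fps_sum_nth)
  then show ?case using Suc by (simp add: qfact_Suc)
qed (simp add: qfact_def)

lemma fps_nth_qpoch_0: "fps_nth t 0 = 0 \<Longrightarrow> fps_nth (qpoch q t k) 0 = (1 :: rat)"
  by (induction k) (simp_all add: qpoch_def)

context weighted_affine_C
begin

text \<open>Reversing the path preserves the Cartan matrix and exchanges \<open>c 0\<close> with
  \<open>c n\<close>, so the parabolic subgroups at the right end need no computation of their
  own.\<close>

lemma weighted_affine_C_flip:
  "weighted_affine_C G n (\<lambda>i. r (n - i)) L (\<lambda>i. c (n - i)) (\<lambda>g f j. act g (\<lambda>i. f (n - i)) (n - j))"
proof unfold_locales
  show "2 \<le> n" by (rule n2)
  fix g P assume g: "g \<in> carrier G" "P \<one>"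
    "\<And>g i. g \<in> carrier G \<Longrightarrow> P g \<Longrightarrow> i \<le> n \<Longrightarrow> P (g \<otimes> r (n - i))"
  have step: "P (g \<otimes> r i)" if "g \<in> carrier G" "P g" "i \<le> n" for g i
    using g(3)[OF that(1,2), of "n - i"] that(3) by simp
  show "P g" by (rule generated[OF g(1,2) step])
next
  fix g i j f assume "g \<in> carrier G" "i \<le> n" "j \<le> n"
  then show "act (g \<otimes> r (n - i)) (\<lambda>i. f (n - i)) (n - j)
    = act g (\<lambda>i. f (n - i)) (n - j) - affC_cartan n i j * act g (\<lambda>i. f (n - i)) (n - i)"
    by (simp add: act_snoc affC_cartan_flip)
next
  fix g i and f :: "nat \<Rightarrow> int"
  assume "g \<in> carrier G" "i \<le> n" "\<And>j. j \<le> n \<Longrightarrow> 0 < f j"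
  then show "0 < act g (\<lambda>i. f (n - i)) (n - i) \<and> L (g \<otimes> r (n - i)) = L g + c (n - i) \<or>
    act g (\<lambda>i. f (n - i)) (n - i) < 0 \<and> L g = L (g \<otimes> r (n - i)) + c (n - i)"
    by (intro L_snoc) auto
next
  fix i assume "1 \<le> i" "i < n"
  then show "c (n - i) = c (n - 1)" using c_mid[of "n - i"] c_mid[of "n - 1"] n2 by simp
qed (use r_square act_one L_one L_eq_0 c_pos in auto)

lemma gf_parabolic_C_right:
  assumes "l \<le> n"
  shows "gf (parabolic {n + 1 - l..<n + 1}) = qpoch (fps_X ^ c 1) (fps_X ^ c n) l * qfact (fps_X ^ c 1) l"
proof -
  interpret flip: weighted_affine_C G n "\<lambda>i. r (n - i)" L "\<lambda>i. c (n - i)"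
    "\<lambda>g f j. act g (\<lambda>i. f (n - i)) (n - j)"
    by (rule weighted_affine_C_flip)
  have "flip.parabolic {..<l} = parabolic {n + 1 - l..<n + 1}"
  proof (intro equalityI subsetI)
    fix x assume "x \<in> flip.parabolic {..<l}"
    then show "x \<in> parabolic {n + 1 - l..<n + 1}"
      by (induction rule: flip.parabolic.induct) (use assms in \<open>auto intro!: parabolic.intros\<close>)
  next
    fix x assume "x \<in> parabolic {n + 1 - l..<n + 1}"
    then show "x \<in> flip.parabolic {..<l}"
    proof (induction rule: parabolic.induct)
      case (snoc g i)
      then have "n - i \<in> {..<l}" "n - (n - i) = i" using assms by auto
      then show ?case using flip.parabolic.snoc[OF snoc.IH, of "n - i"] by simp
    qed (rule flip.parabolic.one)
  qed
  then show ?thesis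
    using flip.gf_parabolic_C[OF assms] c_mid[of "n - 1"] n2 by simp
qed

text \<open>A subset of the path is cut at its smallest missing node \<open>k\<close>: the nodes
  below \<open>k\<close> form a group of signed permutations, and the \<open>n - k\<close> nodes
  above contribute \<open>Z (n - k)\<close>. In \<open>Z\<close> the same cut leaves ordinary
  permutations below the missing node.\<close>

lemma gf_carrier:
  defines "q \<equiv> fps_X ^ c 1" and "s \<equiv> fps_X ^ c 0" and "t \<equiv> fps_X ^ c n"
  shows "gf (carrier G) * (\<Prod>i<n. 1 - s * t * q ^ (n - 1 + i)) = qfact q n * qpoch q s n * qpoch q t n"
proof -
  define f where "f k = inverse (qfact q k)" for k
  define S where "S k = inverse (qpoch q s k)" for k
  define T where "T k = inverse (qpoch q t k)" for k
  have q0: "fps_nth q 0 = 0" "fps_nth s 0 = 0" "fps_nth t 0 = 0"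
    using c_pos[of 1] c_pos[of 0] c_pos[of n] n2 by (auto simp: q_def s_def t_def)
  have f: "f k * qfact q k = 1" for k
    unfolding f_def using fps_nth_qfact_0[OF q0(1), of k] by (simp add: inverse_mult_eq_1)
  have S: "S k * qpoch q s k = 1" for k
    unfolding S_def using fps_nth_qpoch_0[OF q0(2), of q k] by (simp add: inverse_mult_eq_1)
  have T: "T k * qpoch q t k = 1" for k
    unfolding T_def using fps_nth_qpoch_0[OF q0(3), of q k] by (simp add: inverse_mult_eq_1)
  have f0: "f 0 = 1" using f[of 0] by (simp add: qfact_def)
  define h where "h I = (- 1) ^ card I * inverse (gf (parabolic I))" for I
  \<comment> \<open>The alternating sum over all subsets of the last \<open>l\<close> nodes of the
    path.\<close>
  define Z where "Z l = (\<Sum>I\<in>Pow {n + 1 - l..<n + 1}. h I)" for l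
  have h_split: "(\<Sum>J\<in>Pow {Suc k..<n + 1}. h (I \<union> J)) = h I * Z (n - k)"
    if k: "k \<le> n" and I: "I \<subseteq> {..<k}" for I k
  proof -
    have "h (I \<union> J) = h I * h J" if J: "J \<in> Pow {Suc k..<n + 1}" for J
    proof -
      have lt: "i < k" "k < j \<and> j \<le> n" if "i \<in> I" "j \<in> J" for i j
        using that I J by auto
      have sub: "I \<union> J \<subseteq> {..n}" "finite I" "finite J"
        using I J k by (auto intro: finite_subset)
      have disj: "I \<inter> J = {}" using lt by fastforce
      have "affC_cartan n i j = 0" if "i \<in> I" "j \<in> J" for i j
      proof -
        show ?thesis using lt[OF that] by (auto simp: affC_cartan_def)
      qed
      then have "gf (parabolic (I \<union> J)) = gf (parabolic I) * gf (parabolic J)"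
        by (intro gf_parabolic_union sub disj) auto
      then show ?thesis
        using sub disj by (simp add: h_def card_Un_disjoint power_add fps_inverse_mult ac_simps)
    qed
    moreover have "{n + 1 - (n - k)..<n + 1} = {Suc k..<n + 1}" using k by auto
    ultimately show ?thesis by (simp add: Z_def sum_distrib_left)
  qed
  have Z: "Z l = t ^ l * q ^ (l * (l - 1)) * f l * T l" if "l \<le> n" for l
    using that
  proof (induction l rule: less_induct)
    case (less l)
    define a where "a = n + 1 - l"
    have al: "a \<le> n + 1" "n + 1 - a = l" using less.prems by (auto simp: a_def)
    \<comment> \<open>The \<open>k - a\<close> nodes below \<open>k\<close> permute
      \<open>l - (n - k)\<close> coordinates. The missing node itself accounts for the extra 1 in
      \<open>l = (n - k) + (k - a + 1)\<close>, hence for the minus sign.\<close>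
    have ha: "h {a..<k} = - ((- 1) ^ l * (- 1) ^ (n - k) * f (l - (n - k)))" if k: "k \<in> {a..<n + 1}" for k
    proof -
      have e: "l - (n - k) = k - a + 1" "l = (n - k) + (k - a + 1)"
        using k less.prems by (auto simp: a_def)
      have eq: "{a..<k} = {n - l + 1..<n - l + 1 + (k - a)}" using k less.prems by (auto simp: a_def)
      have lt: "n - l + (k - a) < n" using k less.prems by (auto simp: a_def)
      have "gf (parabolic {a..<k}) = qfact q (k - a + 1)"
        unfolding eq gf_parabolic_A[OF lt] q_def ..
      moreover have "(- 1) ^ (k - a) = - ((- 1) ^ l * (- 1) ^ (n - k) :: rat fps)"
        unfolding e(2) by (simp add: power_add)
      ultimately show ?thesis by (simp add: h_def f_def e(1))
    qed
    have "Z l = h {a..<n + 1} + (\<Sum>k\<in>{a..<n + 1}. \<Sum>J\<in>Pow {Suc k..<n + 1}. h ({a..<k} \<union> J))"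
      unfolding Z_def a_def[symmetric] by (rule sum_Pow_first_missing[OF al(1)])
    also have "(\<Sum>k\<in>{a..<n + 1}. \<Sum>J\<in>Pow {Suc k..<n + 1}. h ({a..<k} \<union> J))
      = (\<Sum>k\<in>{a..<n + 1}. - ((- 1) ^ l * (- 1) ^ (n - k) * f (l - (n - k))) * Z (n - k))"
      by (intro sum.cong HOL.refl, subst h_split) (auto simp: ha)
    also have "\<dots> = (\<Sum>m<l. - ((- 1) ^ l * (- 1) ^ m * f (l - m)) * Z m)"
      by (rule sum.reindex_bij_witness[of _ "\<lambda>m. n - m" "\<lambda>k. n - k"]) (use less.prems in \<open>auto simp: a_def\<close>)
    also have "\<dots> = (\<Sum>m<l. - ((- 1) ^ l) * ((- t) ^ m * q ^ (m * (m - 1)) * f m * f (l - m) * T m))"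
      using less by (intro sum.cong) (auto simp: power_minus[of t] ac_simps)
    also have "\<dots> = - ((- 1) ^ l) * (\<Sum>m<l. (- t) ^ m * q ^ (m * (m - 1)) * f m * f (l - m) * T m)"
      by (simp add: sum_distrib_left)
    also have "(\<Sum>m<l. (- t) ^ m * q ^ (m * (m - 1)) * f m * f (l - m) * T m)
      = f l * T l - (- t) ^ l * q ^ (l * (l - 1)) * f l * T l"
    proof -
      \<comment> \<open>With \<open>s = 0\<close> all factors \<open>S\<close> and the product on
        the right become 1. The term \<open>m = l\<close> is then split off, since the recursion for
        \<open>Z l\<close> only involves \<open>m < l\<close>.\<close>
      have "(\<Sum>m\<le>l. (- t) ^ m * q ^ (m * (m - 1)) * f m * f (l - m) * 1 * T m)
        = f l * 1 * T l * (\<Prod>i<l. 1 - 0 * t * q ^ (l - 1 + i))"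
        by (rule qbinom_sum_inverse) (simp_all add: f T qpoch_def[of q 0])
      then show ?thesis by (simp add: lessThan_Suc_atMost[symmetric] f0 algebra_simps)
    qed
    also have "h {a..<n + 1} = (- 1) ^ l * (f l * T l)"
    proof -
      have "gf (parabolic {a..<n + 1}) = qpoch q t l * qfact q l"
        using gf_parabolic_C_right[OF less.prems] by (simp add: a_def q_def t_def)
      then show ?thesis
        using al(2) by (simp add: h_def f_def T_def fps_inverse_mult ac_simps)
    qed
    also have "(- 1) ^ l * (f l * T l) + - ((- 1) ^ l) * (f l * T l - (- t) ^ l * q ^ (l * (l - 1)) * f l * T l)
      = ((- 1) ^ l * (- t) ^ l) * q ^ (l * (l - 1)) * f l * T l"
    proof -
      have "e * x + - e * (x - u * v * w * z) = e * u * v * w * z" for e x u v w z :: "rat fps"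
        by (simp add: algebra_simps)
      then show ?thesis .
    qed
    finally show ?case by (simp add: power_mult_distrib[symmetric])
  qed
  have "{..n} = {0..<n + 1}" by auto
  then have "0 = (\<Sum>I\<in>Pow {0..<n + 1}. h I)"
    using alternating_sum_inverse by (simp add: h_def)
  also have "\<dots> = h {0..<n + 1} + (\<Sum>k\<in>{0..<n + 1}. \<Sum>J\<in>Pow {Suc k..<n + 1}. h ({0..<k} \<union> J))"
    by (rule sum_Pow_first_missing) simp
  also have "(\<Sum>k\<in>{0..<n + 1}. \<Sum>J\<in>Pow {Suc k..<n + 1}. h ({0..<k} \<union> J))
    = (\<Sum>k\<in>{0..<n + 1}. (- 1) ^ k * (S k * f k) * Z (n - k))"
  proof (intro sum.cong HOL.refl)
    fix k assume k: "k \<in> {0..<n + 1}"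
    then have "gf (parabolic {0..<k}) = qpoch q s k * qfact q k"
      using gf_parabolic_C[of k] by (simp add: q_def s_def atLeast0LessThan)
    then have "h {0..<k} = (- 1) ^ k * (S k * f k)"
      by (simp add: h_def S_def f_def fps_inverse_mult)
    then show "(\<Sum>J\<in>Pow {Suc k..<n + 1}. h ({0..<k} \<union> J)) = (- 1) ^ k * (S k * f k) * Z (n - k)"
      using k by (subst h_split) auto
  qed
  also have "\<dots> = (\<Sum>m\<le>n. (- 1) ^ n * ((- t) ^ m * q ^ (m * (m - 1)) * f m * f (n - m) * S (n - m) * T m))"
  proof (rule sum.reindex_bij_witness[of _ "\<lambda>m. n - m" "\<lambda>k. n - k"])
    fix k assume "k \<in> {0..<n + 1}"
    then have k: "n = k + (n - k)" "n - (n - k) = k" by auto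
    have "(- 1) ^ n = (- 1) ^ k * (- 1 :: rat fps) ^ (n - k)"
      by (subst k(1)) (rule power_add)
    then show "(- 1) ^ n * ((- t) ^ (n - k) * q ^ ((n - k) * (n - k - 1)) * f (n - k) * f (n - (n - k)) *
        S (n - (n - k)) * T (n - k)) = (- 1) ^ k * (S k * f k) * Z (n - k)"
      unfolding Z[OF diff_le_self] k(2) power_minus[of t] by (simp add: ac_simps)
  qed auto
  also have "\<dots> = (- 1) ^ n * (f n * S n * T n * (\<Prod>i<n. 1 - s * t * q ^ (n - 1 + i)))"
    unfolding sum_distrib_left[symmetric] by (subst qbinom_sum_inverse[OF f S T]) simp
  \<comment> \<open>The full set has \<open>n + 1\<close> elements, so its sign is opposite to
    \<open>(- 1) ^ n\<close>; this term carries the wanted reciprocal.\<close>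
  also have "h {0..<n + 1} = - ((- 1) ^ n * inverse (gf (carrier G)))"
    by (simp add: h_def parabolic_all[symmetric] lessThan_Suc_atMost atLeast0LessThan)
  finally have "(- 1) ^ n * inverse (gf (carrier G)) = (- 1) ^ n * (f n * S n * T n * (\<Prod>i<n. 1 - s * t * q ^ (n - 1 + i)))"
    by simp
  then have "(- 1) ^ n * ((- 1) ^ n * inverse (gf (carrier G)))
    = (- 1) ^ n * ((- 1) ^ n * (f n * S n * T n * (\<Prod>i<n. 1 - s * t * q ^ (n - 1 + i))))"
    by simp
  then have inv: "inverse (gf (carrier G)) = f n * S n * T n * (\<Prod>i<n. 1 - s * t * q ^ (n - 1 + i))"
    by (simp flip: power_mult_distrib mult.assoc)
  have "qfact q n * qpoch q s n * qpoch q t n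
    = qfact q n * qpoch q s n * qpoch q t n * (gf (carrier G) * inverse (gf (carrier G)))"
    using gf_parabolic_inverse[of "{..n}"] by (simp add: parabolic_all)
  also have "\<dots> = gf (carrier G) * (\<Prod>i<n. 1 - s * t * q ^ (n - 1 + i)) *
      ((f n * qfact q n) * (S n * qpoch q s n) * (T n * qpoch q t n))"
    unfolding inv by (simp only: ac_simps)
  finally show ?thesis by (simp add: f S T)
qed

end

section \<open>Folding homomorphisms\<close>

text \<open>Convergence of power series is coefficientwise, and coefficient \<open>k\<close> of a
  finite partial sum no longer changes once the finite level \<open>k\<close> is included.\<close>

lemma fps_has_sum_gf:
  assumes "weighted_affine_C G n r L c act"
  shows "((\<lambda>g. fps_X ^ L g) has_sum weighted_affine_C.gf L (carrier G)) (carrier G)"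
proof -
  interpret weighted_affine_C G n r L c act by (rule assms)
  show ?thesis
    unfolding has_sum_def
  proof (rule tendsto_fpsI)
    fix k
    define F where "F = {g \<in> carrier G. L g = k}"
    have "fps_nth (\<Sum>g\<in>Y. fps_X ^ L g) k = fps_nth (gf (carrier G)) k"
      if Y: "finite Y" "F \<subseteq> Y" "Y \<subseteq> carrier G" for Y
    proof -
      have "{g \<in> Y. L g = k} = F" using Y by (auto simp: F_def)
      then have "fps_nth (gf Y) k = fps_nth (gf (carrier G)) k" by (simp add: gf_def F_def)
      then show ?thesis using gf_finite[OF Y(1)] by simp
    qed
    then show "\<forall>\<^sub>F Y in finite_subsets_at_top (carrier G).
        fps_nth (\<Sum>g\<in>Y. fps_X ^ L g) k = fps_nth (gf (carrier G)) k"
      unfolding eventually_finite_subsets_at_top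
      by (intro exI[of _ F]) (use finite_level[of k] in \<open>auto simp: F_def\<close>)
  qed
qed

section \<open>Coxeter matrices of the four affine types\<close>

lemma doubleton_eq_less_iff:
  "i < j \<Longrightarrow> a < b \<Longrightarrow> {i, j} = {a, b} \<longleftrightarrow> i = a \<and> j = (b :: nat)"
  by (auto simp: doubleton_eq_iff)

lemma affine_C_m:
  assumes "N \<ge> 2" "i < j" "j \<le> N"
  shows "snd (affine_C N) i j = (if j = i + 1 then (if i = 0 \<or> j = N then 4 else 3) else 2)"
proof -
  have "{i, j} = {0, 1} \<longleftrightarrow> i = 0 \<and> j = 1" "{i, j} = {N - 1, N} \<longleftrightarrow> i = N - 1 \<and> j = N"
    "\<And>k. {i, j} = {k, k + 1} \<longleftrightarrow> i = k \<and> j = k + 1"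
    using assms by (intro doubleton_eq_less_iff; simp)+
  note eq = this
  show ?thesis
    using assms unfolding affine_C_def eq snd_conv by (cases "j = i + 1") auto
qed

lemma affine_A_m:
  assumes "N \<ge> 2" "i < j" "j \<le> N"
  shows "snd (affine_A N) i j = (if j = i + 1 \<or> i = 0 \<and> j = N then 3 else 2)"
proof -
  have "{i, j} = {k, (k + 1) mod (N + 1)} \<longleftrightarrow> k = i \<and> j = i + 1 \<or> k = N \<and> i = 0 \<and> j = N" if "k \<le> N" for k
  proof (cases "k = N")
    case True
    then show ?thesis using assms doubleton_eq_less_iff[of i j 0 N] by (auto simp: insert_commute)
  next
    case False
    then show ?thesis using assms that doubleton_eq_less_iff[of i j k "k + 1"] by auto
  qed
  then have "(\<exists>k\<in>{0..N}. {i, j} = {k, (k + 1) mod (N + 1)}) \<longleftrightarrow> j = i + 1 \<or> i = 0 \<and> j = N"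
    using assms by auto
  then show ?thesis using assms(2) by (simp add: affine_A_def)
qed

lemma affine_B_m:
  assumes "N \<ge> 3" "i < j" "j \<le> N"
  shows "snd (affine_B N) i j = (if i = 0 \<and> j = 1 then 4
    else if 1 \<le> i \<and> (if j = N then i = N - 2 else j = i + 1) then 3 else 2)"
proof -
  have "{i, j} = {0, 1} \<longleftrightarrow> i = 0 \<and> j = 1" "{i, j} = {N - 2, N - 1} \<longleftrightarrow> i = N - 2 \<and> j = N - 1"
    "{i, j} = {N - 2, N} \<longleftrightarrow> i = N - 2 \<and> j = N" "\<And>k. {i, j} = {k, k + 1} \<longleftrightarrow> i = k \<and> j = k + 1"
    using assms by (intro doubleton_eq_less_iff; simp)+
  note eq = this
  show ?thesis
    using assms unfolding affine_B_def eq snd_conv by (cases "j = N") auto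
qed

lemma affine_D_m:
  assumes "N \<ge> 4" "i < j" "j \<le> N"
  shows "snd (affine_D N) i j = (if i = 0 \<and> j = 2 \<or> 1 \<le> i \<and> (if j = N then i = N - 2 else j = i + 1)
    then 3 else 2)"
proof -
  have "{i, j} = {0, 2} \<longleftrightarrow> i = 0 \<and> j = 2" "{i, j} = {1, 2} \<longleftrightarrow> i = 1 \<and> j = 2"
    "{i, j} = {N - 2, N - 1} \<longleftrightarrow> i = N - 2 \<and> j = N - 1"
    "{i, j} = {N - 2, N} \<longleftrightarrow> i = N - 2 \<and> j = N" "\<And>k. {i, j} = {k, k + 1} \<longleftrightarrow> i = k \<and> j = k + 1"
    using assms by (intro doubleton_eq_less_iff; simp)+
  note eq = this
  show ?thesis
    using assms unfolding affine_D_def eq snd_conv by (cases "j = N") auto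
qed

lemma crystallographic_affine_A: "crystallographic (affine_A N) {}"
  by standard (auto simp: affine_A_def insert_commute split: if_splits)

lemma crystallographic_affine_B: "N \<ge> 3 \<Longrightarrow> crystallographic (affine_B N) {0}"
proof
  fix i j assume "i \<in> fst (affine_B N)" "j \<in> fst (affine_B N)" "snd (affine_B N) i j = 4"
  then have "i \<noteq> j" "{i, j} = {0, 1}"
    by (auto simp: affine_B_def split: if_splits)
  then show "i \<in> {0} \<longleftrightarrow> j \<notin> {0}" by (auto simp: doubleton_eq_iff)
qed (auto simp: affine_B_def insert_commute)

lemma crystallographic_affine_D: "crystallographic (affine_D N) {}"
  by standard (auto simp: affine_D_def insert_commute split: if_splits)

lemma crystallographic_affine_C:
  assumes "N \<ge> 2"
  shows "crystallographic (affine_C N) {0, N}"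
proof
  fix i j assume ij: "i \<in> fst (affine_C N)" "j \<in> fst (affine_C N)" "snd (affine_C N) i j = 4"
  then have "i \<noteq> j" "{i, j} = {0, 1} \<or> {i, j} = {N - 1, N}"
    by (auto simp: affine_C_def split: if_splits)
  then show "i \<in> {0, N} \<longleftrightarrow> j \<notin> {0, N}" using assms by (auto simp: doubleton_eq_iff)
qed (auto simp: affine_C_def insert_commute)

context crystallographic
begin

section \<open>Words that replace a pair of generators\<close>

lemma reflect_apply: "reflect i f j = f j - cartan i j * f i"
  by (simp add: reflect_def)

text \<open>If all letters of \<open>us\<close> are ascents of an element, then appending
  \<open>us\<close> raises the length letter by letter. Stating this for arbitrary functionals makes
  it a finite check on Cartan entries.\<close>

definition growing :: "'a list \<Rightarrow> bool" where
  "growing us \<longleftrightarrow> (\<forall>g. (\<forall>s\<in>set us. g s > 0) \<longrightarrow> (\<forall>k<length us. act (take k us) g (us ! k) > 0))"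

lemma len_append_growing:
  assumes "growing us" "zs \<in> lists (fst X)" "us \<in> lists (fst X)" "\<And>s. s \<in> set us \<Longrightarrow> act zs (\<lambda>_. 1) s > 0"
  shows "len (zs @ us) = len zs + length us"
proof -
  have "len (zs @ take k us) = len zs + k" if "k \<le> length us" for k
    using that
  proof (induction k)
    case (Suc k)
    have l: "zs @ take k us \<in> lists (fst X)" "us ! k \<in> fst X"
      using assms(2,3) Suc.prems by (auto dest: in_set_takeD nth_mem)
    have "act (take k us) (act zs (\<lambda>_. 1)) (us ! k) > 0"
      using assms(1,4) Suc.prems unfolding growing_def by auto
    then have "len ((zs @ take k us) @ [us ! k]) = len (zs @ take k us) + 1"
      using len_snoc_cases[OF l, of "\<lambda>_. 1"] by auto
    then show ?case using Suc by (simp add: take_Suc_conv_app_nth)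
  qed simp
  from this[of "length us"] show ?thesis by simp
qed

text \<open>The three clauses mirror the nonempty words of \<open>dihedral_tails\<close>, with
  \<open>us\<close> for \<open>i\<close> and \<open>vs\<close> for \<open>j\<close>. The number
  \<open>m\<close> is the label in the source group, not in \<open>X\<close>.\<close>

definition fold_compatible :: "nat \<Rightarrow> 'a list \<Rightarrow> 'a list \<Rightarrow> bool" where
  "fold_compatible m us vs \<longleftrightarrow> (\<forall>g. (\<forall>s\<in>set us \<union> set vs. g s > 0) \<longrightarrow>
    (\<forall>s\<in>set us. act vs g s > 0 \<and> (m \<ge> 3 \<longrightarrow> act (us @ vs) g s > 0) \<and> (m \<ge> 4 \<longrightarrow> act (vs @ us @ vs) g s > 0)))"

abbreviation "S \<equiv> fst X"
abbreviation "m \<equiv> snd X"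

lemma cartan_2: "m a b = 2 \<Longrightarrow> a \<in> S \<Longrightarrow> b \<in> S \<Longrightarrow> a \<noteq> b \<Longrightarrow> cartan a b = 0 \<and> cartan b a = 0"
  using cartan_pair[of a b] by auto

lemma cartan_3: "m a b = 3 \<Longrightarrow> a \<in> S \<Longrightarrow> b \<in> S \<Longrightarrow> a \<noteq> b \<Longrightarrow> cartan a b = -1 \<and> cartan b a = -1"
  using cartan_pair[of a b] by auto

lemma cartan_4: "m a b = 4 \<Longrightarrow> a \<in> S \<Longrightarrow> b \<in> S \<Longrightarrow> a \<noteq> b \<Longrightarrow>
  cartan a b = -1 \<and> cartan b a = -2 \<or> cartan a b = -2 \<and> cartan b a = -1"
  using cartan_pair[of a b] by auto

lemma growing_1: "growing [a]"
  by (simp add: growing_def)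

lemma growing_2: "a \<in> S \<Longrightarrow> b \<in> S \<Longrightarrow> a \<noteq> b \<Longrightarrow> m a b = 2 \<Longrightarrow> growing [a, b]"
  by (auto simp: growing_def less_Suc_eq reflect_apply cartan_2)

lemma growing_3: "a \<in> S \<Longrightarrow> b \<in> S \<Longrightarrow> a \<noteq> b \<Longrightarrow> m a b = 3 \<Longrightarrow> growing [a, b, a]"
  by (auto simp: growing_def less_Suc_eq reflect_apply cartan_3 cartan_diag)

lemma fold_disjoint:
  assumes "set us \<subseteq> S" "set vs \<subseteq> S" "set us \<inter> set vs = {}"
    "\<And>a b. a \<in> set us \<Longrightarrow> b \<in> set vs \<Longrightarrow> m a b = 2"
  shows "fold_compatible 2 us vs"
proof -
  have "act vs' g s = g s" if "set vs' \<subseteq> set vs" "s \<in> set us" for vs' g s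
    using that(1)
  proof (induction vs' arbitrary: g)
    case (Cons v vs')
    then have "cartan v s = 0" using cartan_2[of s v] assms that(2) by auto
    then show ?case using Cons by (simp add: reflect_apply)
  qed simp
  then show ?thesis by (simp add: fold_compatible_def)
qed

text \<open>In this and the following names the type is that of the diagram spanned by the letters
  of both words.\<close>

lemma fold_A2: "a \<in> S \<Longrightarrow> b \<in> S \<Longrightarrow> a \<noteq> b \<Longrightarrow> m a b = 3 \<Longrightarrow> fold_compatible 3 [a] [b]"
  by (auto simp: fold_compatible_def reflect_apply cartan_3 cartan_diag)

lemma fold_B2:
  assumes "a \<in> S" "b \<in> S" "a \<noteq> b" "m a b = 4"
  shows "fold_compatible 4 [a] [b]"
  using cartan_4[OF assms(4,1,2,3)] cartan_diag assms
  by (auto simp: fold_compatible_def reflect_apply)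

lemma fold_A2A2:
  assumes "{a, b, a', b'} \<subseteq> S" "distinct [a, b, a', b']" "m a b = 3" "m a' b' = 3"
    "m a a' = 2" "m a b' = 2" "m b a' = 2" "m b b' = 2"
  shows "fold_compatible 3 [a, a'] [b, b']"
proof -
  have c: "cartan a b = -1" "cartan b a = -1" "cartan a' b' = -1" "cartan b' a' = -1"
    "cartan a a' = 0" "cartan a' a = 0" "cartan a b' = 0" "cartan b' a = 0"
    "cartan b a' = 0" "cartan a' b = 0" "cartan b b' = 0" "cartan b' b = 0"
    "cartan a a = 2" "cartan b b = 2" "cartan a' a' = 2" "cartan b' b' = 2"
    using assms cartan_3 cartan_2 cartan_diag by auto
  show ?thesis by (auto simp: fold_compatible_def reflect_apply c)
qed

lemma fold_B2B2:
  assumes "{a, b, a', b'} \<subseteq> S" "distinct [a, b, a', b']" "m a b = 4" "m a' b' = 4"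
    "m a a' = 2" "m a b' = 2" "m b a' = 2" "m b b' = 2"
  shows "fold_compatible 4 [a, a'] [b, b']"
proof -
  have c: "cartan a a' = 0" "cartan a' a = 0" "cartan a b' = 0" "cartan b' a = 0"
    "cartan b a' = 0" "cartan a' b = 0" "cartan b b' = 0" "cartan b' b = 0"
    "cartan a a = 2" "cartan b b = 2" "cartan a' a' = 2" "cartan b' b' = 2"
    using assms cartan_2 cartan_diag by auto
  have "cartan a b = -1 \<and> cartan b a = -2 \<or> cartan a b = -2 \<and> cartan b a = -1"
    "cartan a' b' = -1 \<and> cartan b' a' = -2 \<or> cartan a' b' = -2 \<and> cartan b' a' = -1"
    using assms cartan_4 by auto
  then show ?thesis by (elim disjE conjE) (auto simp: fold_compatible_def reflect_apply c)
qed

text \<open>The two ends of the path \<open>a\<close>, \<open>b\<close>, \<open>a'\<close> are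
  merged into one generator, which turns type A of rank 3 into a relation of order 4. Both
  directions are stated as compatibility is not symmetric in its words.\<close>

lemma fold_A3:
  assumes "{a, b, a'} \<subseteq> S" "distinct [a, b, a']" "m a b = 3" "m b a' = 3" "m a a' = 2"
  shows "fold_compatible 4 [b] [a, a']" "fold_compatible 4 [a, a'] [b]"
proof -
  have c: "cartan a b = -1" "cartan b a = -1" "cartan a' b = -1" "cartan b a' = -1"
    "cartan a a' = 0" "cartan a' a = 0" "cartan a a = 2" "cartan b b = 2" "cartan a' a' = 2"
    using assms cartan_3 cartan_2 cartan_diag by auto
  show "fold_compatible 4 [b] [a, a']" "fold_compatible 4 [a, a'] [b]"
    by (auto simp: fold_compatible_def reflect_apply c)
qed

text \<open>The path is \<open>b\<close>, \<open>a\<close>, \<open>a'\<close>, \<open>b'\<close>.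
  Its two middle nodes are adjacent, so they are merged into the longest element
  \<open>a a' a\<close> of their subgroup instead of a product of two commuting reflections.\<close>

lemma fold_A4:
  assumes "{a, b, a', b'} \<subseteq> S" "distinct [a, b, a', b']" "m b a = 3" "m a a' = 3" "m a' b' = 3"
    "m a b' = 2" "m b a' = 2" "m b b' = 2"
  shows "fold_compatible 4 [a, a', a] [b, b']" "fold_compatible 4 [b, b'] [a, a', a]"
proof -
  have c: "cartan a b = -1" "cartan b a = -1" "cartan a' b' = -1" "cartan b' a' = -1"
    "cartan a a' = -1" "cartan a' a = -1" "cartan a b' = 0" "cartan b' a = 0"
    "cartan b a' = 0" "cartan a' b = 0" "cartan b b' = 0" "cartan b' b = 0"
    "cartan a a = 2" "cartan b b = 2" "cartan a' a' = 2" "cartan b' b' = 2"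
    using assms cartan_3 cartan_2 cartan_diag by auto
  show "fold_compatible 4 [a, a', a] [b, b']" "fold_compatible 4 [b, b'] [a, a', a]"
    by (auto simp: fold_compatible_def reflect_apply c)
qed

end

locale affine_C_folding = crystallographic X A for X :: "nat coxeter_datum" and A +
  fixes n :: nat and \<psi> :: "nat \<Rightarrow> nat list" and \<phi> :: "nat list set \<Rightarrow> nat list set"
  assumes n2: "n \<ge> 2"
    and hom: "\<phi> \<in> hom (coxeter_group (affine_C n)) (coxeter_group X)"
    and \<phi>_gen: "i \<le> n \<Longrightarrow> \<phi> (coxeter_gen (affine_C n) i) = coxeter_class X (\<psi> i)"
    and \<psi>_lists: "i \<le> n \<Longrightarrow> \<psi> i \<in> lists (fst X)"
    and \<psi>_nonempty: "i \<le> n \<Longrightarrow> \<psi> i \<noteq> []"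
    and \<psi>_growing: "i \<le> n \<Longrightarrow> growing (\<psi> i)"
    and \<psi>_compatible: "i \<le> n \<Longrightarrow> j \<le> n \<Longrightarrow> i \<noteq> j \<Longrightarrow>
      fold_compatible (snd (affine_C n) i j) (\<psi> i) (\<psi> j)"
    and \<psi>_mid: "1 \<le> i \<Longrightarrow> i < n \<Longrightarrow> length (\<psi> i) = length (\<psi> 1)"
begin

sublocale C: crystallographic "affine_C n" "{0, n}"
  by (rule crystallographic_affine_C[OF n2])

lemma fst_C: "fst (affine_C n) = {0..n}"
  by (simp add: affine_C_def)

section \<open>From words of the source to words of the target\<close>

definition flat :: "nat list \<Rightarrow> nat list" where "flat xs = concat (map \<psi> xs)"

lemma flat_lists: "xs \<in> lists {0..n} \<Longrightarrow> flat xs \<in> lists (fst X)"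
proof (induction xs)
  case (Cons i xs)
  then show ?case using \<psi>_lists[of i] by (simp add: flat_def)
qed (simp add: flat_def)

lemma \<phi>_class:
  assumes "xs \<in> lists {0..n}"
  shows "\<phi> (coxeter_class (affine_C n) xs) = coxeter_class X (flat xs)"
  using assms
proof (induction xs)
  case Nil
  have "\<phi> \<one>\<^bsub>coxeter_group (affine_C n)\<^esub> = \<one>\<^bsub>coxeter_group X\<^esub>"
    using hom group_affine(3) group_coxeter_group[OF m_diag] by (rule hom_one)
  then show ?case by (simp add: coxeter_one flat_def)
next
  case (Cons i xs)
  then have l: "[i] \<in> lists (fst (affine_C n))" "xs \<in> lists (fst (affine_C n))" by (auto simp: fst_C)
  have "coxeter_class (affine_C n) (i # xs)
    = coxeter_gen (affine_C n) i \<otimes>\<^bsub>coxeter_group (affine_C n)\<^esub> coxeter_class (affine_C n) xs"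
    using coxeter_class_mult[OF l] by (simp add: coxeter_gen_def)
  also have "\<phi> \<dots> = coxeter_class X (\<psi> i) \<otimes>\<^bsub>coxeter_group X\<^esub> coxeter_class X (flat xs)"
    using l Cons by (subst hom_mult[OF hom]) (auto simp: coxeter_carrier coxeter_gen_def \<phi>_gen[unfolded coxeter_gen_def])
  also have "\<dots> = coxeter_class X (flat (i # xs))"
    using coxeter_class_mult[OF \<psi>_lists flat_lists, of i xs] Cons by (simp add: flat_def)
  finally show ?case .
qed

text \<open>No relation is checked on the words \<open>\<psi> i\<close>: since \<open>\<phi>\<close>
  is a map on classes that \<open>flat\<close> computes, equivalent words have equivalent
  images.\<close>

lemma flat_equiv:
  assumes "coxeter_equiv (affine_C n) xs ys"
  shows "flat xs \<simeq> flat ys"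
proof -
  have l: "xs \<in> lists {0..n}" "ys \<in> lists {0..n}"
    using coxeter_equiv_lists[OF assms] by (auto simp: fst_C)
  have "coxeter_class (affine_C n) xs = coxeter_class (affine_C n) ys"
    using coxeter_class_eq_iff[of xs "affine_C n" ys] l assms by (simp add: fst_C)
  then have "coxeter_class X (flat xs) = coxeter_class X (flat ys)"
    using \<phi>_class l by metis
  then show ?thesis using coxeter_class_eq_iff[OF flat_lists flat_lists] l by blast
qed

text \<open>Tits's induction runs in the source group, while positivity is measured in the
  representation of \<open>X\<close>. A nonempty dihedral tail is handled by the corresponding
  clause of \<open>fold_compatible\<close>.\<close>

lemma folded_ascent:
  assumes "xs \<in> lists {0..n}" "i \<in> {0..n}" "C.len xs < C.len (xs @ [i])"
  shows "\<forall>s\<in>set (\<psi> i). act (flat xs) (\<lambda>_. 1) s > 0"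
proof (rule C.ascent_induct[of "\<lambda>xs i. \<forall>s\<in>set (\<psi> i). act (flat xs) (\<lambda>_. 1) s > 0", OF _ _ _ assms[folded fst_C]])
  fix xs ys i assume "coxeter_equiv (affine_C n) xs ys" "\<forall>s\<in>set (\<psi> i). act (flat xs) (\<lambda>_. 1) s > 0"
  then show "\<forall>s\<in>set (\<psi> i). act (flat ys) (\<lambda>_. 1) s > 0"
    using act_cong[OF flat_equiv] by metis
next
  fix v i j y
  assume ij: "i \<in> fst (affine_C n)" "j \<in> fst (affine_C n)" "i \<noteq> j"
    and pos: "\<forall>s\<in>set (\<psi> i). act (flat v) (\<lambda>_. 1) s > 0" "\<forall>s\<in>set (\<psi> j). act (flat v) (\<lambda>_. 1) s > 0"
    and y: "y \<in> C.dihedral_tails i j"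
  have "fold_compatible (snd (affine_C n) i j) (\<psi> i) (\<psi> j)"
    using ij by (intro \<psi>_compatible) (auto simp: fst_C)
  moreover have "\<forall>s\<in>set (\<psi> i) \<union> set (\<psi> j). act (flat v) (\<lambda>_. 1) s > 0" using pos by blast
  ultimately have K: "\<forall>s\<in>set (\<psi> i). act (\<psi> j) (act (flat v) (\<lambda>_. 1)) s > 0 \<and>
      (snd (affine_C n) i j \<ge> 3 \<longrightarrow> act (\<psi> i @ \<psi> j) (act (flat v) (\<lambda>_. 1)) s > 0) \<and>
      (snd (affine_C n) i j \<ge> 4 \<longrightarrow> act (\<psi> j @ \<psi> i @ \<psi> j) (act (flat v) (\<lambda>_. 1)) s > 0)"
    unfolding fold_compatible_def by blast
  consider "y = []" | "y = [j]" | "y = [i, j]" "snd (affine_C n) i j \<ge> 3"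
    | "y = [j, i, j]" "snd (affine_C n) i j \<ge> 4"
    using y by (auto simp: C.dihedral_tails_def split: if_splits)
  then show "\<forall>s\<in>set (\<psi> i). act (flat (v @ y)) (\<lambda>_. 1) s > 0"
    by cases (use K pos in \<open>auto simp: flat_def\<close>)
qed (simp add: flat_def)

definition L :: "nat list set \<Rightarrow> nat" where "L w = coxeter_length X (\<phi> w)"

lemma L_class: "xs \<in> lists {0..n} \<Longrightarrow> L (coxeter_class (affine_C n) xs) = len (flat xs)"
  unfolding L_def using \<phi>_class coxeter_length_class[OF flat_lists] by simp

lemma len_flat_snoc:
  assumes "xs \<in> lists {0..n}" "i \<in> {0..n}" "C.len xs < C.len (xs @ [i])"
  shows "len (flat (xs @ [i])) = len (flat xs) + length (\<psi> i)"
proof -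
  have "flat (xs @ [i]) = flat xs @ \<psi> i" by (simp add: flat_def)
  then show ?thesis
    using len_append_growing[OF \<psi>_growing flat_lists[OF assms(1)] \<psi>_lists, of i] folded_ascent[OF assms] assms(2)
    by simp
qed

text \<open>The action of the source group, through an arbitrary representing word;
  \<open>C.act_cong\<close> makes it independent of the choice.\<close>

definition C_act :: "nat list set \<Rightarrow> (nat \<Rightarrow> int) \<Rightarrow> nat \<Rightarrow> int" where
  "C_act w f = C.act (SOME xs. xs \<in> lists {0..n} \<and> w = coxeter_class (affine_C n) xs) f"

lemma C_act_class:
  assumes "xs \<in> lists {0..n}"
  shows "C_act (coxeter_class (affine_C n) xs) f = C.act xs f"
proof -
  define ys where "ys = (SOME ys. ys \<in> lists {0..n} \<and> coxeter_class (affine_C n) xs = coxeter_class (affine_C n) ys)"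
  have ys: "ys \<in> lists {0..n} \<and> coxeter_class (affine_C n) xs = coxeter_class (affine_C n) ys"
    unfolding ys_def by (rule someI[of _ xs]) (simp add: assms)
  then have "coxeter_equiv (affine_C n) xs ys"
    using coxeter_class_eq_iff[of xs "affine_C n" ys] assms by (simp add: fst_C)
  then show ?thesis unfolding C_act_def ys_def[symmetric] by (simp add: C.act_cong)
qed

lemma C_cartan:
  assumes "i \<le> n" "j \<le> n"
  shows "C.cartan i j = affC_cartan n i j"
proof -
  have m: "snd (affine_C n) i j = (if j = i + 1 then (if i = 0 \<or> j = n then 4 else 3) else 2)" if "i < j"
    using affine_C_m[OF n2 that assms(2)] .
  have m': "snd (affine_C n) i j = (if i = j + 1 then (if j = 0 \<or> i = n then 4 else 3) else 2)" if "j < i"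
    using affine_C_m[OF n2 that assms(1)] C.m_sym by metis
  consider "i < j" | "i = j" | "j < i" by linarith
  then show ?thesis
  proof cases
    case 1
    then show ?thesis using assms n2 unfolding C.cartan_def m[OF 1] fst_C affC_cartan_def by auto
  next
    case 2
    then show ?thesis using assms by (simp add: C.cartan_def fst_C affC_cartan_def)
  next
    case 3
    then show ?thesis using assms n2 unfolding C.cartan_def m'[OF 3] fst_C affC_cartan_def by auto
  qed
qed

lemma class_snoc:
  assumes "xs \<in> lists {0..n}" "i \<le> n"
  shows "coxeter_class (affine_C n) xs \<otimes>\<^bsub>coxeter_group (affine_C n)\<^esub> coxeter_gen (affine_C n) i
    = coxeter_class (affine_C n) (xs @ [i])"
  using coxeter_class_mult[of xs "affine_C n" "[i]"] assms by (simp add: coxeter_gen_def fst_C)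

lemma class_cases:
  assumes "w \<in> carrier (coxeter_group (affine_C n))"
  obtains xs where "xs \<in> lists {0..n}" "w = coxeter_class (affine_C n) xs"
  using assms by (auto simp: coxeter_carrier fst_C)

lemma weighted_affine_C:
  "weighted_affine_C (coxeter_group (affine_C n)) n (coxeter_gen (affine_C n)) L (\<lambda>i. length (\<psi> i)) C_act"
proof (intro weighted_affine_C.intro weighted_affine_C_axioms.intro group_affine(3))
  let ?G = "coxeter_group (affine_C n)" and ?r = "coxeter_gen (affine_C n)"
  show "2 \<le> n" by (rule n2)
  show "?r i \<in> carrier ?G" if "i \<le> n" for i
    using that by (simp add: coxeter_gen_def coxeter_carrier fst_C)
  show "?r i \<otimes>\<^bsub>?G\<^esub> ?r i = \<one>\<^bsub>?G\<^esub>" if i: "i \<le> n" for i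
  proof -
    have "coxeter_equiv (affine_C n) ([] @ [i, i] @ []) ([] @ [])"
      using i by (intro C.cancel) (auto simp: fst_C)
    then show ?thesis
      using class_snoc[of "[i]" i] coxeter_class_eq_iff[of "[i, i]" "affine_C n" "[]"] i
      by (simp add: coxeter_gen_def coxeter_one fst_C)
  qed
  show "P g" if g: "g \<in> carrier ?G" and P: "P \<one>\<^bsub>?G\<^esub>"
    "\<And>g i. g \<in> carrier ?G \<Longrightarrow> P g \<Longrightarrow> i \<le> n \<Longrightarrow> P (g \<otimes>\<^bsub>?G\<^esub> ?r i)" for g P
  proof -
    obtain xs where xs: "xs \<in> lists {0..n}" "g = coxeter_class (affine_C n) xs"
      using class_cases[OF g] .
    have "P (coxeter_class (affine_C n) xs)" using xs(1)
    proof (induction xs rule: rev_induct)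
      case Nil
      then show ?case using P(1) by (simp add: coxeter_one)
    next
      case (snoc i xs)
      then have "P (coxeter_class (affine_C n) xs \<otimes>\<^bsub>?G\<^esub> ?r i)"
        by (intro P(2)) (auto simp: coxeter_carrier fst_C)
      then show ?case using snoc class_snoc[of xs i] by simp
    qed
    then show ?thesis using xs by simp
  qed
  show "C_act \<one>\<^bsub>?G\<^esub> f j = f j" for f j
    using C_act_class[of "[]"] by (simp add: coxeter_one)
  show "C_act (g \<otimes>\<^bsub>?G\<^esub> ?r i) f j = C_act g f j - affC_cartan n i j * C_act g f i"
    if g: "g \<in> carrier ?G" and ij: "i \<le> n" "j \<le> n" for g i j f
  proof -
    obtain xs where xs: "xs \<in> lists {0..n}" "g = coxeter_class (affine_C n) xs"
      using class_cases[OF g] .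
    then show ?thesis using ij by (simp add: class_snoc C_act_class C.reflect_apply C_cartan)
  qed
  show "L \<one>\<^bsub>?G\<^esub> = 0"
    using L_class[of "[]"] by (simp add: coxeter_one flat_def)
  show "g = \<one>\<^bsub>?G\<^esub>" if g: "g \<in> carrier ?G" and Lg: "L g = 0" for g
  proof -
    obtain xs where xs: "xs \<in> lists {0..n}" "g = coxeter_class (affine_C n) xs"
      using class_cases[OF g] .
    obtain ys where ys: "coxeter_equiv (affine_C n) xs ys" "length ys = C.len xs"
      using reduced_word_exists[of xs "affine_C n"] xs(1) by (auto simp: fst_C)
    have ysl: "ys \<in> lists {0..n}" using coxeter_equiv_lists[OF ys(1)] by (simp add: fst_C)
    have gy: "g = coxeter_class (affine_C n) ys"
      using coxeter_class_eq_iff[of xs "affine_C n" ys] xs ysl ys(1) by (simp add: fst_C)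
    \<comment> \<open>The last letter of a reduced word is an ascent of the word before it, so it
      contributes the positive length of its image.\<close>
    have "ys = []"
    proof (rule ccontr)
      assume "ys \<noteq> []"
      then obtain zs i where zs: "ys = zs @ [i]" by (cases ys rule: rev_cases) auto
      have l: "zs \<in> lists {0..n}" "i \<in> {0..n}" using ysl zs by auto
      have "C.len ys = length ys" using word_length_cong[OF ys(1)] ys(2) by simp
      moreover have "C.len zs \<le> length zs"
        by (rule word_length_le) (use l in \<open>simp add: fst_C coxeter_equiv.refl\<close>)
      ultimately have "C.len zs < C.len (zs @ [i])" using zs by simp
      from len_flat_snoc[OF l this] have "L g > 0"
        using L_class[OF ysl] \<psi>_nonempty[of i] l(2) gy zs by simp
      then show False using Lg by simp
    qed
    then show ?thesis using gy by (simp add: coxeter_one)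
  qed
  show "C_act g f i > 0 \<and> L (g \<otimes>\<^bsub>?G\<^esub> ?r i) = L g + length (\<psi> i) \<or>
      C_act g f i < 0 \<and> L g = L (g \<otimes>\<^bsub>?G\<^esub> ?r i) + length (\<psi> i)"
    if g: "g \<in> carrier ?G" and i: "i \<le> n" and f: "\<And>j. j \<le> n \<Longrightarrow> f j > 0" for g i f
  proof -
    obtain xs where xs: "xs \<in> lists {0..n}" "g = coxeter_class (affine_C n) xs"
      using class_cases[OF g] .
    have i': "i \<in> {0..n}" using i by simp
    have xi: "xs @ [i] \<in> lists {0..n}" using xs(1) i by simp
    have "coxeter_equiv (affine_C n) (xs @ [i, i] @ []) (xs @ [])"
      using xs i by (intro C.cancel) (auto simp: fst_C)
    then have ii: "coxeter_equiv (affine_C n) ((xs @ [i]) @ [i]) xs" by simp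
    have flat: "len (flat ((xs @ [i]) @ [i])) = len (flat xs)"
      by (rule word_length_cong[OF flat_equiv[OF ii]])
    from C.len_snoc_cases[OF xs(1)[folded fst_C] i'[folded fst_C], of f] f
    have "C.act xs f i > 0 \<and> C.len (xs @ [i]) = C.len xs + 1 \<or>
      C.act xs f i < 0 \<and> C.len xs = C.len (xs @ [i]) + 1" by (simp add: fst_C)
    then show ?thesis
    proof (elim disjE conjE)
      assume a: "C.act xs f i > 0" "C.len (xs @ [i]) = C.len xs + 1"
      then have "len (flat (xs @ [i])) = len (flat xs) + length (\<psi> i)"
        by (intro len_flat_snoc[OF xs(1) i']) simp
      then show ?thesis
        using a(1) C_act_class[OF xs(1)] L_class[OF xs(1)] L_class[OF xi] class_snoc[OF xs(1) i] xs(2) by simp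
    next
      assume a: "C.act xs f i < 0" "C.len xs = C.len (xs @ [i]) + 1"
      \<comment> \<open>A descent of \<open>xs\<close> is an ascent of \<open>xs @ [i]\<close>, and
        appending \<open>i\<close> once more leads back to \<open>xs\<close>.\<close>
      then have "C.len (xs @ [i]) < C.len ((xs @ [i]) @ [i])"
        using word_length_cong[OF ii] by simp
      from len_flat_snoc[OF xi i' this] have "len (flat xs) = len (flat (xs @ [i])) + length (\<psi> i)"
        using flat by simp
      then show ?thesis
        using a(1) C_act_class[OF xs(1)] L_class[OF xs(1)] L_class[OF xi] class_snoc[OF xs(1) i] xs(2) by simp
    qed
  qed
  show "0 < length (\<psi> i)" if "i \<le> n" for i using \<psi>_nonempty[OF that] by simp
  show "length (\<psi> i) = length (\<psi> 1)" if "1 \<le> i" "i < n" for i by (rule \<psi>_mid[OF that])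
qed

text \<open>The closed form \<open>U\<close> is tested after multiplication with Macdonald's
  denominator. This has constant term 1, so it is nonzero and cancels in the integral domain of
  power series.\<close>

lemma has_sum_folding:
  fixes q U :: "rat fps"
  assumes "length (\<psi> 0) = a" "length (\<psi> 1) = b" "length (\<psi> n) = c" "q = fps_X"
    and "U * (\<Prod>i<n. 1 - q ^ a * q ^ c * (q ^ b) ^ (n - 1 + i))
      = qfact (q ^ b) n * qpoch (q ^ b) (q ^ a) n * qpoch (q ^ b) (q ^ c) n"
  shows "((\<lambda>w. q ^ coxeter_length X (\<phi> w)) has_sum U) (carrier (coxeter_group (affine_C n)))"
proof -
  interpret W: weighted_affine_C "coxeter_group (affine_C n)" n "coxeter_gen (affine_C n)" L
    "\<lambda>i. length (\<psi> i)" C_act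
    by (rule weighted_affine_C)
  let ?D = "\<Prod>i<n. 1 - q ^ a * q ^ c * (q ^ b) ^ (n - 1 + i)"
  have pos: "a > 0" using \<psi>_nonempty[of 0] assms(1) by auto
  have "fps_nth (\<Prod>i<k. 1 - q ^ a * q ^ c * h i) 0 = 1" for k and h :: "nat \<Rightarrow> rat fps"
    using pos assms(4) by (induction k) (simp_all add: fps_X_power_mult_nth mult.assoc)
  then have "fps_nth ?D 0 = 1" .
  then have "?D \<noteq> 0" by (metis fps_zero_nth zero_neq_one)
  moreover have "W.gf (carrier (coxeter_group (affine_C n))) * ?D = U * ?D"
    using W.gf_carrier assms by simp
  ultimately have "W.gf (carrier (coxeter_group (affine_C n))) = U" by simp
  then show ?thesis
    using fps_has_sum_gf[OF weighted_affine_C] assms(4) by (simp add: L_def)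
qed

end

section \<open>The closed forms\<close>

lemma prod_1_eq_lessThan: "(\<Prod>k=1..n. g k) = (\<Prod>i<n. g (Suc i))"
  by (simp add: prod.atLeast1_atMost_eq)

lemma prod_shift_Suc:
  fixes g :: "nat \<Rightarrow> 'a::comm_monoid_mult"
  shows "g n * (\<Prod>i<n. g (Suc n + i)) = (\<Prod>i<n. g (n + i)) * g (2 * n)"
proof -
  have "g n * (\<Prod>i<n. g (Suc n + i)) = (\<Prod>i<Suc n. g (n + i))"
    unfolding prod.lessThan_Suc_shift by simp
  then show ?thesis by (simp add: mult_2)
qed

text \<open>A finite form of Euler's theorem on odd and distinct parts. Formally both sides are the
  product of \<open>1 - x ^ k\<close> over \<open>k \<le> 2 * n\<close> divided by that over
  \<open>k \<le> n\<close>, because \<open>1 - x ^ (2 * k)\<close> is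
  \<open>(1 - x ^ k) * (1 + x ^ k)\<close>. The induction avoids the division.\<close>

lemma euler_prod:
  fixes x :: "'a::comm_ring_1"
  shows "(\<Prod>i<n. 1 - x ^ (n + 1 + i)) = (\<Prod>j<n. 1 - x ^ (2 * j + 1)) * qpoch x x n"
proof (induction n)
  case 0
  then show ?case by (simp add: qpoch_def)
next
  case (Suc n)
  have "(\<Prod>i<Suc n. 1 - x ^ (Suc n + 1 + i))
      = (\<Prod>i<n. 1 - x ^ (Suc n + 1 + i)) * (1 - x ^ (2 * Suc n))"
    by (simp add: mult_2)
  also have "1 - x ^ (2 * Suc n) = (1 - x ^ Suc n) * (1 + x ^ Suc n)"
    unfolding mult_2 power_add by (simp add: algebra_simps)
  also have "(\<Prod>i<n. 1 - x ^ (Suc n + 1 + i)) * ((1 - x ^ Suc n) * (1 + x ^ Suc n))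
      = ((1 - x ^ Suc n) * (\<Prod>i<n. 1 - x ^ (Suc (Suc n + i)))) * (1 + x ^ Suc n)"
    by (simp add: ac_simps)
  also have "(1 - x ^ Suc n) * (\<Prod>i<n. 1 - x ^ (Suc (Suc n + i)))
      = (\<Prod>i<n. 1 - x ^ (n + 1 + i)) * (1 - x ^ (2 * n + 1))"
    using prod_shift_Suc[of "\<lambda>i. 1 - x ^ Suc i" n] by simp
  finally show ?case unfolding Suc.IH by (simp add: qpoch_def ac_simps)
qed

lemma euler_prod_shift:
  fixes x :: "'a::comm_ring_1"
  shows "(\<Prod>i<n. 1 - x ^ (n + 2 + i)) * (1 - x ^ (n + 1))
    = (\<Prod>j<Suc n. 1 - x ^ (2 * j + 1)) * qpoch x x n"
  using prod_shift_Suc[of "\<lambda>i. 1 - x ^ Suc i" n] euler_prod[of x n] by (simp add: ac_simps)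

lemma euler_prod_0:
  fixes x :: "'a::comm_ring_1"
  shows "(\<Prod>i<Suc n. 1 - x ^ (Suc n + i)) = (\<Prod>j<Suc n. 1 - x ^ (2 * j + 1)) * qpoch x x n"
  using euler_prod[of x n] by (simp add: mult_2 mult_2_right ac_simps)

lemma q_bracket_mult: "q_bracket k x * (1 - x) = 1 - (x :: 'a::comm_ring_1) ^ k"
proof (induction k)
  case (Suc k)
  have "q_bracket (Suc k) x * (1 - x) = q_bracket k x * (1 - x) + x ^ k * (1 - x)"
    by (simp add: q_bracket_def distrib_right)
  then show ?case unfolding Suc.IH by (simp add: algebra_simps)
qed (simp add: q_bracket_def)

lemma q_bracket_double: "q_bracket (2 * k) x = (1 + x) * q_bracket k ((x :: 'a::comm_ring_1) ^ 2)"
  by (induction k) (simp_all add: q_bracket_def algebra_simps power_mult power2_eq_square mult_2 power_add)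

text \<open>The numerator common to the five cases with \<open>c 1 = 2\<close>; it will turn out to
  be part of Macdonald's numerator in base \<open>q^2\<close>.\<close>

definition alt_fact :: "'a::comm_ring_1 \<Rightarrow> nat \<Rightarrow> 'a" where
  "alt_fact q m = (\<Prod>k=1..m. q_bracket k ((- 1) ^ k * q))"

lemma alt_fact_from_2:
  assumes "m \<ge> 1"
  shows "alt_fact q m = (\<Prod>k=2..m. q_bracket k ((- 1) ^ k * q))"
proof -
  define g where "g k = q_bracket k ((- 1) ^ k * q)" for k
  have "g 1 = 1" by (simp add: g_def q_bracket_def)
  then show ?thesis
    unfolding alt_fact_def g_def[symmetric] using prod.atLeast_Suc_atMost[OF assms, of g]
    by (simp add: numeral_2_eq_2)
qed

lemma alt_fact_odd: "alt_fact q (2 * n + 1) * (1 + q) = alt_fact q (2 * n) * (1 + q ^ (2 * n + 1))"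
  using q_bracket_mult[of "2 * n + 1" "- q"] by (simp add: alt_fact_def mult.assoc)

text \<open>Consecutive factors are paired: the bracket of \<open>2 * Suc n\<close> contains
  \<open>1 + q\<close>, and this turns the bracket of \<open>2 * n + 1\<close> at \<open>- q\<close>
  into \<open>1 + q ^ (2 * n + 1)\<close>.\<close>

lemma alt_fact_even: "alt_fact q (2 * n) = qfact (q\<^sup>2) n * qpoch (q\<^sup>2) q n"
proof (induction n)
  case 0
  then show ?case by (simp add: alt_fact_def qfact_def qpoch_def)
next
  case (Suc n)
  have "alt_fact q (2 * Suc n) = alt_fact q (2 * n + 1) * q_bracket (2 * Suc n) q"
    by (simp add: alt_fact_def)
  also have "\<dots> = (alt_fact q (2 * n + 1) * (1 + q)) * q_bracket (Suc n) (q\<^sup>2)"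
    unfolding q_bracket_double by (simp only: ac_simps)
  also have "\<dots> = alt_fact q (2 * n) * (1 + q * (q\<^sup>2) ^ n) * q_bracket (Suc n) (q\<^sup>2)"
    by (simp only: alt_fact_odd) (simp add: power_mult)
  finally show ?case
    unfolding Suc.IH by (simp add: qfact_Suc qpoch_def ac_simps)
qed

definition alt_denom :: "'a::comm_ring_1 \<Rightarrow> nat \<Rightarrow> 'a" where
  "alt_denom q m = (\<Prod>k=1..m. 1 + (- q) ^ k)"

lemma alt_denom_odd: "alt_denom q (2 * n + 1) = alt_denom q (2 * n) * (1 - q ^ (2 * n + 1))"
  by (simp add: alt_denom_def)

text \<open>For odd \<open>k\<close> the factor on the left is \<open>1 - q ^ k\<close>, and
  \<open>qpoch\<close> supplies its partner \<open>1 + q ^ k\<close>. The right-hand side is that of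
  \<open>euler_prod\<close> in base \<open>q^2\<close>.\<close>

lemma alt_denom_even:
  "alt_denom q (2 * n) * qpoch (q\<^sup>2) q n = (\<Prod>j<n. 1 - (q\<^sup>2) ^ (2 * j + 1)) * qpoch (q\<^sup>2) (q\<^sup>2) n"
proof (induction n)
  case 0
  then show ?case by (simp add: alt_denom_def qpoch_def)
next
  case (Suc n)
  have "(1 - q ^ (2 * n + 1)) * (1 + q ^ (2 * n + 1)) = 1 - (q\<^sup>2) ^ (2 * n + 1)"
    by (simp add: algebra_simps flip: power_mult power_add mult_2)
  moreover have "alt_denom q (2 * Suc n) * qpoch (q\<^sup>2) q (Suc n) = (alt_denom q (2 * n) * qpoch (q\<^sup>2) q n) *
     ((1 - q ^ (2 * n + 1)) * (1 + q ^ (2 * n + 1))) * (1 + q ^ (2 * Suc n))"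
    by (simp add: alt_denom_def qpoch_def ac_simps flip: power_mult)
  moreover have "q ^ (2 * Suc n) = q\<^sup>2 * (q\<^sup>2) ^ n" by (simp only: power_mult power_Suc)
  ultimately show ?case unfolding Suc.IH by (simp add: qpoch_def ac_simps)
qed

lemma qpoch_odd: "(1 + q) * qpoch (q\<^sup>2) (q ^ 3) n = qpoch (q\<^sup>2) q (Suc n)" for q :: "'a::comm_ring_1"
  unfolding qpoch_def prod.lessThan_Suc_shift by (simp add: eval_nat_numeral ac_simps)

section \<open>Specialisation of the parameters\<close>

context
  fixes q :: "rat fps"
  assumes q: "q = fps_X"
begin

lemma q_unit: "k > 0 \<Longrightarrow> fps_nth (1 + q ^ k) 0 = 1" "k > 0 \<Longrightarrow> fps_nth (1 - q ^ k) 0 = 1"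
  "k > 0 \<Longrightarrow> fps_nth (1 + (- q) ^ k) 0 = 1"
  by (simp_all add: q)

lemma q_nonzero: "k > 0 \<Longrightarrow> 1 - q ^ k \<noteq> 0" "1 + q \<noteq> 0"
  using q_unit(2)[of k] q_unit(1)[of 1] by (metis fps_zero_nth power_one_right zero_less_one zero_neq_one)+

lemma fps_divide_mult_unit: "fps_nth b 0 = 1 \<Longrightarrow> a / b * b = (a :: rat fps)"
  by (simp add: fps_divide_unit mult.assoc inverse_mult_eq_1)

lemma prod_divide_mult_unit:
  "(\<And>k. k \<in> K \<Longrightarrow> fps_nth (b k) 0 = 1) \<Longrightarrow> (\<Prod>k\<in>K. a k / b k) * (\<Prod>k\<in>K. b k) = (\<Prod>k\<in>K. a k :: rat fps)"
  by (simp add: fps_divide_mult_unit flip: prod.distrib)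

lemma alt_fact_odd': "alt_fact q (2 * n + 1) = qfact (q\<^sup>2) n * qpoch (q\<^sup>2) (q ^ 3) n"
proof -
  have "alt_fact q (2 * n + 1) * (1 + q) = qfact (q\<^sup>2) n * qpoch (q\<^sup>2) (q ^ 3) n * (1 + q)"
  proof -
    have "1 + q ^ (2 * n + 1) = 1 + q * (q\<^sup>2) ^ n" by (simp add: power_mult)
    moreover have "(1 + q) * qpoch (q\<^sup>2) (q ^ 3) n = qpoch (q\<^sup>2) q n * (1 + q * (q\<^sup>2) ^ n)"
      unfolding qpoch_odd by (simp add: qpoch_def)
    ultimately have e: "qpoch (q\<^sup>2) q n * (1 + q ^ (2 * n + 1)) = (1 + q) * qpoch (q\<^sup>2) (q ^ 3) n"
      by simp
    show ?thesis
      unfolding alt_fact_odd alt_fact_even mult.assoc e by (simp only: ac_simps)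
  qed
  then show ?thesis using q_nonzero(2) by simp
qed

text \<open>The product omits \<open>k = n + 1\<close>, so its denominator is restored by
  multiplying with \<open>1 + (-q)^(n+1)\<close>. Together with \<open>1 + q\<close> and the extra
  bracket at \<open>- q\<close> this gives \<open>1 - (q^2)^(n+1)\<close>, exactly the factor by
  which \<open>euler_prod_shift\<close> exceeds Macdonald's denominator.\<close>

lemma closed_form_1:
  "q_bracket (n+1) (-q) * q_bracket (n+1) ((-1)^(n+1) * q) *
      (\<Prod>k\<in>{1..2*n+1} - {n+1}. q_bracket k ((-1)^k * q) / (1 + (-q)^k)) *
      (\<Prod>i<n. 1 - q ^ 3 * q ^ 3 * (q ^ 2) ^ (n - 1 + i))
    = qfact (q ^ 2) n * qpoch (q ^ 2) (q ^ 3) n * qpoch (q ^ 2) (q ^ 3) n"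
  (is "?U * ?D = ?N")
proof -
  define K where "K = {1..2*n+1} - {n+1}"
  have ins: "{1..2*n+1} = insert (n+1) K" "n + 1 \<notin> K" "finite K" by (auto simp: K_def)
  have "(\<Prod>k\<in>K. q_bracket k ((-1)^k * q) / (1 + (-q)^k)) * (\<Prod>k\<in>K. 1 + (-q)^k)
      = (\<Prod>k\<in>K. q_bracket k ((-1)^k * q))"
    by (rule prod_divide_mult_unit, rule q_unit(3)) (auto simp: K_def)
  then have "q_bracket (n+1) (-q) * (1 + q) * (1 + (-q)^(n+1)) * alt_fact q (2*n+1)
      = q_bracket (n+1) (-q) * (1 + q) * (1 + (-q)^(n+1)) * (q_bracket (n+1) ((-1)^(n+1) * q) *
        ((\<Prod>k\<in>K. q_bracket k ((-1)^k * q) / (1 + (-q)^k)) * (\<Prod>k\<in>K. 1 + (-q)^k)))"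
    unfolding alt_fact_def ins(1) prod.insert[OF ins(3,2)] by (simp only:)
  also have "\<dots> = ?U * alt_denom q (2*n+1) * (1 + q)"
    unfolding alt_denom_def K_def[symmetric] unfolding ins(1) prod.insert[OF ins(3,2)]
    by (simp only: ac_simps)
  finally have "?U * alt_denom q (2*n+1) * (1 + q)
      = (q_bracket (n+1) (-q) * (1 + q) * (1 + (-q)^(n+1))) * alt_fact q (2*n+1)" ..
  also have "q_bracket (n+1) (-q) * (1 + q) * (1 + (-q)^(n+1)) = 1 - (q\<^sup>2) ^ (n+1)"
  proof -
    have "q_bracket (n+1) (-q) * (1 + q) = 1 - (-q)^(n+1)"
      using q_bracket_mult[of "n+1" "-q"] by simp
    moreover have "(1 - z) * (1 + z) = 1 - z\<^sup>2" for z :: "rat fps"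
      by (simp add: algebra_simps power2_eq_square)
    moreover have "((-q)^(n+1))\<^sup>2 = (q\<^sup>2)^(n+1)"
      by (metis power2_minus power_mult mult.commute)
    ultimately show ?thesis by (simp only:)
  qed
  finally have U: "?U * alt_denom q (2*n+1) * (1 + q) = (1 - (q\<^sup>2) ^ (n+1)) * alt_fact q (2*n+1)" .
  have "(\<Prod>i<n. 1 - (q\<^sup>2) ^ (n + 2 + i)) * (1 - (q\<^sup>2) ^ (n + 1))
      = (alt_denom q (2 * n) * qpoch (q\<^sup>2) q n) * (1 - (q\<^sup>2) ^ (2 * n + 1))"
    unfolding euler_prod_shift alt_denom_even by (simp add: ac_simps)
  also have "1 - (q\<^sup>2) ^ (2 * n + 1) = (1 - q ^ (2 * n + 1)) * (1 + q * (q\<^sup>2) ^ n)"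
    by (simp add: algebra_simps flip: power_mult power_add mult_2)
  also have "(alt_denom q (2 * n) * qpoch (q\<^sup>2) q n) * \<dots>
      = alt_denom q (2 * n + 1) * qpoch (q\<^sup>2) q (Suc n)"
    unfolding alt_denom_odd by (simp add: qpoch_def ac_simps)
  finally have D: "(\<Prod>i<n. 1 - (q\<^sup>2) ^ (n + 2 + i)) * (1 - (q\<^sup>2) ^ (n + 1))
      = alt_denom q (2 * n + 1) * (1 + q) * qpoch (q\<^sup>2) (q ^ 3) n"
    by (simp add: qpoch_odd[symmetric] ac_simps)
  have "?D = (\<Prod>i<n. 1 - (q\<^sup>2) ^ (n + 2 + i))"
  proof (rule prod.cong)
    fix i assume "i \<in> {..<n}"
    then have "3 + 3 + 2 * (n - 1 + i) = 2 * (n + 2 + i)" by auto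
    then show "1 - q ^ 3 * q ^ 3 * (q\<^sup>2) ^ (n - 1 + i) = 1 - (q\<^sup>2) ^ (n + 2 + i)"
      unfolding power_add[symmetric] power_mult[symmetric] by (simp only:)
  qed simp
  then have "?U * ?D * (1 - (q\<^sup>2) ^ (n + 1)) = (?U * alt_denom q (2*n+1) * (1 + q)) * qpoch (q\<^sup>2) (q ^ 3) n"
    using D by (simp add: ac_simps)
  also have "\<dots> = ?N * (1 - (q\<^sup>2) ^ (n + 1))"
    unfolding U alt_fact_odd' by (simp add: ac_simps)
  finally have "?U * ?D * (1 - (q\<^sup>2) ^ (n + 1)) = ?N * (1 - (q\<^sup>2) ^ (n + 1))" .
  moreover have "1 - (q\<^sup>2) ^ (n + 1) \<noteq> 0"
    unfolding power_mult[symmetric] by (rule q_nonzero) simp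
  ultimately show ?thesis by (rule mult_right_cancel[THEN iffD1, rotated])
qed

text \<open>For \<open>s = q^3\<close> and \<open>t = q\<close> Macdonald's denominator is the
  left-hand side of \<open>euler_prod\<close> in base \<open>q^2\<close>, with no
  correction.\<close>

lemma closed_form_2:
  "(\<Prod>k=1..2*n. q_bracket (k+1) ((-1)^(k+1) * q) / (1 + (-q)^k)) *
      (\<Prod>i<n. 1 - q ^ 3 * q ^ 1 * (q ^ 2) ^ (n - 1 + i))
    = qfact (q ^ 2) n * qpoch (q ^ 2) (q ^ 3) n * qpoch (q ^ 2) (q ^ 1) n"
  (is "?U * ?D = ?N")
proof -
  have "?U * alt_denom q (2*n) = (\<Prod>k=1..2*n. q_bracket (k+1) ((-1)^(k+1) * q))"
    unfolding alt_denom_def by (rule prod_divide_mult_unit, rule q_unit(3)) simp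
  also have "\<dots> = alt_fact q (2*n+1)"
  proof -
    define g where "g k = q_bracket k ((- 1) ^ k * q)" for k
    show ?thesis
      unfolding alt_fact_from_2[of "2*n+1", OF le_add2] g_def[symmetric]
      using prod.shift_bounds_cl_Suc_ivl[of g 1 "2*n"] by (simp only: Suc_eq_plus1 one_add_one)
  qed
  finally have U: "?U * alt_denom q (2*n) = alt_fact q (2*n+1)" .
  have "?D = (\<Prod>i<n. 1 - (q\<^sup>2) ^ (n + 1 + i))"
  proof (rule prod.cong)
    fix i assume "i \<in> {..<n}"
    then have "3 + 1 + 2 * (n - 1 + i) = 2 * (n + 1 + i)" by auto
    then show "1 - q ^ 3 * q ^ 1 * (q\<^sup>2) ^ (n - 1 + i) = 1 - (q\<^sup>2) ^ (n + 1 + i)"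
      unfolding power_add[symmetric] power_mult[symmetric] by (simp only:)
  qed simp
  also have "\<dots> = alt_denom q (2 * n) * qpoch (q\<^sup>2) q n"
    unfolding euler_prod alt_denom_even ..
  finally have "?U * ?D = (?U * alt_denom q (2*n)) * qpoch (q\<^sup>2) q n"
    by (simp only: ac_simps)
  then show ?thesis unfolding U alt_fact_odd' by simp
qed

text \<open>For \<open>s = t = q\<close> the exponents start at \<open>n\<close>, the case of
  \<open>euler_prod_0\<close>. There are only \<open>2 * n - 1\<close> denominators, whence the
  shift to \<open>m = n - 1\<close>.\<close>

lemma closed_form_3:
  assumes "n > 0"
  shows "(\<Prod>k=2..2*n. q_bracket k ((-1)^k * q) / (1 + (-q)^(k-1))) *
      (\<Prod>i<n. 1 - q ^ 1 * q ^ 1 * (q ^ 2) ^ (n - 1 + i))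
    = qfact (q ^ 2) n * qpoch (q ^ 2) (q ^ 1) n * qpoch (q ^ 2) (q ^ 1) n"
  (is "?U * ?D = ?N")
proof -
  obtain m where n: "n = Suc m" using assms gr0_implies_Suc by blast
  have "?U * (\<Prod>k=2..2*n. 1 + (-q)^(k-1)) = (\<Prod>k=2..2*n. q_bracket k ((-1)^k * q))"
    by (rule prod_divide_mult_unit, rule q_unit(3)) simp
  also have "\<dots> = alt_fact q (2*n)"
    using alt_fact_from_2[of "2*n" q] assms by simp
  also have "(\<Prod>k=2..2*n. 1 + (-q)^(k-1)) = alt_denom q (2*m+1)"
    unfolding alt_denom_def n using prod.shift_bounds_cl_Suc_ivl[of "\<lambda>k. 1 + (-q)^(k-1)" 1 "2*m+1"]
    by (simp add: numeral_2_eq_2)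
  finally have U: "?U * alt_denom q (2*m+1) = alt_fact q (2*n)" .
  have "?D = (\<Prod>i<Suc m. 1 - (q\<^sup>2) ^ (Suc m + i))"
    unfolding n by (intro prod.cong) (simp_all add: power2_eq_square)
  also have "\<dots> = (alt_denom q (2 * m) * qpoch (q\<^sup>2) q m) * (1 - (q\<^sup>2) ^ (2 * m + 1))"
    unfolding euler_prod_0 alt_denom_even by (simp add: ac_simps)
  also have "1 - (q\<^sup>2) ^ (2 * m + 1) = (1 - q ^ (2 * m + 1)) * (1 + q * (q\<^sup>2) ^ m)"
    by (simp add: algebra_simps flip: power_mult power_add mult_2)
  also have "(alt_denom q (2 * m) * qpoch (q\<^sup>2) q m) * \<dots> = alt_denom q (2 * m + 1) * qpoch (q\<^sup>2) q n"
    unfolding alt_denom_odd n by (simp add: qpoch_def ac_simps)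
  finally have "?U * ?D = (?U * alt_denom q (2*m+1)) * qpoch (q\<^sup>2) q n"
    by (simp only: ac_simps)
  then show ?thesis unfolding U alt_fact_even by simp
qed

text \<open>Without its middle term, the bracket of \<open>2 * k + 1\<close> is the bracket of
  \<open>k\<close> times \<open>1 + q ^ (k + 1)\<close>. The three leading brackets are the product
  of these factors for \<open>k = 1\<close> and \<open>k = 2\<close>.\<close>

lemma prod_bracket_minus:
  assumes "n \<ge> 2"
  shows "q_bracket 2 q * q_bracket 3 (-q) * q_bracket 4 q * (\<Prod>k=3..n. q_bracket (2*k+1) q - q^k)
    = qfact q n * qpoch q (q\<^sup>2) n"
  using assms
proof (induction n rule: nat_induct_at_least)
  case base
  show ?case
    by (simp add: q_bracket_def qfact_def qpoch_def eval_nat_numeral algebra_simps)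
next
  case (Suc n)
  have "q_bracket (2 * Suc n + 1) q = q_bracket (Suc n) q + q ^ Suc n * (1 + q * q_bracket (Suc n) q)"
    using q_bracket_add[of "Suc n" "Suc (Suc n)" q] q_bracket_add[of 1 "Suc n" q]
    by (simp add: q_bracket_def mult_2)
  then have "q_bracket (2 * Suc n + 1) q - q ^ Suc n = q_bracket (Suc n) q * (1 + q\<^sup>2 * q ^ n)"
    by (simp add: algebra_simps power2_eq_square)
  then show ?case
    using Suc by (simp add: qfact_Suc qpoch_def mult.assoc[symmetric])
qed

lemma prod_odd_from_3:
  assumes "n \<ge> 2"
  shows "(1 - q) * (1 - q^3) * (1 - q^5) * (\<Prod>k=3..n. 1 - q^(2*k+1)) = (\<Prod>j<Suc n. 1 - q ^ (2 * j + 1))"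
  using assms
proof (induction n rule: nat_induct_at_least)
  case base
  show ?case by (simp add: eval_nat_numeral)
next
  case (Suc n)
  have "{3..Suc n} = insert (Suc n) {3..n}" using Suc.hyps by auto
  then have "(\<Prod>k=3..Suc n. 1 - q^(2*k+1)) = (1 - q ^ (2 * Suc n + 1)) * (\<Prod>k=3..n. 1 - q^(2*k+1))" by simp
  then have "(1 - q) * (1 - q^3) * (1 - q^5) * (\<Prod>k=3..Suc n. 1 - q^(2*k+1))
    = ((1 - q) * (1 - q^3) * (1 - q^5) * (\<Prod>k=3..n. 1 - q^(2*k+1))) * (1 - q ^ (2 * Suc n + 1))"
    by (simp only: ac_simps)
  then show ?case unfolding Suc.IH by simp
qed

text \<open>The bracket of 2 at \<open>-(q^(n+1))\<close> is \<open>1 - q ^ (n+1)\<close>, the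
  correction in \<open>euler_prod_shift\<close> for base \<open>q\<close>.\<close>

lemma closed_form_4:
  assumes "n \<ge> 2"
  shows "(q_bracket 2 q * q_bracket 3 (-q) * q_bracket 4 q * q_bracket 2 (-(q^(n+1))))
        / ((1 - q) * (1 - q^3) * (1 - q^5)) *
      (\<Prod>k=3..n. (q_bracket (2*k+1) q - q^k) / (1 - q^(2*k+1))) *
      (\<Prod>i<n. 1 - q ^ 1 * q ^ 2 * (q ^ 1) ^ (n - 1 + i))
    = qfact (q ^ 1) n * qpoch (q ^ 1) (q ^ 1) n * qpoch (q ^ 1) (q ^ 2) n"
  (is "?A / ?B * ?P * ?D = ?N")
proof -
  define T where "T = (\<Prod>k=3..n. 1 - q^(2*k+1))"
  have B: "fps_nth ?B 0 = 1" by (simp add: q)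
  have P: "?P * T = (\<Prod>k=3..n. q_bracket (2*k+1) q - q^k)"
    unfolding T_def by (rule prod_divide_mult_unit, rule q_unit(2)) simp
  have BT: "?B * T = (\<Prod>j<Suc n. 1 - q ^ (2 * j + 1))"
    unfolding T_def by (rule prod_odd_from_3[OF assms])
  have b2: "q_bracket 2 z = 1 + z" for z :: "rat fps" by (simp add: q_bracket_def eval_nat_numeral)
  have A: "?A = (q_bracket 2 q * q_bracket 3 (-q) * q_bracket 4 q) * (1 - q ^ (n + 1))"
    unfolding b2[of "- _"] by simp
  have "?A / ?B * ?P * (?B * T) = (?A / ?B * ?B) * (?P * T)"
    by (simp only: ac_simps)
  also have "\<dots> = ?A * (\<Prod>k=3..n. q_bracket (2*k+1) q - q^k)"
    unfolding P fps_divide_mult_unit[OF B] ..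
  also have "\<dots> = qfact q n * qpoch q (q\<^sup>2) n * (1 - q ^ (n + 1))"
    unfolding A prod_bracket_minus[OF assms, symmetric] by (simp only: ac_simps)
  finally have U: "?A / ?B * ?P * (?B * T) = qfact q n * qpoch q (q\<^sup>2) n * (1 - q ^ (n + 1))" .
  have "?D = (\<Prod>i<n. 1 - q ^ (n + 2 + i))"
  proof (rule prod.cong)
    fix i assume "i \<in> {..<n}"
    then have "1 + 2 + 1 * (n - 1 + i) = n + 2 + i" by auto
    then show "1 - q ^ 1 * q ^ 2 * (q ^ 1) ^ (n - 1 + i) = 1 - q ^ (n + 2 + i)"
      unfolding power_add[symmetric] power_mult[symmetric] by (simp only:)
  qed simp
  then have D: "?D * (1 - q ^ (n + 1)) = ?B * T * qpoch q q n"
    unfolding BT euler_prod_shift[symmetric] by simp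
  have "?A / ?B * ?P * ?D * (1 - q ^ (n + 1)) = ?A / ?B * ?P * (?D * (1 - q ^ (n + 1)))"
    by (simp only: ac_simps)
  also have "\<dots> = ?A / ?B * ?P * (?B * T) * qpoch q q n"
    unfolding D by (simp only: ac_simps)
  also have "\<dots> = ?N * (1 - q ^ (n + 1))"
    unfolding U by (simp add: ac_simps)
  finally have "?A / ?B * ?P * ?D * (1 - q ^ (n + 1)) = ?N * (1 - q ^ (n + 1))" .
  moreover have "1 - q ^ (n + 1) \<noteq> 0" by (rule q_nonzero) simp
  ultimately show ?thesis by (rule mult_right_cancel[THEN iffD1, rotated])
qed

lemma closed_form_5:
  assumes "n \<ge> 2"
  shows "q_bracket 2 q * q_bracket 3 (-q) * q_bracket 4 q *
      (\<Prod>k=3..n. q_bracket (2*k+1) q - q^k) *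
      (\<Prod>k=1..n. (1 + q^(k+1)) / (1 - q^(n+k+2))) *
      (\<Prod>i<n. 1 - q ^ 2 * q ^ 2 * (q ^ 1) ^ (n - 1 + i))
    = qfact (q ^ 1) n * qpoch (q ^ 1) (q ^ 2) n * qpoch (q ^ 1) (q ^ 2) n"
  (is "_ * ?P * ?D = _")
proof -
  have "?D = (\<Prod>k=1..n. 1 - q^(n+k+2))"
    unfolding prod_1_eq_lessThan
  proof (rule prod.cong)
    fix i assume "i \<in> {..<n}"
    then have "2 + 2 + 1 * (n - 1 + i) = n + Suc i + 2" by auto
    then show "1 - q ^ 2 * q ^ 2 * (q ^ 1) ^ (n - 1 + i) = 1 - q ^ (n + Suc i + 2)"
      unfolding power_add[symmetric] power_mult[symmetric] by (simp only:)
  qed simp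
  then have "?P * ?D = (\<Prod>k=1..n. 1 + q^(k+1))"
    using prod_divide_mult_unit[of "{1..n}" "\<lambda>k. 1 - q^(n+k+2)" "\<lambda>k. 1 + q^(k+1)", OF q_unit(2)] by simp
  also have "\<dots> = qpoch q (q\<^sup>2) n"
    unfolding prod_1_eq_lessThan qpoch_def by (simp add: power2_eq_square mult.assoc)
  finally have PD: "?P * ?D = qpoch q (q\<^sup>2) n" .
  show ?thesis
    unfolding mult.assoc[of _ ?P] PD prod_bracket_minus[OF assms] by simp
qed

text \<open>The part shared by the two foldings into type \<open>C\<close>: the quotients cancel
  Macdonald's denominator and leave the Pochhammer product of the parameter
  \<open>s = q^2\<close>.\<close>

lemma even_divide_prod:
  assumes "\<And>i. i < n \<Longrightarrow> e + 2 * (n - 1 + i) = f (Suc i)" "\<And>k. f k > 0"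
  shows "(\<Prod>k=1..n. (1 + q^(2*k)) / (1 - q^f k)) * (\<Prod>i<n. 1 - q ^ e * (q ^ 2) ^ (n - 1 + i))
    = qpoch (q\<^sup>2) (q\<^sup>2) n"
proof -
  have "(\<Prod>i<n. 1 - q ^ e * (q ^ 2) ^ (n - 1 + i)) = (\<Prod>k=1..n. 1 - q^f k)"
    unfolding prod_1_eq_lessThan
  proof (rule prod.cong)
    fix i assume "i \<in> {..<n}"
    then have "e + 2 * (n - 1 + i) = f (Suc i)" using assms(1) by simp
    then show "1 - q ^ e * (q ^ 2) ^ (n - 1 + i) = 1 - q ^ f (Suc i)"
      unfolding power_add[symmetric] power_mult[symmetric] by (simp only:)
  qed simp
  then have "(\<Prod>k=1..n. (1 + q^(2*k)) / (1 - q^f k)) * (\<Prod>i<n. 1 - q ^ e * (q ^ 2) ^ (n - 1 + i))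
    = (\<Prod>k=1..n. 1 + q^(2*k))"
    using prod_divide_mult_unit[of "{1..n}" "\<lambda>k. 1 - q^f k" "\<lambda>k. 1 + q^(2*k)", OF q_unit(2)] assms(2) by simp
  also have "\<dots> = qpoch (q\<^sup>2) (q\<^sup>2) n"
    unfolding prod_1_eq_lessThan qpoch_def by (simp only: power_mult power_Suc)
  finally show ?thesis .
qed

lemma closed_form_6:
  "(\<Prod>k=1..2*n+1. q_bracket k ((-1)^k * q)) * (\<Prod>k=1..n. (1 + q^(2*k)) / (1 - q^(2*(n+k)+1))) *
      (\<Prod>i<n. 1 - q ^ 2 * q ^ 3 * (q ^ 2) ^ (n - 1 + i))
    = qfact (q ^ 2) n * qpoch (q ^ 2) (q ^ 2) n * qpoch (q ^ 2) (q ^ 3) n"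
  (is "_ * ?P * ?D = _")
proof -
  have PD: "?P * ?D = qpoch (q\<^sup>2) (q\<^sup>2) n"
    unfolding power_add[symmetric, of q] by (rule even_divide_prod) auto
  show ?thesis
    unfolding mult.assoc[of _ ?P] PD alt_fact_def[symmetric] alt_fact_odd' by (simp only: ac_simps)
qed

lemma closed_form_7:
  "(\<Prod>k=1..2*n. q_bracket k ((-1)^k * q)) * (\<Prod>k=1..n. (1 + q^(2*k)) / (1 - q^(2*(n+k)-1))) *
      (\<Prod>i<n. 1 - q ^ 2 * q ^ 1 * (q ^ 2) ^ (n - 1 + i))
    = qfact (q ^ 2) n * qpoch (q ^ 2) (q ^ 2) n * qpoch (q ^ 2) (q ^ 1) n"
  (is "_ * ?P * ?D = _")
proof (cases "n = 0")
  case True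
  then show ?thesis by (simp add: qfact_def qpoch_def)
next
  case False
  have PD: "?P * ?D = qpoch (q\<^sup>2) (q\<^sup>2) n"
    unfolding power_add[symmetric, of q] by (rule even_divide_prod) (use False in auto)
  show ?thesis
    unfolding mult.assoc[of _ ?P] PD alt_fact_def[symmetric] alt_fact_even by (simp add: ac_simps)
qed

end

section \<open>The seven foldings\<close>

lemma affine_A_m_sym:
  assumes "N \<ge> 2" "i \<le> N" "j \<le> N" "i \<noteq> j"
  shows "snd (affine_A N) i j = (if j = i + 1 \<or> i = j + 1 \<or> i = 0 \<and> j = N \<or> i = N \<and> j = 0 then 3 else 2)"
proof -
  interpret crystallographic "affine_A N" "{}" by (rule crystallographic_affine_A)
  consider "i < j" | "j < i" using assms by linarith
  then show ?thesis
  proof cases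
    case 1
    show ?thesis unfolding affine_A_m[OF assms(1) 1 assms(3)] using 1 by auto
  next
    case 2
    show ?thesis unfolding m_sym[of i j] affine_A_m[OF assms(1) 2 assms(2)] using 2 by auto
  qed
qed

lemma affine_B_m_sym:
  assumes "N \<ge> 3" "i \<le> N" "j \<le> N" "i \<noteq> j"
  shows "snd (affine_B N) i j = (if i = 0 \<and> j = 1 \<or> i = 1 \<and> j = 0 then 4
    else if i \<noteq> 0 \<and> j \<noteq> 0 \<and> (if j = N then i = N - 2 else if i = N then j = N - 2 else j = i + 1 \<or> i = j + 1)
    then 3 else 2)"
proof -
  interpret crystallographic "affine_B N" "{0}" by (rule crystallographic_affine_B[OF assms(1)])
  consider "i < j" | "j < i" using assms by linarith
  then show ?thesis
  proof cases
    case 1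
    show ?thesis unfolding affine_B_m[OF assms(1) 1 assms(3)] using 1 assms by auto
  next
    case 2
    show ?thesis unfolding m_sym[of i j] affine_B_m[OF assms(1) 2 assms(2)] using 2 assms by auto
  qed
qed

lemma affine_C_m_sym:
  assumes "N \<ge> 2" "i \<le> N" "j \<le> N" "i \<noteq> j"
  shows "snd (affine_C N) i j = (if j = i + 1 \<or> i = j + 1
    then if i = 0 \<or> j = 0 \<or> i = N \<or> j = N then 4 else 3 else 2)"
proof -
  interpret crystallographic "affine_C N" "{0, N}" by (rule crystallographic_affine_C[OF assms(1)])
  consider "i < j" | "j < i" using assms by linarith
  then show ?thesis
  proof cases
    case 1
    show ?thesis unfolding affine_C_m[OF assms(1) 1 assms(3)] using 1 assms by auto
  next
    case 2
    show ?thesis unfolding m_sym[of i j] affine_C_m[OF assms(1) 2 assms(2)] using 2 assms by auto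
  qed
qed

lemma affine_D_m_sym:
  assumes "N \<ge> 4" "i \<le> N" "j \<le> N" "i \<noteq> j"
  shows "snd (affine_D N) i j = (if i = 0 \<and> j = 2 \<or> i = 2 \<and> j = 0 \<or>
    i \<noteq> 0 \<and> j \<noteq> 0 \<and> (if j = N then i = N - 2 else if i = N then j = N - 2 else j = i + 1 \<or> i = j + 1)
    then 3 else 2)"
proof -
  interpret crystallographic "affine_D N" "{}" by (rule crystallographic_affine_D)
  consider "i < j" | "j < i" using assms by linarith
  then show ?thesis
  proof cases
    case 1
    show ?thesis unfolding affine_D_m[OF assms(1) 1 assms(3)] using 1 assms by auto
  next
    case 2
    show ?thesis unfolding m_sym[of i j] affine_D_m[OF assms(1) 2 assms(2)] using 2 assms by auto
  qed
qed

lemma coxeter_gen_mult: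
  assumes "a \<in> fst X" "b \<in> fst X"
  shows "coxeter_gen X a \<otimes>\<^bsub>coxeter_group X\<^esub> coxeter_gen X b = coxeter_class X [a, b]"
  using coxeter_class_mult[of "[a]" X "[b]"] assms by (simp add: coxeter_gen_def)

lemma coxeter_class_mult_gen:
  assumes "a \<in> fst X" "b \<in> fst X" "c \<in> fst X"
  shows "coxeter_class X [a, b] \<otimes>\<^bsub>coxeter_group X\<^esub> coxeter_gen X c = coxeter_class X [a, b, c]"
  using coxeter_class_mult[of "[a, b]" X "[c]"] assms by (simp add: coxeter_gen_def)

text \<open>Nodes at distance at least two in the path only need commuting images, so explicit
  compatibility is required just for neighbours: label 4 at the two ends and label 3 in
  between.\<close>

lemma affine_C_foldingI:
  fixes X :: "nat coxeter_datum" and \<psi> :: "nat \<Rightarrow> nat list"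
  assumes X: "crystallographic X A" and n: "n \<ge> 2"
    and "\<phi> \<in> hom (coxeter_group (affine_C n)) (coxeter_group X)"
    and "\<And>i. i \<le> n \<Longrightarrow> \<phi> (coxeter_gen (affine_C n) i) = coxeter_class X (\<psi> i)"
    and lists: "\<And>i. i \<le> n \<Longrightarrow> set (\<psi> i) \<subseteq> fst X" and "\<And>i. i \<le> n \<Longrightarrow> \<psi> i \<noteq> []"
    and "\<And>i. i \<le> n \<Longrightarrow> crystallographic.growing X A (\<psi> i)"
    and "\<And>i. 1 \<le> i \<Longrightarrow> i < n \<Longrightarrow> length (\<psi> i) = length (\<psi> 1)"
    and first: "crystallographic.fold_compatible X A 4 (\<psi> 0) (\<psi> 1)" "crystallographic.fold_compatible X A 4 (\<psi> 1) (\<psi> 0)"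
    and last: "crystallographic.fold_compatible X A 4 (\<psi> n) (\<psi> (n - 1))" "crystallographic.fold_compatible X A 4 (\<psi> (n - 1)) (\<psi> n)"
    and mid: "\<And>i. 1 \<le> i \<Longrightarrow> i + 1 < n \<Longrightarrow> crystallographic.fold_compatible X A 3 (\<psi> i) (\<psi> (i + 1))"
      "\<And>i. 1 \<le> i \<Longrightarrow> i + 1 < n \<Longrightarrow> crystallographic.fold_compatible X A 3 (\<psi> (i + 1)) (\<psi> i)"
    and far: "\<And>i j a b. i + 2 \<le> j \<Longrightarrow> j \<le> n \<Longrightarrow> a \<in> set (\<psi> i) \<Longrightarrow> b \<in> set (\<psi> j) \<Longrightarrow> a \<noteq> b \<and> snd X a b = 2"
  shows "affine_C_folding X A n \<psi> \<phi>"
proof (intro affine_C_folding.intro affine_C_folding_axioms.intro X n assms(3,4,6,7,8))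
  interpret crystallographic X A by (rule X)
  fix i j assume ij: "i \<le> n" "j \<le> n" "i \<noteq> j"
  note m = affine_C_m_sym[OF n ij]
  have far': "fold_compatible 2 (\<psi> i) (\<psi> j)" if "i + 2 \<le> j \<or> j + 2 \<le> i"
    using that
  proof
    assume "i + 2 \<le> j"
    then show ?thesis using far[OF _ ij(2)] lists ij by (intro fold_disjoint) blast+
  next
    assume "j + 2 \<le> i"
    then have "a \<noteq> b \<and> snd X a b = 2" if "a \<in> set (\<psi> i)" "b \<in> set (\<psi> j)" for a b
      using far[OF _ ij(1) that(2,1)] m_sym[of a b] by auto
    then show ?thesis using lists ij by (intro fold_disjoint) blast+
  qed
  consider "i + 2 \<le> j \<or> j + 2 \<le> i" | "j = i + 1" | "i = j + 1" using ij by linarith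
  then show "fold_compatible (snd (affine_C n) i j) (\<psi> i) (\<psi> j)"
  proof cases
    case 1
    then show ?thesis unfolding m using far' by auto
  next
    case 2
    then consider "i = 0" | "j = n" | "1 \<le> i" "i + 1 < n" using ij by linarith
    then show ?thesis unfolding m by cases (use 2 ij first last mid in auto)
  next
    case 3
    then consider "j = 0" | "i = n" | "1 \<le> j" "j + 1 < n" using ij by linarith
    then show ?thesis unfolding m by cases (use 3 ij first last mid in auto)
  qed
next
  show "\<psi> i \<in> lists (fst X)" if "i \<le> n" for i using lists[OF that] by auto
qed auto

text \<open>The reflection of the cycle that sends \<open>i\<close> to \<open>2*n+1-i\<close> fixes
  no node. It swaps two adjacent pairs, and each of these gives a generator of length 3.\<close>

lemma folding_A_odd_long:
  fixes n :: nat and q :: "rat fps"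
  defines "X \<equiv> affine_A (2*n+1)"
  defines "s \<equiv> coxeter_gen X" and "r \<equiv> coxeter_gen (affine_C n)"
  assumes n: "n \<ge> 2" and q: "q = fps_X" and hom: "\<phi> \<in> hom (coxeter_group (affine_C n)) (coxeter_group X)"
    and \<phi>: "\<phi> (r 0) = s 0 \<otimes>\<^bsub>coxeter_group X\<^esub> s (2*n+1) \<otimes>\<^bsub>coxeter_group X\<^esub> s 0"
      "\<phi> (r n) = s n \<otimes>\<^bsub>coxeter_group X\<^esub> s (n+1) \<otimes>\<^bsub>coxeter_group X\<^esub> s n"
      "\<forall>i\<in>{1..n-1}. \<phi> (r i) = s i \<otimes>\<^bsub>coxeter_group X\<^esub> s (2*n+1-i)"
  shows "((\<lambda>w. q ^ coxeter_length X (\<phi> w)) has_sum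
      q_bracket (n+1) (-q) * q_bracket (n+1) ((-1)^(n+1) * q) *
          (\<Prod>k\<in>{1..2*n+1} - {n+1}. q_bracket k ((-1)^k * q) / (1 + (-q)^k))) (carrier (coxeter_group (affine_C n)))"
proof -
  define \<psi> where "\<psi> i = (if i = 0 then [0, 2*n+1, 0] else if i = n then [n, n+1, n] else [i, 2*n+1-i])" for i
  have S: "fst X = {0..2*n+1}" by (simp add: X_def affine_A_def)
  define A :: "nat set" where "A = {}"
  interpret crystallographic X A unfolding X_def A_def by (rule crystallographic_affine_A)
  have m: "snd X i j = (if j = i + 1 \<or> i = j + 1 \<or> i = 0 \<and> j = 2*n+1 \<or> i = 2*n+1 \<and> j = 0 then 3 else 2)"
    if "i \<le> 2*n+1" "j \<le> 2*n+1" "i \<noteq> j" for i j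
    unfolding X_def using n by (subst affine_A_m_sym) (use that in auto)
  have "affine_C_folding X A n \<psi> \<phi>"
  proof (rule affine_C_foldingI[OF crystallographic_axioms n hom])
    fix i assume i: "i \<le> n"
    show "\<phi> (coxeter_gen (affine_C n) i) = coxeter_class X (\<psi> i)"
      using \<phi> i n unfolding s_def r_def \<psi>_def
      by (auto simp: S coxeter_gen_mult coxeter_class_mult_gen coxeter_gen_def[symmetric])
    show "set (\<psi> i) \<subseteq> fst X" using i n by (auto simp: \<psi>_def S)
    show "\<psi> i \<noteq> []" by (simp add: \<psi>_def)
    show "growing (\<psi> i)"
      using i n by (auto simp: \<psi>_def S m intro!: growing_1 growing_2 growing_3)
  next
    show "length (\<psi> i) = length (\<psi> 1)" if "1 \<le> i" "i < n" for i using that by (simp add: \<psi>_def)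
    have \<psi>: "\<psi> 0 = [0, 2*n+1, 0]" "\<psi> 1 = [1, 2*n]" "\<psi> n = [n, n+1, n]" "\<psi> (n - 1) = [n-1, n+2]"
      using n by (auto simp: \<psi>_def)
    show "fold_compatible 4 (\<psi> 0) (\<psi> 1)"
      unfolding \<psi> by (rule fold_A4(1); use n in \<open>auto simp: S m\<close>)
    show "fold_compatible 4 (\<psi> 1) (\<psi> 0)"
      unfolding \<psi> by (rule fold_A4(2); use n in \<open>auto simp: S m\<close>)
    show "fold_compatible 4 (\<psi> n) (\<psi> (n - 1))"
      unfolding \<psi> by (rule fold_A4(1); use n in \<open>auto simp: S m\<close>)
    show "fold_compatible 4 (\<psi> (n - 1)) (\<psi> n)"
      unfolding \<psi> by (rule fold_A4(2); use n in \<open>auto simp: S m\<close>)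
    fix i assume i: "1 \<le> i" "i + 1 < n"
    then have \<psi>i: "\<psi> i = [i, 2*n+1-i]" "\<psi> (i + 1) = [i+1, 2*n-i]"
      by (auto simp: \<psi>_def)
    show "fold_compatible 3 (\<psi> i) (\<psi> (i + 1))" "fold_compatible 3 (\<psi> (i + 1)) (\<psi> i)"
      unfolding \<psi>i by (rule fold_A2A2; use i in \<open>auto simp: S m\<close>)+
  next
    fix i j a b assume "i + 2 \<le> j" "j \<le> n" "a \<in> set (\<psi> i)" "b \<in> set (\<psi> j)"
    then show "a \<noteq> b \<and> snd X a b = 2" by (auto simp: \<psi>_def m split: if_splits)
  qed
  then interpret F: affine_C_folding X A n \<psi> \<phi> .
  show ?thesis
    by (rule F.has_sum_folding[OF _ _ _ q closed_form_1[OF q]]) (use n in \<open>auto simp: \<psi>_def\<close>)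
qed

text \<open>Here the reflection of the cycle swaps the adjacent nodes \<open>0\<close> and
  \<open>2*n\<close> and fixes \<open>n\<close>.\<close>

lemma folding_A_even:
  fixes n :: nat and q :: "rat fps"
  defines "X \<equiv> affine_A (2*n)"
  defines "s \<equiv> coxeter_gen X" and "r \<equiv> coxeter_gen (affine_C n)"
  assumes n: "n \<ge> 2" and q: "q = fps_X" and hom: "\<phi> \<in> hom (coxeter_group (affine_C n)) (coxeter_group X)"
    and \<phi>: "\<phi> (r 0) = s 0 \<otimes>\<^bsub>coxeter_group X\<^esub> s (2*n) \<otimes>\<^bsub>coxeter_group X\<^esub> s 0"
      "\<phi> (r n) = s n"
      "\<forall>i\<in>{1..n-1}. \<phi> (r i) = s i \<otimes>\<^bsub>coxeter_group X\<^esub> s (2*n-i)"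
  shows "((\<lambda>w. q ^ coxeter_length X (\<phi> w)) has_sum
      (\<Prod>k=1..2*n. q_bracket (k+1) ((-1)^(k+1) * q) / (1 + (-q)^k))) (carrier (coxeter_group (affine_C n)))"
proof -
  define \<psi> where "\<psi> i = (if i = 0 then [0, 2*n, 0] else if i = n then [n] else [i, 2*n-i])" for i
  have S: "fst X = {0..2*n}" by (simp add: X_def affine_A_def)
  define A :: "nat set" where "A = {}"
  interpret crystallographic X A unfolding X_def A_def by (rule crystallographic_affine_A)
  have m: "snd X i j = (if j = i + 1 \<or> i = j + 1 \<or> i = 0 \<and> j = 2*n \<or> i = 2*n \<and> j = 0 then 3 else 2)"
    if "i \<le> 2*n" "j \<le> 2*n" "i \<noteq> j" for i j
    unfolding X_def using n by (subst affine_A_m_sym) (use that in auto)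
  have "affine_C_folding X A n \<psi> \<phi>"
  proof (rule affine_C_foldingI[OF crystallographic_axioms n hom])
    fix i assume i: "i \<le> n"
    show "\<phi> (coxeter_gen (affine_C n) i) = coxeter_class X (\<psi> i)"
      using \<phi> i n unfolding s_def r_def \<psi>_def
      by (auto simp: S coxeter_gen_mult coxeter_class_mult_gen coxeter_gen_def[symmetric])
    show "set (\<psi> i) \<subseteq> fst X" using i n by (auto simp: \<psi>_def S)
    show "\<psi> i \<noteq> []" by (simp add: \<psi>_def)
    show "growing (\<psi> i)"
      using i n by (auto simp: \<psi>_def S m intro!: growing_1 growing_2 growing_3)
  next
    show "length (\<psi> i) = length (\<psi> 1)" if "1 \<le> i" "i < n" for i using that by (simp add: \<psi>_def)
    have \<psi>: "\<psi> 0 = [0, 2*n, 0]" "\<psi> 1 = [1, 2*n-1]" "\<psi> n = [n]" "\<psi> (n - 1) = [n-1, n+1]"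
      using n by (auto simp: \<psi>_def)
    show "fold_compatible 4 (\<psi> 0) (\<psi> 1)"
      unfolding \<psi> by (rule fold_A4(1); use n in \<open>auto simp: S m\<close>)
    show "fold_compatible 4 (\<psi> 1) (\<psi> 0)"
      unfolding \<psi> by (rule fold_A4(2); use n in \<open>auto simp: S m\<close>)
    show "fold_compatible 4 (\<psi> n) (\<psi> (n - 1))"
      unfolding \<psi> by (rule fold_A3(1); use n in \<open>auto simp: S m\<close>)
    show "fold_compatible 4 (\<psi> (n - 1)) (\<psi> n)"
      unfolding \<psi> by (rule fold_A3(2); use n in \<open>auto simp: S m\<close>)
    fix i assume i: "1 \<le> i" "i + 1 < n"
    then have \<psi>i: "\<psi> i = [i, 2*n-i]" "\<psi> (i + 1) = [i+1, 2*n-(i+1)]"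
      by (auto simp: \<psi>_def)
    show "fold_compatible 3 (\<psi> i) (\<psi> (i + 1))" "fold_compatible 3 (\<psi> (i + 1)) (\<psi> i)"
      unfolding \<psi>i by (rule fold_A2A2; use i in \<open>auto simp: S m\<close>)+
  next
    fix i j a b assume "i + 2 \<le> j" "j \<le> n" "a \<in> set (\<psi> i)" "b \<in> set (\<psi> j)"
    then show "a \<noteq> b \<and> snd X a b = 2" by (auto simp: \<psi>_def m split: if_splits)
  qed
  then interpret F: affine_C_folding X A n \<psi> \<phi> .
  show ?thesis
    by (rule F.has_sum_folding[OF _ _ _ q closed_form_2[OF q]]) (use n in \<open>auto simp: \<psi>_def\<close>)
qed

text \<open>Here the reflection of the cycle fixes the opposite nodes \<open>0\<close> and
  \<open>n\<close>.\<close>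

lemma folding_A_odd_short:
  fixes n :: nat and q :: "rat fps"
  defines "X \<equiv> affine_A (2*n-1)"
  defines "s \<equiv> coxeter_gen X" and "r \<equiv> coxeter_gen (affine_C n)"
  assumes n: "n \<ge> 2" and q: "q = fps_X" and hom: "\<phi> \<in> hom (coxeter_group (affine_C n)) (coxeter_group X)"
    and \<phi>: "\<phi> (r 0) = s 0"
      "\<phi> (r n) = s n"
      "\<forall>i\<in>{1..n-1}. \<phi> (r i) = s i \<otimes>\<^bsub>coxeter_group X\<^esub> s (2*n-i)"
  shows "((\<lambda>w. q ^ coxeter_length X (\<phi> w)) has_sum
      (\<Prod>k=2..2*n. q_bracket k ((-1)^k * q) / (1 + (-q)^(k-1)))) (carrier (coxeter_group (affine_C n)))"
proof -
  define \<psi> where "\<psi> i = (if i = 0 then [0] else if i = n then [n] else [i, 2*n-i])" for i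
  have S: "fst X = {0..2*n-1}" by (simp add: X_def affine_A_def)
  define A :: "nat set" where "A = {}"
  interpret crystallographic X A unfolding X_def A_def by (rule crystallographic_affine_A)
  have m: "snd X i j = (if j = i + 1 \<or> i = j + 1 \<or> i = 0 \<and> j = 2*n-1 \<or> i = 2*n-1 \<and> j = 0 then 3 else 2)"
    if "i \<le> 2*n-1" "j \<le> 2*n-1" "i \<noteq> j" for i j
    unfolding X_def using n by (subst affine_A_m_sym) (use that in auto)
  have "affine_C_folding X A n \<psi> \<phi>"
  proof (rule affine_C_foldingI[OF crystallographic_axioms n hom])
    fix i assume i: "i \<le> n"
    show "\<phi> (coxeter_gen (affine_C n) i) = coxeter_class X (\<psi> i)"
      using \<phi> i n unfolding s_def r_def \<psi>_def
      by (auto simp: S coxeter_gen_mult coxeter_class_mult_gen coxeter_gen_def[symmetric])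
    show "set (\<psi> i) \<subseteq> fst X" using i n by (auto simp: \<psi>_def S)
    show "\<psi> i \<noteq> []" by (simp add: \<psi>_def)
    show "growing (\<psi> i)"
      using i n by (auto simp: \<psi>_def S m intro!: growing_1 growing_2 growing_3)
  next
    show "length (\<psi> i) = length (\<psi> 1)" if "1 \<le> i" "i < n" for i using that by (simp add: \<psi>_def)
    have \<psi>: "\<psi> 0 = [0]" "\<psi> 1 = [1, 2*n-1]" "\<psi> n = [n]" "\<psi> (n - 1) = [n-1, n+1]"
      using n by (auto simp: \<psi>_def)
    show "fold_compatible 4 (\<psi> 0) (\<psi> 1)"
      unfolding \<psi> by (rule fold_A3(1); use n in \<open>auto simp: S m\<close>)
    show "fold_compatible 4 (\<psi> 1) (\<psi> 0)"
      unfolding \<psi> by (rule fold_A3(2); use n in \<open>auto simp: S m\<close>)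
    show "fold_compatible 4 (\<psi> n) (\<psi> (n - 1))"
      unfolding \<psi> by (rule fold_A3(1); use n in \<open>auto simp: S m\<close>)
    show "fold_compatible 4 (\<psi> (n - 1)) (\<psi> n)"
      unfolding \<psi> by (rule fold_A3(2); use n in \<open>auto simp: S m\<close>)
    fix i assume i: "1 \<le> i" "i + 1 < n"
    then have \<psi>i: "\<psi> i = [i, 2*n-i]" "\<psi> (i + 1) = [i+1, 2*n-(i+1)]"
      by (auto simp: \<psi>_def)
    show "fold_compatible 3 (\<psi> i) (\<psi> (i + 1))" "fold_compatible 3 (\<psi> (i + 1)) (\<psi> i)"
      unfolding \<psi>i by (rule fold_A2A2; use i in \<open>auto simp: S m\<close>)+
  next
    fix i j a b assume "i + 2 \<le> j" "j \<le> n" "a \<in> set (\<psi> i)" "b \<in> set (\<psi> j)"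
    then show "a \<noteq> b \<and> snd X a b = 2" by (auto simp: \<psi>_def m split: if_splits)
  qed
  then interpret F: affine_C_folding X A n \<psi> \<phi> .
  show ?thesis
    by (rule F.has_sum_folding[OF _ _ _ q closed_form_3[OF q]]) (use n in \<open>auto simp: \<psi>_def\<close>)
qed

text \<open>The two branches \<open>n\<close> and \<open>n+1\<close> of the fork are merged; the
  bond of label 4 at the other end is kept.\<close>

lemma folding_B:
  fixes n :: nat and q :: "rat fps"
  defines "X \<equiv> affine_B (n+1)"
  defines "s \<equiv> coxeter_gen X" and "r \<equiv> coxeter_gen (affine_C n)"
  assumes n: "n \<ge> 2" and q: "q = fps_X" and hom: "\<phi> \<in> hom (coxeter_group (affine_C n)) (coxeter_group X)"
    and \<phi>: "\<forall>j\<in>{0..n-1}. \<phi> (r j) = s j"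
      "\<phi> (r n) = s n \<otimes>\<^bsub>coxeter_group X\<^esub> s (n+1)"
  shows "((\<lambda>w. q ^ coxeter_length X (\<phi> w)) has_sum
      (q_bracket 2 q * q_bracket 3 (-q) * q_bracket 4 q * q_bracket 2 (-(q^(n+1))))
            / ((1 - q) * (1 - q^3) * (1 - q^5)) *
          (\<Prod>k=3..n. (q_bracket (2*k+1) q - q^k) / (1 - q^(2*k+1)))) (carrier (coxeter_group (affine_C n)))"
proof -
  define \<psi> where "\<psi> i = (if i = n then [n, n+1] else [i])" for i
  have S: "fst X = {0..n+1}" by (simp add: X_def affine_B_def)
  define A :: "nat set" where "A = {0}"
  interpret crystallographic X A unfolding X_def A_def by (rule crystallographic_affine_B) (use n in simp)
  have m: "snd X i j = (if i = 0 \<and> j = 1 \<or> i = 1 \<and> j = 0 then 4 else if i \<noteq> 0 \<and> j \<noteq> 0 \<and>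
      (if j = n+1 then i = n - 1 else if i = n+1 then j = n - 1 else j = i + 1 \<or> i = j + 1) then 3 else 2)"
    if "i \<le> n+1" "j \<le> n+1" "i \<noteq> j" for i j
    unfolding X_def using n by (subst affine_B_m_sym) (use that in auto)
  have "affine_C_folding X A n \<psi> \<phi>"
  proof (rule affine_C_foldingI[OF crystallographic_axioms n hom])
    fix i assume i: "i \<le> n"
    show "\<phi> (coxeter_gen (affine_C n) i) = coxeter_class X (\<psi> i)"
      using \<phi> i n unfolding s_def r_def \<psi>_def
      by (auto simp: S coxeter_gen_mult coxeter_class_mult_gen coxeter_gen_def[symmetric])
    show "set (\<psi> i) \<subseteq> fst X" using i n by (auto simp: \<psi>_def S)
    show "\<psi> i \<noteq> []" by (simp add: \<psi>_def)
    show "growing (\<psi> i)"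
      using i n by (auto simp: \<psi>_def S m intro!: growing_1 growing_2 growing_3)
  next
    show "length (\<psi> i) = length (\<psi> 1)" if "1 \<le> i" "i < n" for i using that by (simp add: \<psi>_def)
    have \<psi>: "\<psi> 0 = [0]" "\<psi> 1 = [1]" "\<psi> n = [n, n+1]" "\<psi> (n - 1) = [n-1]"
      using n by (auto simp: \<psi>_def)
    show "fold_compatible 4 (\<psi> 0) (\<psi> 1)"
      unfolding \<psi> by (rule fold_B2; use n in \<open>auto simp: S m\<close>)
    show "fold_compatible 4 (\<psi> 1) (\<psi> 0)"
      unfolding \<psi> by (rule fold_B2; use n in \<open>auto simp: S m\<close>)
    show "fold_compatible 4 (\<psi> n) (\<psi> (n - 1))"
      unfolding \<psi> by (rule fold_A3(2); use n in \<open>auto simp: S m\<close>)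
    show "fold_compatible 4 (\<psi> (n - 1)) (\<psi> n)"
      unfolding \<psi> by (rule fold_A3(1); use n in \<open>auto simp: S m\<close>)
    fix i assume i: "1 \<le> i" "i + 1 < n"
    then have \<psi>i: "\<psi> i = [i]" "\<psi> (i + 1) = [i+1]"
      by (auto simp: \<psi>_def)
    show "fold_compatible 3 (\<psi> i) (\<psi> (i + 1))" "fold_compatible 3 (\<psi> (i + 1)) (\<psi> i)"
      unfolding \<psi>i by (rule fold_A2; use i in \<open>auto simp: S m\<close>)+
  next
    fix i j a b assume "i + 2 \<le> j" "j \<le> n" "a \<in> set (\<psi> i)" "b \<in> set (\<psi> j)"
    then show "a \<noteq> b \<and> snd X a b = 2" by (auto simp: \<psi>_def m split: if_splits)
  qed
  then interpret F: affine_C_folding X A n \<psi> \<phi> .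
  show ?thesis
    by (rule F.has_sum_folding[OF _ _ _ q closed_form_4[OF q n]]) (use n in \<open>auto simp: \<psi>_def\<close>)
qed

text \<open>Both forks are merged, which shifts the inner nodes by one.\<close>

lemma folding_D:
  fixes n :: nat and q :: "rat fps"
  defines "X \<equiv> affine_D (n+2)"
  defines "s \<equiv> coxeter_gen X" and "r \<equiv> coxeter_gen (affine_C n)"
  assumes n: "n \<ge> 2" and q: "q = fps_X" and hom: "\<phi> \<in> hom (coxeter_group (affine_C n)) (coxeter_group X)"
    and \<phi>: "\<phi> (r 0) = s 0 \<otimes>\<^bsub>coxeter_group X\<^esub> s 1"
      "\<phi> (r n) = s (n+1) \<otimes>\<^bsub>coxeter_group X\<^esub> s (n+2)"
      "\<forall>i\<in>{1..n-1}. \<phi> (r i) = s (i+1)"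
  shows "((\<lambda>w. q ^ coxeter_length X (\<phi> w)) has_sum
      q_bracket 2 q * q_bracket 3 (-q) * q_bracket 4 q *
          (\<Prod>k=3..n. q_bracket (2*k+1) q - q^k) *
          (\<Prod>k=1..n. (1 + q^(k+1)) / (1 - q^(n+k+2)))) (carrier (coxeter_group (affine_C n)))"
proof -
  define \<psi> where "\<psi> i = (if i = 0 then [0, 1] else if i = n then [n+1, n+2] else [i+1])" for i
  have S: "fst X = {0..n+2}" by (simp add: X_def affine_D_def)
  define A :: "nat set" where "A = {}"
  interpret crystallographic X A unfolding X_def A_def by (rule crystallographic_affine_D)
  have m: "snd X i j = (if i = 0 \<and> j = 2 \<or> i = 2 \<and> j = 0 \<or> i \<noteq> 0 \<and> j \<noteq> 0 \<and>
      (if j = n+2 then i = n else if i = n+2 then j = n else j = i + 1 \<or> i = j + 1) then 3 else 2)"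
    if "i \<le> n+2" "j \<le> n+2" "i \<noteq> j" for i j
    unfolding X_def using n by (subst affine_D_m_sym) (use that in auto)
  have "affine_C_folding X A n \<psi> \<phi>"
  proof (rule affine_C_foldingI[OF crystallographic_axioms n hom])
    fix i assume i: "i \<le> n"
    show "\<phi> (coxeter_gen (affine_C n) i) = coxeter_class X (\<psi> i)"
      using \<phi> i n unfolding s_def r_def \<psi>_def
      by (auto simp: S coxeter_gen_mult coxeter_class_mult_gen coxeter_gen_def[symmetric])
    show "set (\<psi> i) \<subseteq> fst X" using i n by (auto simp: \<psi>_def S)
    show "\<psi> i \<noteq> []" by (simp add: \<psi>_def)
    show "growing (\<psi> i)"
      using i n by (auto simp: \<psi>_def S m intro!: growing_1 growing_2 growing_3)
  next
    show "length (\<psi> i) = length (\<psi> 1)" if "1 \<le> i" "i < n" for i using that by (simp add: \<psi>_def)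
    have \<psi>: "\<psi> 0 = [0, 1]" "\<psi> 1 = [2]" "\<psi> n = [n+1, n+2]" "\<psi> (n - 1) = [n]"
      using n by (auto simp: \<psi>_def)
    show "fold_compatible 4 (\<psi> 0) (\<psi> 1)"
      unfolding \<psi> by (rule fold_A3(2); use n in \<open>auto simp: S m\<close>)
    show "fold_compatible 4 (\<psi> 1) (\<psi> 0)"
      unfolding \<psi> by (rule fold_A3(1); use n in \<open>auto simp: S m\<close>)
    show "fold_compatible 4 (\<psi> n) (\<psi> (n - 1))"
      unfolding \<psi> by (rule fold_A3(2); use n in \<open>auto simp: S m\<close>)
    show "fold_compatible 4 (\<psi> (n - 1)) (\<psi> n)"
      unfolding \<psi> by (rule fold_A3(1); use n in \<open>auto simp: S m\<close>)
    fix i assume i: "1 \<le> i" "i + 1 < n"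
    then have \<psi>i: "\<psi> i = [i+1]" "\<psi> (i + 1) = [i+2]"
      by (auto simp: \<psi>_def)
    show "fold_compatible 3 (\<psi> i) (\<psi> (i + 1))" "fold_compatible 3 (\<psi> (i + 1)) (\<psi> i)"
      unfolding \<psi>i by (rule fold_A2; use i in \<open>auto simp: S m\<close>)+
  next
    fix i j a b assume "i + 2 \<le> j" "j \<le> n" "a \<in> set (\<psi> i)" "b \<in> set (\<psi> j)"
    then show "a \<noteq> b \<and> snd X a b = 2" by (auto simp: \<psi>_def m split: if_splits)
  qed
  then interpret F: affine_C_folding X A n \<psi> \<phi> .
  show ?thesis
    by (rule F.has_sum_folding[OF _ _ _ q closed_form_5[OF q n]]) (use n in \<open>auto simp: \<psi>_def\<close>)
qed

text \<open>The path is folded in the middle of its bond between \<open>n\<close> and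
  \<open>n+1\<close>, so its two bonds of label 4 fall on each other and \<open>n\<close>,
  \<open>n+1\<close> give a generator of length 3.\<close>

lemma folding_C_odd:
  fixes n :: nat and q :: "rat fps"
  defines "X \<equiv> affine_C (2*n+1)"
  defines "s \<equiv> coxeter_gen X" and "r \<equiv> coxeter_gen (affine_C n)"
  assumes n: "n \<ge> 2" and q: "q = fps_X" and hom: "\<phi> \<in> hom (coxeter_group (affine_C n)) (coxeter_group X)"
    and \<phi>: "\<forall>j\<in>{0..n-1}. \<phi> (r j) = s j \<otimes>\<^bsub>coxeter_group X\<^esub> s (2*n+1-j)"
      "\<phi> (r n) = s n \<otimes>\<^bsub>coxeter_group X\<^esub> s (n+1) \<otimes>\<^bsub>coxeter_group X\<^esub> s n"
  shows "((\<lambda>w. q ^ coxeter_length X (\<phi> w)) has_sum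
      (\<Prod>k=1..2*n+1. q_bracket k ((-1)^k * q)) *
          (\<Prod>k=1..n. (1 + q^(2*k)) / (1 - q^(2*(n+k)+1)))) (carrier (coxeter_group (affine_C n)))"
proof -
  define \<psi> where "\<psi> i = (if i = n then [n, n+1, n] else [i, 2*n+1-i])" for i
  have S: "fst X = {0..2*n+1}" by (simp add: X_def affine_C_def)
  define A :: "nat set" where "A = {0, 2*n+1}"
  interpret crystallographic X A unfolding X_def A_def by (rule crystallographic_affine_C) (use n in simp)
  have m: "snd X i j = (if j = i + 1 \<or> i = j + 1 then if i = 0 \<or> j = 0 \<or> i = 2*n+1 \<or> j = 2*n+1 then 4 else 3 else 2)"
    if "i \<le> 2*n+1" "j \<le> 2*n+1" "i \<noteq> j" for i j
    unfolding X_def using n by (subst affine_C_m_sym) (use that in auto)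
  have "affine_C_folding X A n \<psi> \<phi>"
  proof (rule affine_C_foldingI[OF crystallographic_axioms n hom])
    fix i assume i: "i \<le> n"
    show "\<phi> (coxeter_gen (affine_C n) i) = coxeter_class X (\<psi> i)"
      using \<phi> i n unfolding s_def r_def \<psi>_def
      by (auto simp: S coxeter_gen_mult coxeter_class_mult_gen coxeter_gen_def[symmetric])
    show "set (\<psi> i) \<subseteq> fst X" using i n by (auto simp: \<psi>_def S)
    show "\<psi> i \<noteq> []" by (simp add: \<psi>_def)
    show "growing (\<psi> i)"
      using i n by (auto simp: \<psi>_def S m intro!: growing_1 growing_2 growing_3)
  next
    show "length (\<psi> i) = length (\<psi> 1)" if "1 \<le> i" "i < n" for i using that by (simp add: \<psi>_def)
    have \<psi>: "\<psi> 0 = [0, 2*n+1]" "\<psi> 1 = [1, 2*n]" "\<psi> n = [n, n+1, n]" "\<psi> (n - 1) = [n-1, n+2]"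
      using n by (auto simp: \<psi>_def)
    show "fold_compatible 4 (\<psi> 0) (\<psi> 1)"
      unfolding \<psi> by (rule fold_B2B2; use n in \<open>auto simp: S m\<close>)
    show "fold_compatible 4 (\<psi> 1) (\<psi> 0)"
      unfolding \<psi> by (rule fold_B2B2; use n in \<open>auto simp: S m\<close>)
    show "fold_compatible 4 (\<psi> n) (\<psi> (n - 1))"
      unfolding \<psi> by (rule fold_A4(1); use n in \<open>auto simp: S m\<close>)
    show "fold_compatible 4 (\<psi> (n - 1)) (\<psi> n)"
      unfolding \<psi> by (rule fold_A4(2); use n in \<open>auto simp: S m\<close>)
    fix i assume i: "1 \<le> i" "i + 1 < n"
    then have \<psi>i: "\<psi> i = [i, 2*n+1-i]" "\<psi> (i + 1) = [i+1, 2*n-i]"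
      by (auto simp: \<psi>_def)
    show "fold_compatible 3 (\<psi> i) (\<psi> (i + 1))" "fold_compatible 3 (\<psi> (i + 1)) (\<psi> i)"
      unfolding \<psi>i by (rule fold_A2A2; use i in \<open>auto simp: S m\<close>)+
  next
    fix i j a b assume "i + 2 \<le> j" "j \<le> n" "a \<in> set (\<psi> i)" "b \<in> set (\<psi> j)"
    then show "a \<noteq> b \<and> snd X a b = 2" by (auto simp: \<psi>_def m split: if_splits)
  qed
  then interpret F: affine_C_folding X A n \<psi> \<phi> .
  show ?thesis
    by (rule F.has_sum_folding[OF _ _ _ q closed_form_6[OF q]]) (use n in \<open>auto simp: \<psi>_def\<close>)
qed

text \<open>The path is folded at its middle node \<open>n\<close>, which keeps length 1.\<close>

lemma folding_C_even:
  fixes n :: nat and q :: "rat fps"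
  defines "X \<equiv> affine_C (2*n)"
  defines "s \<equiv> coxeter_gen X" and "r \<equiv> coxeter_gen (affine_C n)"
  assumes n: "n \<ge> 2" and q: "q = fps_X" and hom: "\<phi> \<in> hom (coxeter_group (affine_C n)) (coxeter_group X)"
    and \<phi>: "\<forall>j\<in>{0..n-1}. \<phi> (r j) = s j \<otimes>\<^bsub>coxeter_group X\<^esub> s (2*n-j)"
      "\<phi> (r n) = s n"
  shows "((\<lambda>w. q ^ coxeter_length X (\<phi> w)) has_sum
      (\<Prod>k=1..2*n. q_bracket k ((-1)^k * q)) *
          (\<Prod>k=1..n. (1 + q^(2*k)) / (1 - q^(2*(n+k)-1)))) (carrier (coxeter_group (affine_C n)))"
proof -
  define \<psi> where "\<psi> i = (if i = n then [n] else [i, 2*n-i])" for i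
  have S: "fst X = {0..2*n}" by (simp add: X_def affine_C_def)
  define A :: "nat set" where "A = {0, 2*n}"
  interpret crystallographic X A unfolding X_def A_def by (rule crystallographic_affine_C) (use n in simp)
  have m: "snd X i j = (if j = i + 1 \<or> i = j + 1 then if i = 0 \<or> j = 0 \<or> i = 2*n \<or> j = 2*n then 4 else 3 else 2)"
    if "i \<le> 2*n" "j \<le> 2*n" "i \<noteq> j" for i j
    unfolding X_def using n by (subst affine_C_m_sym) (use that in auto)
  have "affine_C_folding X A n \<psi> \<phi>"
  proof (rule affine_C_foldingI[OF crystallographic_axioms n hom])
    fix i assume i: "i \<le> n"
    show "\<phi> (coxeter_gen (affine_C n) i) = coxeter_class X (\<psi> i)"
      using \<phi> i n unfolding s_def r_def \<psi>_def
      by (auto simp: S coxeter_gen_mult coxeter_class_mult_gen coxeter_gen_def[symmetric])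
    show "set (\<psi> i) \<subseteq> fst X" using i n by (auto simp: \<psi>_def S)
    show "\<psi> i \<noteq> []" by (simp add: \<psi>_def)
    show "growing (\<psi> i)"
      using i n by (auto simp: \<psi>_def S m intro!: growing_1 growing_2 growing_3)
  next
    show "length (\<psi> i) = length (\<psi> 1)" if "1 \<le> i" "i < n" for i using that by (simp add: \<psi>_def)
    have \<psi>: "\<psi> 0 = [0, 2*n]" "\<psi> 1 = [1, 2*n-1]" "\<psi> n = [n]" "\<psi> (n - 1) = [n-1, n+1]"
      using n by (auto simp: \<psi>_def)
    show "fold_compatible 4 (\<psi> 0) (\<psi> 1)"
      unfolding \<psi> by (rule fold_B2B2; use n in \<open>auto simp: S m\<close>)
    show "fold_compatible 4 (\<psi> 1) (\<psi> 0)"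
      unfolding \<psi> by (rule fold_B2B2; use n in \<open>auto simp: S m\<close>)
    show "fold_compatible 4 (\<psi> n) (\<psi> (n - 1))"
      unfolding \<psi> by (rule fold_A3(1); use n in \<open>auto simp: S m\<close>)
    show "fold_compatible 4 (\<psi> (n - 1)) (\<psi> n)"
      unfolding \<psi> by (rule fold_A3(2); use n in \<open>auto simp: S m\<close>)
    fix i assume i: "1 \<le> i" "i + 1 < n"
    then have \<psi>i: "\<psi> i = [i, 2*n-i]" "\<psi> (i + 1) = [i+1, 2*n-(i+1)]"
      by (auto simp: \<psi>_def)
    show "fold_compatible 3 (\<psi> i) (\<psi> (i + 1))" "fold_compatible 3 (\<psi> (i + 1)) (\<psi> i)"
      unfolding \<psi>i by (rule fold_A2A2; use i in \<open>auto simp: S m\<close>)+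
  next
    fix i j a b assume "i + 2 \<le> j" "j \<le> n" "a \<in> set (\<psi> i)" "b \<in> set (\<psi> j)"
    then show "a \<noteq> b \<and> snd X a b = 2" by (auto simp: \<psi>_def m split: if_splits)
  qed
  then interpret F: affine_C_folding X A n \<psi> \<phi> .
  show ?thesis
    by (rule F.has_sum_folding[OF _ _ _ q closed_form_7[OF q]]) (use n in \<open>auto simp: \<psi>_def\<close>)
qed

theorem theorem1p9:
  fixes n :: nat
    and q :: "rat fps"
    and C :: "nat list set monoid"
    and r :: "nat \<Rightarrow> nat list set"
  assumes "n \<ge> 2"
    and "q = fps_X"
    and "C = coxeter_group (affine_C n)"
    and "r = coxeter_gen (affine_C n)"
  shows
    "(let X = affine_A (2*n+1); W = coxeter_group X; s = coxeter_gen X in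
      \<forall>\<phi>\<in>hom C W.
        \<phi> (r 0) = s 0 \<otimes>\<^bsub>W\<^esub> s (2*n+1) \<otimes>\<^bsub>W\<^esub> s 0 \<and>
        \<phi> (r n) = s n \<otimes>\<^bsub>W\<^esub> s (n+1) \<otimes>\<^bsub>W\<^esub> s n \<and>
        (\<forall>i\<in>{1..n-1}. \<phi> (r i) = s i \<otimes>\<^bsub>W\<^esub> s (2*n+1-i)) \<longrightarrow>
        ((\<lambda>w. q ^ coxeter_length X (\<phi> w)) has_sum
          q_bracket (n+1) (-q) * q_bracket (n+1) ((-1)^(n+1) * q) *
          (\<Prod>k\<in>{1..2*n+1} - {n+1}. q_bracket k ((-1)^k * q) / (1 + (-q)^k))) (carrier C))
   \<and> (let X = affine_A (2*n); W = coxeter_group X; s = coxeter_gen X in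
      \<forall>\<phi>\<in>hom C W.
        \<phi> (r 0) = s 0 \<otimes>\<^bsub>W\<^esub> s (2*n) \<otimes>\<^bsub>W\<^esub> s 0 \<and>
        \<phi> (r n) = s n \<and>
        (\<forall>i\<in>{1..n-1}. \<phi> (r i) = s i \<otimes>\<^bsub>W\<^esub> s (2*n-i)) \<longrightarrow>
        ((\<lambda>w. q ^ coxeter_length X (\<phi> w)) has_sum
          (\<Prod>k=1..2*n. q_bracket (k+1) ((-1)^(k+1) * q) / (1 + (-q)^k))) (carrier C))
   \<and> (let X = affine_A (2*n-1); W = coxeter_group X; s = coxeter_gen X in
      \<forall>\<phi>\<in>hom C W.
        \<phi> (r 0) = s 0 \<and>
        \<phi> (r n) = s n \<and>
        (\<forall>i\<in>{1..n-1}. \<phi> (r i) = s i \<otimes>\<^bsub>W\<^esub> s (2*n-i)) \<longrightarrow>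
        ((\<lambda>w. q ^ coxeter_length X (\<phi> w)) has_sum
          (\<Prod>k=2..2*n. q_bracket k ((-1)^k * q) / (1 + (-q)^(k-1)))) (carrier C))
   \<and> (let X = affine_B (n+1); W = coxeter_group X; s = coxeter_gen X in
      \<forall>\<phi>\<in>hom C W.
        (\<forall>j\<in>{0..n-1}. \<phi> (r j) = s j) \<and>
        \<phi> (r n) = s n \<otimes>\<^bsub>W\<^esub> s (n+1) \<longrightarrow>
        ((\<lambda>w. q ^ coxeter_length X (\<phi> w)) has_sum
          (q_bracket 2 q * q_bracket 3 (-q) * q_bracket 4 q * q_bracket 2 (-(q^(n+1))))
            / ((1 - q) * (1 - q^3) * (1 - q^5)) *
          (\<Prod>k=3..n. (q_bracket (2*k+1) q - q^k) / (1 - q^(2*k+1)))) (carrier C))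
   \<and> (let X = affine_D (n+2); W = coxeter_group X; s = coxeter_gen X in
      \<forall>\<phi>\<in>hom C W.
        \<phi> (r 0) = s 0 \<otimes>\<^bsub>W\<^esub> s 1 \<and>
        \<phi> (r n) = s (n+1) \<otimes>\<^bsub>W\<^esub> s (n+2) \<and>
        (\<forall>i\<in>{1..n-1}. \<phi> (r i) = s (i+1)) \<longrightarrow>
        ((\<lambda>w. q ^ coxeter_length X (\<phi> w)) has_sum
          q_bracket 2 q * q_bracket 3 (-q) * q_bracket 4 q *
          (\<Prod>k=3..n. q_bracket (2*k+1) q - q^k) *
          (\<Prod>k=1..n. (1 + q^(k+1)) / (1 - q^(n+k+2)))) (carrier C))
   \<and> (let X = affine_C (2*n+1); W = coxeter_group X; s = coxeter_gen X in
      \<forall>\<phi>\<in>hom C W.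
        (\<forall>j\<in>{0..n-1}. \<phi> (r j) = s j \<otimes>\<^bsub>W\<^esub> s (2*n+1-j)) \<and>
        \<phi> (r n) = s n \<otimes>\<^bsub>W\<^esub> s (n+1) \<otimes>\<^bsub>W\<^esub> s n \<longrightarrow>
        ((\<lambda>w. q ^ coxeter_length X (\<phi> w)) has_sum
          (\<Prod>k=1..2*n+1. q_bracket k ((-1)^k * q)) *
          (\<Prod>k=1..n. (1 + q^(2*k)) / (1 - q^(2*(n+k)+1)))) (carrier C))
   \<and> (let X = affine_C (2*n); W = coxeter_group X; s = coxeter_gen X in
      \<forall>\<phi>\<in>hom C W.
        (\<forall>j\<in>{0..n-1}. \<phi> (r j) = s j \<otimes>\<^bsub>W\<^esub> s (2*n-j)) \<and>
        \<phi> (r n) = s n \<longrightarrow>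
        ((\<lambda>w. q ^ coxeter_length X (\<phi> w)) has_sum
          (\<Prod>k=1..2*n. q_bracket k ((-1)^k * q)) *
          (\<Prod>k=1..n. (1 + q^(2*k)) / (1 - q^(2*(n+k)-1)))) (carrier C))"
proof -
  note qCr = assms(2-4)
  show ?thesis
    unfolding Let_def qCr(2,3)
    by (intro conjI ballI impI; elim conjE)
      (rule folding_A_odd_long[OF assms(1,2)] folding_A_even[OF assms(1,2)] folding_A_odd_short[OF assms(1,2)]
        folding_B[OF assms(1,2)] folding_D[OF assms(1,2)] folding_C_odd[OF assms(1,2)] folding_C_even[OF assms(1,2)];
        assumption)+
qed

end
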